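(* Let $\mathfrak h$ be a Lie subalgebra of $\mathfrak{sp}_2(\mathbb R)=\mathfrak{sp}(V)$, where $(V,\Omega)$ is the real symplectic vector space of dimension $4$. Then $\mathfrak h$ is either of infinite type or it is, up to conjugation by an element of $\mathrm{Sp}(V)$, a subalgebra of one of the Lie algebras of the following list: 1. the unitary algebra $\mathfrak u_2$ (the maximal compact subalgebra of $\mathfrak{sp}_2(\mathbb R)$); 2. the pseudo-unitary algebra $\mathfrak u_{1,1}=\mathfrak{sl}(H)\oplus\mathfrak{so}(E)\subset\mathfrak{sp}(H\otimes E)$, where $V=H\otimes E=\mathbb R^2\otimes\mathbb R^2$ and the symplectic structure is the tensor product $\Omega=\mathrm{vol}_H\otimes\eta_E$ of the volume form on $H$ and a Euclidean metric on $E$; 3. the reductive subalgebra $Q\vee P\cong\mathfrak{gl}(P)$, where $P$ and $Q$ are complementary Lagrangian subspaces of $V$; 4. the irreducible subalgebra $\mathfrak{sl}_2^4(\mathbb R)$, i.e. the image of $\mathfrak{sl}_2(\mathbb R)$ acting on $V=S^3(\mathbb R^2)$; 5. the direct sum $\mathfrak{so}_2(\mathbb R)\oplus\mathbb R\,\mathrm{diag}(1,-1)$ of two Cartan subalgebras of $\mathfrak{sl}_2(\mathbb R)$, one compact and one noncompact (inside $\mathfrak{sp}(V_1)\oplus\mathfrak{sp}(V_2)\cong\mathfrak{sl}_2(\mathbb R)\oplus\mathfrak{sl}_2(\mathbb R)$); 6. the solvable $2$-dimensional subalgebra $D_{4,12}=\mathrm{span}(p_1q_1+\epsilon p_2^2,\;p_2q_1)$,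 where $\epsilon=\pm1$; 7. the $1$-dimensional subalgebra $\mathrm{span}(p_2^2+q_2^2+\epsilon p_1^2)$, where $\epsilon=\pm1$. All these subalgebras are maximal finite type subalgebras (i.e. maximal among the finite type subalgebras of $\mathfrak{sp}_2(\mathbb R)$). In particular a finite type subalgebra of $\mathfrak{sp}_2(\mathbb R)$ has dimension at most $4$.
   Context: $V=\mathrm{span}(p_1,p_2,q_1,q_2)$ with symplectic form $\Omega=-(p_1^*\wedge q_1^*+p_2^*\wedge q_2^* )$, so $\Omega(q_i,p_i)=1$. The Lie algebra $\mathfrak{sp}(V)=\mathfrak{sp}_2(\mathbb R)$ is identified with the space $S^2(V)$ of quadratic polynomials: $uv\in S^2(V)$ acts by $w\mapsto\Omega(u,w)v+\Omega(v,w)u$. $V_i=\mathrm{span}(p_i,q_i)$, $i=1,2$. For complementary Lagrangian subspaces, e.g. $P=\mathrm{span}(p_1,p_2)$, $Q=\mathrm{span}(q_1,q_2)$, $Q\vee P\subset S^2(V)$ is the span of the products $qp$, $q\in Q,p\in P$. $S^3(\mathbb R^2)$ is given its $\mathfrak{sl}_2(\mathbb R)$-invariant symplectic form (unique up to scale). For a linear Lie algebra $\mathfrak h\subset\mathfrak{gl}(V)$, the $k$-th prolongation is $\mathfrak h^{(k)}=(S^{k}V^*\otimes\mathfrak h)\cap(S^{k+1}V^*\otimes V)$; in particular $\mathfrak h^{(1)}$ is the space of linear maps $T:V\to\mathfrak h$ with $T(u)v=T(v)u$ for all $u,v\in V$. $\mathfrak h$ has finite type if $\mathfrak h^{(k)}=0$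 for some $k$ (equivalently the full prolongation $\mathfrak h^{(\infty)}=V+\mathfrak h+\mathfrak h^{(1)}+\cdots$ is finite-dimensional), and infinite type otherwise. *)

theory Defs
  imports "HOL-Analysis.Analysis" "HOL-Library.Multiset"
begin

section \<open>Linear Lie algebras and their prolongations\<close>

definition lie_bracket :: "real^'n^'n \<Rightarrow> real^'n^'n \<Rightarrow> real^'n^'n" where
  "lie_bracket A B = A ** B - B ** A"

definition lie_subalgebra :: "(real^'n^'n) set \<Rightarrow> bool" where
  "lie_subalgebra \<hh> \<longleftrightarrow> subspace \<hh> \<and> (\<forall>A\<in>\<hh>. \<forall>B\<in>\<hh>. lie_bracket A B \<in> \<hh>)"

text \<open>
  The space \<open>S\<^sup>kV* \<otimes> W\<close>, as symmetric \<open>k\<close>-linear maps \<open>V\<^sup>k \<rightarrow> W\<close>. The \<open>k\<close> arguments are passed as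
  a list of length \<open>k\<close>; lists of any other length are sent to \<open>0\<close>, so that the function is
  determined by the multilinear map.
\<close>
definition sym_multilinear :: "nat \<Rightarrow> ('v::real_vector list \<Rightarrow> 'w::real_vector) set" where
  "sym_multilinear k = {F.
     (\<forall>xs ys. Suc (length xs + length ys) = k \<longrightarrow> linear (\<lambda>v. F (xs @ v # ys))) \<and>
     (\<forall>vs ws. length vs = k \<and> mset vs = mset ws \<longrightarrow> F vs = F ws) \<and>
     (\<forall>vs. length vs \<noteq> k \<longrightarrow> F vs = 0)}"

text \<open>
  \<open>\<hh>\<^sup>(\<^sup>k\<^sup>) = (S\<^sup>kV* \<otimes> \<hh>) \<inter> (S\<^sup>k\<^sup>+\<^sup>1V* \<otimes> V)\<close>: an element of \<open>S\<^sup>kV* \<otimes> gl(V)\<close> is read as a \<open>(k+1)\<close>-linear map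
  into \<open>V\<close> by applying its value to one further vector.
\<close>
definition prolongation :: "(real^'n^'n) set \<Rightarrow> nat \<Rightarrow> ((real^'n) list \<Rightarrow> real^'n^'n) set" where
  "prolongation \<hh> k = {T \<in> sym_multilinear k.
     (\<forall>vs. T vs \<in> \<hh>) \<and>
     (\<lambda>vs. case vs of [] \<Rightarrow> 0 | v # us \<Rightarrow> T us *v v) \<in> sym_multilinear (Suc k)}"

definition finite_type :: "(real^'n^'n) set \<Rightarrow> bool" where
  "finite_type \<hh> \<longleftrightarrow> (\<exists>k. prolongation \<hh> k = {\<lambda>_. 0})"

definition infinite_type :: "(real^'n^'n) set \<Rightarrow> bool" where
  "infinite_type \<hh> \<longleftrightarrow> \<not> finite_type \<hh>"


section \<open>The symplectic space \<open>V\<close> and its quadratic polynomials\<close>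

type_synonym V = "real^4"
type_synonym glV = "real^4^4"

definition p1 :: V where "p1 = axis 1 1"
definition p2 :: V where "p2 = axis 2 1"
definition q1 :: V where "q1 = axis 3 1"
definition q2 :: V where "q2 = axis 4 1"

text \<open>\<open>\<Omega> = - (p\<^sub>1* \<and> q\<^sub>1* + p\<^sub>2* \<and> q\<^sub>2*)\<close>, hence \<open>\<Omega>(q\<^sub>i, p\<^sub>i) = 1\<close>.\<close>
definition Omega :: "V \<Rightarrow> V \<Rightarrow> real" where
  "Omega u v = - ((u$1 * v$3 - u$3 * v$1) + (u$2 * v$4 - u$4 * v$2))"

definition spV :: "glV set" where
  "spV = {A. \<forall>u v. Omega (A *v u) v + Omega u (A *v v) = 0}"

definition SpV :: "glV set" where
  "SpV = {S. \<forall>u v. Omega (S *v u) (S *v v) = Omega u v}"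

definition conjugate :: "glV \<Rightarrow> glV set \<Rightarrow> glV set" where
  "conjugate S \<gg> = (\<lambda>A. S ** A ** matrix_inv S) ` \<gg>"

text \<open>The endomorphism of \<open>V\<close> identified with the product \<open>uv \<in> S\<^sup>2(V)\<close>.\<close>
definition quad :: "V \<Rightarrow> V \<Rightarrow> glV" where
  "quad u v = matrix (\<lambda>w. Omega u w *\<^sub>R v + Omega v w *\<^sub>R u)"

definition maximal_finite_type :: "glV set \<Rightarrow> bool" where
  "maximal_finite_type \<gg> \<longleftrightarrow>
     lie_subalgebra \<gg> \<and> \<gg> \<subseteq> spV \<and> finite_type \<gg> \<and>
     (\<forall>\<hh>. lie_subalgebra \<hh> \<and> \<hh> \<subseteq> spV \<and> finite_type \<hh> \<and> \<gg> \<subseteq> \<hh> \<longrightarrow> \<hh> = \<gg>)"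


section \<open>Transport from other models of the symplectic space\<close>

text \<open>
  The model space is a subspace \<open>W\<close> of an ambient space. Forms and linear maps are given on the
  ambient space but are constrained on \<open>W\<close> only; every bilinear form on \<open>W\<close> and every linear map
  from \<open>W\<close> arises in this way.
\<close>
definition symplectic_form_on :: "'w::real_vector set \<Rightarrow> ('w \<Rightarrow> 'w \<Rightarrow> real) \<Rightarrow> bool" where
  "symplectic_form_on W \<omega> \<longleftrightarrow>
     bilinear \<omega> \<and> (\<forall>s\<in>W. \<omega> s s = 0) \<and> (\<forall>s\<in>W. (\<forall>t\<in>W. \<omega> s t = 0) \<longrightarrow> s = 0)"

definition symplectic_iso :: "'w::real_vector set \<Rightarrow> ('w \<Rightarrow> 'w \<Rightarrow> real) \<Rightarrow> ('w \<Rightarrow> V) \<Rightarrow> bool" where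
  "symplectic_iso W \<omega> \<phi> \<longleftrightarrow>
     linear \<phi> \<and> bij_betw \<phi> W UNIV \<and> (\<forall>s\<in>W. \<forall>t\<in>W. Omega (\<phi> s) (\<phi> t) = \<omega> s t)"

text \<open>\<open>{\<phi> \<circ> X \<circ> \<phi>\<^sup>-\<^sup>1 | X \<in> \<gg>}\<close> for a linear isomorphism \<open>\<phi>\<close> from \<open>W\<close> onto \<open>V\<close>.\<close>
definition transport :: "'w set \<Rightarrow> ('w \<Rightarrow> V) \<Rightarrow> ('w \<Rightarrow> 'w) set \<Rightarrow> glV set" where
  "transport W \<phi> \<gg> = {L. \<exists>X\<in>\<gg>. \<forall>s\<in>W. L *v \<phi> s = \<phi> (X s)}"

definition sl2 :: "(real^2^2) set" where
  "sl2 = {A. trace A = 0}"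

definition so2 :: "(real^2^2) set" where
  "so2 = {B. transpose B = - B}"


section \<open>The finite type subalgebras\<close>

text \<open>
  \<open>V = \<complex>\<^sup>2\<close> with complex structure \<open>J p\<^sub>i = q\<^sub>i\<close>, \<open>J q\<^sub>i = - p\<^sub>i\<close> and the positive definite Hermitian form
  whose real part is the standard Euclidean metric and whose imaginary part is \<open>\<Omega>\<close>.
\<close>
definition J :: glV where
  "J = matrix (\<lambda>u. u$1 *\<^sub>R q1 + u$2 *\<^sub>R q2 - u$3 *\<^sub>R p1 - u$4 *\<^sub>R p2)"

definition hermitian_form :: "V \<Rightarrow> V \<Rightarrow> complex" where
  "hermitian_form u v = Complex (u \<bullet> v) (Omega u v)"

definition u2 :: "glV set" where
  "u2 = {A. A ** J = J ** A \<and>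
            (\<forall>u v. hermitian_form (A *v u) v + hermitian_form u (A *v v) = 0)}"

text \<open>
  \<open>H \<otimes> E = \<real>\<^sup>2 \<otimes> \<real>\<^sup>2\<close> is the space of \<open>2 \<times> 2\<close> matrices, \<open>h \<otimes> e\<close> being the matrix with entries
  \<open>h\<^sub>i e\<^sub>j\<close>. Then \<open>A \<otimes> 1 + 1 \<otimes> B\<close> acts by \<open>M \<mapsto> A M + M B\<^sup>T\<close>.
\<close>
definition vol :: "real^2 \<Rightarrow> real^2 \<Rightarrow> real" where
  "vol u v = u$1 * v$2 - u$2 * v$1"

definition tensor_form :: "real^2^2 \<Rightarrow> real^2^2 \<Rightarrow> real" where
  "tensor_form M N = (\<Sum>i\<in>UNIV. \<Sum>j\<in>UNIV. \<Sum>k\<in>UNIV. \<Sum>l\<in>UNIV.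
     M$i$j * N$k$l * (vol (axis i 1) (axis k 1) * (axis j 1 \<bullet> (axis l 1 :: real^2))))"

definition sl_plus_so :: "(real^2^2 \<Rightarrow> real^2^2) set" where
  "sl_plus_so = {\<lambda>M. A ** M + M ** transpose B | A B. A \<in> sl2 \<and> B \<in> so2}"

definition u11_algebras :: "glV set set" where
  "u11_algebras = {transport UNIV \<phi> sl_plus_so | \<phi>. symplectic_iso UNIV tensor_form \<phi>}"

definition lagrangian :: "V set \<Rightarrow> bool" where
  "lagrangian L \<longleftrightarrow> subspace L \<and> dim L = 2 \<and> (\<forall>u\<in>L. \<forall>v\<in>L. Omega u v = 0)"

definition vee :: "V set \<Rightarrow> V set \<Rightarrow> glV set" where
  "vee Q P = span {quad q p | q p. q \<in> Q \<and> p \<in> P}"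

definition gl_algebras :: "glV set set" where
  "gl_algebras = {vee Q P | Q P. lagrangian Q \<and> lagrangian P \<and>
     Q \<inter> P = {0} \<and> {q + p | q p. q \<in> Q \<and> p \<in> P} = UNIV}"

text \<open>
  \<open>S\<^sup>3(\<real>\<^sup>2)\<close> as the symmetric tensors in \<open>\<real>\<^sup>2 \<otimes> \<real>\<^sup>2 \<otimes> \<real>\<^sup>2\<close>, on which \<open>A\<close> acts by
  \<open>A \<otimes> 1 \<otimes> 1 + 1 \<otimes> A \<otimes> 1 + 1 \<otimes> 1 \<otimes> A\<close>.
\<close>
definition S3 :: "(real^2^2^2) set" where
  "S3 = {T. \<forall>i j k. T$i$j$k = T$j$i$k \<and> T$i$j$k = T$i$k$j}"

definition S3_action :: "real^2^2 \<Rightarrow> real^2^2^2 \<Rightarrow> real^2^2^2" where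
  "S3_action A T = (\<chi> i j k. \<Sum>l\<in>UNIV. A$i$l * T$l$j$k + A$j$l * T$i$l$k + A$k$l * T$i$j$l)"

definition sl2_invariant_on_S3 :: "(real^2^2^2 \<Rightarrow> real^2^2^2 \<Rightarrow> real) \<Rightarrow> bool" where
  "sl2_invariant_on_S3 \<omega> \<longleftrightarrow>
     (\<forall>A\<in>sl2. \<forall>s\<in>S3. \<forall>t\<in>S3. \<omega> (S3_action A s) t + \<omega> s (S3_action A t) = 0)"

definition sl24_algebras :: "glV set set" where
  "sl24_algebras = {transport S3 \<phi> (S3_action ` sl2) | \<phi> \<omega>.
     symplectic_form_on S3 \<omega> \<and> sl2_invariant_on_S3 \<omega> \<and> symplectic_iso S3 \<omega> \<phi>}"

text \<open>
  The element \<open>(M, N)\<close> of \<open>gl(V\<^sub>1) \<oplus> gl(V\<^sub>2)\<close>, with \<open>M\<close> and \<open>N\<close> written in the bases \<open>(p\<^sub>1, q\<^sub>1)\<close> and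
  \<open>(p\<^sub>2, q\<^sub>2)\<close>.
\<close>
definition block_sum :: "real^2^2 \<Rightarrow> real^2^2 \<Rightarrow> glV" where
  "block_sum M N = matrix (\<lambda>w.
     (M$1$1 * w$1 + M$1$2 * w$3) *\<^sub>R p1 + (M$2$1 * w$1 + M$2$2 * w$3) *\<^sub>R q1 +
     (N$1$1 * w$2 + N$1$2 * w$4) *\<^sub>R p2 + (N$2$1 * w$2 + N$2$2 * w$4) *\<^sub>R q2)"

definition cartan_sum :: "glV set" where
  "cartan_sum = {block_sum X (t *\<^sub>R vector [vector [1, 0], vector [0, -1]]) | X t. X \<in> so2}"

definition D412 :: "real \<Rightarrow> glV set" where
  "D412 \<epsilon> = span {quad p1 q1 + \<epsilon> *\<^sub>R quad p2 p2, quad p2 q1}"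

definition line_algebra :: "real \<Rightarrow> glV set" where
  "line_algebra \<epsilon> = span {quad p2 p2 + quad q2 q2 + \<epsilon> *\<^sub>R quad p1 p1}"

definition finite_type_list :: "glV set set" where
  "finite_type_list =
     {u2} \<union> u11_algebras \<union> gl_algebras \<union> sl24_algebras \<union> {cartan_sum} \<union>
     {D412 \<epsilon> | \<epsilon>. \<epsilon> = 1 \<or> \<epsilon> = -1} \<union> {line_algebra \<epsilon> | \<epsilon>. \<epsilon> = 1 \<or> \<epsilon> = -1}"

end

theory Submission
  imports Defs
begin

text \<open>
  If the complexification of \<open>\<hh>\<close> contains a rank one element \<open>w\<^sup>2\<close> with \<open>w = u + iv\<close>, then the real parts
  of the powers of \<open>w\<close> give nonzero elements of every prolongation. So a subalgebra of finite type is
  elliptic: it contains no pair \<open>u\<^sup>2 - v\<^sup>2\<close>, \<open>uv\<close> with \<open>(u, v) \<noteq> 0\<close>, and ellipticity is all that the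
  classification uses. A nilpotent element \<open>N \<noteq> 0\<close> of an elliptic subalgebra has a square-zero or a
  principal normal form. In the square-zero case \<open>N\<close> and \<open>(ad N)\<^sup>2Y = -2NYN\<close> are quadratic
  forms in two variables, and a pencil of such forms contains a square of a complex linear form as soon as it is
  not spanned by \<open>N\<close>. This bounds the subalgebra. If there is no nilpotent element, then \<open>ad X\<close> has no
  eigenvector for a nonzero real eigenvalue, which confines the subalgebra to a centralizer-like
  subspace whenever some \<open>X\<close> has an eigenvalue outside \<open>i\<real>\<close> or is not semisimple. In the remaining
  case the trace form is negative definite, and one decomposes under \<open>ad X\<close> for a sum \<open>X\<close> of two
  plane rotations, or finds that all elements square to scalars. Conversely, every listed algebra
  has trivial first prolongation, and among elliptic subalgebras it is maximal.
\<close>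

section \<open>Matrix algebra\<close>

text \<open>The working device for X in L: a polynomial in ad X maps L into itself, and it can be
  chosen to annihilate all weight components of a given Y in L except one. What survives lies in L
  and has a known shape, by which it is excluded: square-zero when L has no nilpotents, symmetric
  when the trace form is negative definite, or of complex rank one. Real polynomials suffice: ad X
  is never diagonalised, complex weights enter as quadratic factors and nilpotent parts of ad X as
  repeated factors. The case distinction rests on the characteristic polynomial t^4 - s t^2 + r of
  an element of sp(V): the squares of the eigenvalues are the roots of t^2 - s t + r, so two numbers
  sort the elements. The obstacle is resonance: when weights of ad X that should be separated
  coincide, no polynomial separates them, as for rotations with frequencies 1 and 3. Then either a
  second element of L moves the frequencies apart, or the bracket of two components is a sum of
  squares that has to vanish.\<close>

lemma vector_4 [simp]:
  "(vector [x,y,z,w] :: ('a::zero)^4)$1 = x"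
  "(vector [x,y,z,w] :: ('a::zero)^4)$2 = y"
  "(vector [x,y,z,w] :: ('a::zero)^4)$3 = z"
  "(vector [x,y,z,w] :: ('a::zero)^4)$4 = w"
  unfolding vector_def by simp_all

lemma matrix_diff_ldistrib: "(A::real^'n^'m) ** (B - C) = A ** B - A ** C"
  by (simp add: vec_eq_iff matrix_matrix_mult_def sum_subtractf algebra_simps)

lemma matrix_diff_rdistrib: "((B::real^'n^'m) - C) ** A = B ** A - C ** A"
  by (simp add: vec_eq_iff matrix_matrix_mult_def sum_subtractf algebra_simps)

lemma matrix_plus_rdistrib: "((B::real^'n^'m) + C) ** A = B ** A + C ** A"
  by (simp add: vec_eq_iff matrix_matrix_mult_def sum.distrib algebra_simps)

lemma matrix_scaleR_left: "(r *\<^sub>R (A::real^'n^'m)) ** B = r *\<^sub>R (A ** B)"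
  by (simp add: vec_eq_iff matrix_matrix_mult_def sum_distrib_left algebra_simps)

lemma matrix_scaleR_right: "(A::real^'n^'m) ** (r *\<^sub>R B) = r *\<^sub>R (A ** B)"
  by (simp add: vec_eq_iff matrix_matrix_mult_def sum_distrib_left algebra_simps)

lemma matrix_minus_left: "(- (A::real^'n^'m)) ** B = - (A ** B)"
  by (simp add: vec_eq_iff matrix_matrix_mult_def sum_negf)

lemma matrix_minus_right: "(A::real^'n^'m) ** (- B) = - (A ** B)"
  by (simp add: vec_eq_iff matrix_matrix_mult_def sum_negf)

lemma matrix_zero_left: "(0::real^'n^'m) ** B = 0"
  by (simp add: vec_eq_iff matrix_matrix_mult_def)

lemma matrix_zero_right: "(A::real^'n^'m) ** 0 = 0"
  by (simp add: vec_eq_iff matrix_matrix_mult_def)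

lemma scaleR_vector_mult: "(r *\<^sub>R (A::real^'n^'m)) *v v = r *\<^sub>R (A *v v)"
  by (simp add: scaleR_matrix_vector_assoc)

lemma minus_vector_mult: "(- (A::real^'n^'m)) *v v = - (A *v v)"
  by (simp add: vec_eq_iff matrix_vector_mult_def sum_negf)

lemma matrix_minus_vector_right: "(A::real^'n^'m) *v (- v) = - (A *v v)"
  by (simp add: vec_eq_iff matrix_vector_mult_def sum_negf)

lemmas matrix_distribs = matrix_diff_ldistrib matrix_diff_rdistrib matrix_add_ldistrib
  matrix_plus_rdistrib matrix_scaleR_left matrix_scaleR_right matrix_minus_left matrix_minus_right
  matrix_zero_left matrix_zero_right

lemma trace_scaleR: "trace (r *\<^sub>R (A::real^'n^'n)) = r * trace A"
  by (simp add: trace_def sum_distrib_left)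

lemma matrix_inv_mult:
  fixes S :: "real^'n^'n"
  assumes "invertible S"
  shows "matrix_inv S ** S = mat 1" and "S ** matrix_inv S = mat 1"
proof -
  have "S ** matrix_inv S = mat 1 \<and> matrix_inv S ** S = mat 1"
    unfolding matrix_inv_def by (rule someI_ex) (use assms in \<open>auto simp: invertible_def\<close>)
  then show "matrix_inv S ** S = mat 1" and "S ** matrix_inv S = mat 1" by auto
qed


section \<open>Coordinates on the symplectic Lie algebra\<close>

lemma Omega_left: "Omega (u + v) w = Omega u w + Omega v w" "Omega (u - v) w = Omega u w - Omega v w"
  "Omega (r *\<^sub>R u) w = r * Omega u w" "Omega (- u) w = - Omega u w" "Omega 0 w = 0"
  by (simp_all add: Omega_def algebra_simps)

lemma Omega_right: "Omega w (u + v) = Omega w u + Omega w v" "Omega w (u - v) = Omega w u - Omega w v"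
  "Omega w (r *\<^sub>R u) = r * Omega w u" "Omega w (- u) = - Omega w u" "Omega w 0 = 0"
  by (simp_all add: Omega_def algebra_simps)

lemmas Omega_linear = Omega_left Omega_right

lemma Omega_commute: "Omega u v = - Omega v u"
  by (simp add: Omega_def)

lemma Omega_self [simp]: "Omega u u = 0"
  by (simp add: Omega_def)

lemma Omega_nondegenerate:
  assumes "\<And>v. Omega u v = 0"
  shows "u = 0"
  using assms[of "axis 1 1"] assms[of "axis 2 1"] assms[of "axis 3 1"] assms[of "axis 4 1"]
  by (simp add: Omega_def vec_eq_iff forall_4 axis_def)

text \<open>
  The block matrix \<open>(A, B; C, -A\<^sup>T)\<close> in the basis \<open>p\<^sub>1, p\<^sub>2, q\<^sub>1, q\<^sub>2\<close>, where \<open>A\<close> has the rows \<open>(a, b)\<close>,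
  \<open>(c, d)\<close> and the symmetric blocks \<open>B\<close>, \<open>C\<close> have the upper triangles \<open>e, f, g\<close> and \<open>h, i, j\<close>.
\<close>
definition M :: "real \<Rightarrow> real \<Rightarrow> real \<Rightarrow> real \<Rightarrow> real \<Rightarrow> real \<Rightarrow> real \<Rightarrow> real \<Rightarrow> real \<Rightarrow> real \<Rightarrow> glV" where
  "M a b c d e f g h i j = vector [vector [a, b, e, f], vector [c, d, f, g],
     vector [h, i, -a, -c], vector [i, j, -b, -d]]"

lemma M_nth [simp]:
  "M a b c d e f g h i j $ 1 = vector [a, b, e, f]"
  "M a b c d e f g h i j $ 2 = vector [c, d, f, g]"
  "M a b c d e f g h i j $ 3 = vector [h, i, -a, -c]"
  "M a b c d e f g h i j $ 4 = vector [i, j, -b, -d]"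
  by (simp_all add: M_def)

lemma M_eq_iff:
  "M a b c d e f g h i j = M a' b' c' d' e' f' g' h' i' j' \<longleftrightarrow>
   a = a' \<and> b = b' \<and> c = c' \<and> d = d' \<and> e = e' \<and> f = f' \<and> g = g' \<and> h = h'
     \<and> i = i' \<and> j = j'"
  by (auto simp: vec_eq_iff forall_4)

lemma M_eq_0_iff:
  "M a b c d e f g h i j = 0 \<longleftrightarrow> a = 0 \<and> b = 0 \<and> c = 0 \<and> d = 0 \<and> e = 0
    \<and> f = 0 \<and> g = 0 \<and> h = 0 \<and> i = 0 \<and> j = 0"
  by (auto simp: vec_eq_iff forall_4)

lemma M_plus [simp]:
  "M a b c d e f g h i j + M a' b' c' d' e' f' g' h' i' j' =
   M (a+a') (b+b') (c+c') (d+d') (e+e') (f+f') (g+g') (h+h') (i+i') (j+j')"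
  by (simp add: vec_eq_iff forall_4)

lemma M_diff [simp]:
  "M a b c d e f g h i j - M a' b' c' d' e' f' g' h' i' j' =
   M (a-a') (b-b') (c-c') (d-d') (e-e') (f-f') (g-g') (h-h') (i-i') (j-j')"
  by (simp add: vec_eq_iff forall_4)

lemma M_scaleR [simp]:
  "r *\<^sub>R M a b c d e f g h i j = M (r*a) (r*b) (r*c) (r*d) (r*e) (r*f) (r*g) (r*h) (r*i) (r*j)"
  by (simp add: vec_eq_iff forall_4)

lemma lie_bracket_M [simp]:
  "lie_bracket (M a b c d e f g h i j) (M a' b' c' d' e' f' g' h' i' j') = M
    (a*a' + b*c' + e*h' + f*i' - (a'*a + b'*c) - (e'*h + f'*i))
    (a*b' + b*d' + e*i' + f*j' - (a'*b + b'*d) - (e'*i + f'*j))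
    (c*a' + d*c' + f*h' + g*i' - (c'*a + d'*c) - (f'*h + g'*i))
    (c*b' + d*d' + f*i' + g*j' - (c'*b + d'*d) - (f'*i + g'*j))
    (a*e' + b*f' + e'*a + f'*b - (a'*e + b'*f) - (e*a' + f*b'))
    (a*f' + b*g' + e'*c + f'*d - (a'*f + b'*g) - (e*c' + f*d'))
    (c*f' + d*g' + f'*c + g'*d - (c'*f + d'*g) - (f*c' + g*d'))
    (h*a' + i*c' + a'*h + c'*i - (a*h' + c*i') - (h'*a + i'*c))
    (h*b' + i*d' + a'*i + c'*j - (a*i' + c*j') - (h'*b + i'*d))
    (i*b' + j*d' + b'*i + d'*j - (b*i' + d*j') - (i'*b + j'*d))"
  by (simp add: lie_bracket_def vec_eq_iff forall_4 matrix_matrix_mult_def sum_4)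

lemma M_vector_mult [simp]:
  "M a b c d e f g h i j *v v = vector [a * v$1 + b * v$2 + e * v$3 + f * v$4,
     c * v$1 + d * v$2 + f * v$3 + g * v$4, h * v$1 + i * v$2 - a * v$3 - c * v$4,
     i * v$1 + j * v$2 - b * v$3 - d * v$4]"
  by (simp add: vec_eq_iff forall_4 matrix_vector_mult_def sum_4)

lemma spV_alt: "A \<in> spV \<longleftrightarrow> (\<forall>u v. Omega (A *v u) v = - Omega u (A *v v))"
  by (auto simp: spV_def eq_neg_iff_add_eq_0)

lemma M_in_spV [simp]: "M a b c d e f g h i j \<in> spV"
  by (simp add: spV_def Omega_def algebra_simps)

lemma spV_eq_M:
  assumes "A \<in> spV"
  shows "A = M (A$1$1) (A$1$2) (A$2$1) (A$2$2) (A$1$3) (A$1$4) (A$2$4) (A$3$1) (A$3$2) (A$4$2)"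
proof -
  have "Omega (A *v axis k 1) (axis l 1) + Omega (axis k 1) (A *v axis l 1) = 0" for k l
    using assms by (auto simp: spV_def)
  from this[of 1 2] this[of 1 3] this[of 1 4] this[of 2 3] this[of 2 4] this[of 3 4]
  show ?thesis
    by (simp add: vec_eq_iff forall_4 Omega_def matrix_vector_mult_def sum_4 axis_def)
qed

lemma spV_cases:
  assumes "A \<in> spV"
  obtains a b c d e f g h i j where "A = M a b c d e f g h i j"
  using spV_eq_M[OF assms] by blast

lemma quad_mult: "quad u v *v w = Omega u w *\<^sub>R v + Omega v w *\<^sub>R u"
proof -
  have "linear (\<lambda>w. Omega u w *\<^sub>R v + Omega v w *\<^sub>R u)"
    by (rule linearI) (simp_all add: Omega_linear algebra_simps)
  then show ?thesis unfolding quad_def by (simp add: matrix_works)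
qed

lemma matrix_eq_axis_iff: "(A::real^4^4) = B \<longleftrightarrow> (\<forall>k. A *v axis k 1 = B *v axis k 1)"
  by (auto simp: matrix_vector_mult_basis column_def vec_eq_iff)

section \<open>Conjugation by symplectic matrices\<close>

lemma SpV_invertible:
  assumes "S \<in> SpV"
  shows "invertible S"
proof -
  have "u = 0" if "S *v u = 0" for u
  proof (rule Omega_nondegenerate)
    fix v
    have "Omega u v = Omega (S *v u) (S *v v)" using assms by (simp add: SpV_def)
    then show "Omega u v = 0" using that by (simp add: Omega_linear)
  qed
  then show ?thesis
    by (simp add: invertible_left_inverse matrix_left_invertible_ker)
qed

lemmas SpV_inv = matrix_inv_mult[OF SpV_invertible]

lemma SpV_inv_vector:
  assumes "S \<in> SpV"
  shows "S *v (matrix_inv S *v v) = v" "matrix_inv S *v (S *v v) = v"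
  using SpV_inv[OF assms] by (simp_all add: matrix_vector_mul_assoc)

lemma SpV_cancel:
  assumes "S \<in> SpV"
  shows "matrix_inv S ** (S ** A) = A" "S ** (matrix_inv S ** A) = A"
    "A ** S ** matrix_inv S = A" "A ** matrix_inv S ** S = A"
  using SpV_inv[OF assms] by (simp_all add: matrix_mul_assoc) (simp_all add: matrix_mul_assoc[symmetric])

lemma Omega_SpV: "S \<in> SpV \<Longrightarrow> Omega (S *v u) (S *v v) = Omega u v"
  by (simp add: SpV_def)

lemma SpV_matrix_inv: "S \<in> SpV \<Longrightarrow> matrix_inv S \<in> SpV"
  using Omega_SpV[of S "matrix_inv S *v _" "matrix_inv S *v _"] SpV_inv_vector(1)[of S]
  by (simp add: SpV_def)

lemma SpV_mult: "S \<in> SpV \<Longrightarrow> T \<in> SpV \<Longrightarrow> S ** T \<in> SpV"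
  by (simp add: SpV_def matrix_vector_mul_assoc[symmetric])

lemma mat_1_in_SpV: "mat 1 \<in> SpV"
  by (simp add: SpV_def)

lemma matrix_inv_eq:
  fixes A :: "real^'n^'n"
  assumes "A ** B = mat 1"
  shows "matrix_inv A = B"
proof -
  have "invertible A" using assms invertible_right_inverse by blast
  then have "matrix_inv A ** (A ** B) = B"
    using matrix_inv_mult(1)[of A] by (simp add: matrix_mul_assoc)
  then show ?thesis using assms by simp
qed

lemma matrix_inv_SpV_mult:
  assumes "S \<in> SpV" "T \<in> SpV"
  shows "matrix_inv (S ** T) = matrix_inv T ** matrix_inv S"
  by (rule matrix_inv_eq) (metis SpV_cancel(2) SpV_inv(2) assms matrix_mul_assoc)

lemma matrix_inv_matrix_inv: "S \<in> SpV \<Longrightarrow> matrix_inv (matrix_inv S) = S"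
  by (rule matrix_inv_eq) (rule SpV_inv)

lemma conj_conj_inv:
  assumes "S \<in> SpV"
  shows "S ** (matrix_inv S ** X ** S) ** matrix_inv S = X"
proof -
  have "S ** (matrix_inv S ** X ** S) ** matrix_inv S = (S ** matrix_inv S) ** X ** (S ** matrix_inv S)"
    by (simp only: matrix_mul_assoc)
  then show ?thesis using SpV_inv[OF assms] by simp
qed

text \<open>Equivariance of the identification of S^2(V) with sp(V). It makes the shape of rank one
  elements, and with it ellipticity, independent of the symplectic basis.\<close>

lemma quad_conj:
  assumes "S \<in> SpV"
  shows "S ** quad u v ** matrix_inv S = quad (S *v u) (S *v v)"
proof -
  have "(S ** quad u v ** matrix_inv S) *v w = quad (S *v u) (S *v v) *v w" for w
  proof -
    have "Omega u (matrix_inv S *v w) = Omega (S *v u) w" for u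
      using Omega_SpV[OF assms, of u "matrix_inv S *v w"] by (simp add: SpV_inv_vector[OF assms])
    then show ?thesis
      by (simp add: matrix_vector_mul_assoc[symmetric] quad_mult matrix_vector_right_distrib
        matrix_vector_mult_scaleR)
  qed
  then show ?thesis by (simp add: matrix_eq)
qed

lemma quad_M:
  "quad u v = M (u$3* v$1 + v$3*u$1) (u$4* v$1 + v$4*u$1) (u$3* v$2 + v$3*u$2) (u$4* v$2 + v$4*u$2)
     (- 2*u$1* v$1) (- (u$2* v$1 + u$1* v$2)) (- 2*u$2* v$2)
     (2*u$3* v$3) (u$4* v$3 + u$3* v$4) (2*u$4* v$4)"
  unfolding matrix_eq_axis_iff
  by (simp add: forall_4 quad_mult vec_eq_iff Omega_def axis_def algebra_simps)

text \<open>\<open>u\<^sup>2 - v\<^sup>2\<close> and \<open>2uv\<close> are the real and imaginary parts of the rank one element \<open>(u + iv)\<^sup>2\<close> of \<open>S\<^sup>2(V \<otimes> \<complex>)\<close>.\<close>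
definition elliptic :: "glV set \<Rightarrow> bool" where
  "elliptic L \<longleftrightarrow> (\<forall>u v. quad u u - quad v v \<in> L \<and> quad u v \<in> L
    \<longrightarrow> u = 0 \<and> v = 0)"

section \<open>Elliptic subalgebras and symplectic changes of basis\<close>

definition elliptic_subalgebra :: "glV set \<Rightarrow> bool" where
  "elliptic_subalgebra L \<longleftrightarrow> lie_subalgebra L \<and> L \<subseteq> spV \<and> elliptic L"

text \<open>The algebra \<open>L\<close> written in the basis formed by the columns of
  \<open>S\<close>.\<close>

definition pullback :: "glV \<Rightarrow> glV set \<Rightarrow> glV set" where
  "pullback S L = {Y. S ** Y ** matrix_inv S \<in> L}"

definition listed :: "glV set \<Rightarrow> bool" where
  "listed L \<longleftrightarrow> (\<exists>\<gg>\<in>finite_type_list. \<exists>S\<in>SpV. L \<subseteq> conjugate S \<gg>)"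

text \<open>In dimension 4 nilpotency is detected by the fourth power.\<close>

definition nilpotent_free :: "glV set \<Rightarrow> bool" where
  "nilpotent_free L \<longleftrightarrow> (\<forall>A\<in>L. A ** A ** (A ** A) = 0 \<longrightarrow> A = 0)"

text \<open>A real substitute for compactness: a nonzero semisimple matrix with imaginary
  eigenvalues has a square of negative trace.\<close>

definition trace_negative :: "glV set \<Rightarrow> bool" where
  "trace_negative L \<longleftrightarrow> (\<forall>A\<in>L. A \<noteq> 0 \<longrightarrow> trace (A ** A) < 0)"

lemma lie_closed:
  assumes "lie_subalgebra L"
  shows "0 \<in> L" "A \<in> L \<Longrightarrow> B \<in> L \<Longrightarrow> A + B \<in> L" "A \<in> L
    \<Longrightarrow> B \<in> L \<Longrightarrow> A - B \<in> L"
    "A \<in> L \<Longrightarrow> r *\<^sub>R A \<in> L" "A \<in> L \<Longrightarrow> B \<in> L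
      \<Longrightarrow> lie_bracket A B \<in> L" "A \<in> L \<Longrightarrow> - A \<in> L"
  using assms unfolding lie_subalgebra_def
  by (auto intro: subspace_0 subspace_add subspace_diff subspace_scale subspace_neg)

lemma elliptic_subalgebra_closed:
  assumes "elliptic_subalgebra L"
  shows "0 \<in> L" "A \<in> L \<Longrightarrow> B \<in> L \<Longrightarrow> A + B \<in> L" "A \<in> L
    \<Longrightarrow> B \<in> L \<Longrightarrow> A - B \<in> L"
    "A \<in> L \<Longrightarrow> r *\<^sub>R A \<in> L" "A \<in> L \<Longrightarrow> B \<in> L
      \<Longrightarrow> lie_bracket A B \<in> L" "A \<in> L \<Longrightarrow> - A \<in> L"
  using lie_closed assms unfolding elliptic_subalgebra_def by auto

lemma elliptic_subalgebra_cases: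
  assumes "elliptic_subalgebra L" "Y \<in> L"
  obtains a b c d e f g h i j where "Y = M a b c d e f g h i j"
  using assms spV_cases unfolding elliptic_subalgebra_def by blast

lemma elliptic_subalgebra_elliptic:
  "elliptic_subalgebra L \<Longrightarrow> quad u u - quad v v \<in> L \<Longrightarrow> quad u v \<in> L
    \<Longrightarrow> u = 0 \<and> v = 0"
  by (auto simp: elliptic_subalgebra_def elliptic_def)

lemma pullback_memI:
  assumes "S \<in> SpV" "X \<in> L" "X ** S = S ** Y"
  shows "Y \<in> pullback S L"
  using assms by (metis (no_types) SpV_cancel(3) mem_Collect_eq pullback_def)

lemma pullback_memD:
  assumes "S \<in> SpV" "Y \<in> pullback S L"
  shows "\<exists>X\<in>L. X ** S = S ** Y \<and> X = S ** Y ** matrix_inv S"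
  using assms by (auto simp: pullback_def SpV_cancel)

lemma conj_mult:
  assumes "S \<in> SpV"
  shows "(S ** A ** matrix_inv S) ** (S ** B ** matrix_inv S) = S ** (A ** B) ** matrix_inv S"
proof -
  have "(S ** A ** matrix_inv S) ** (S ** B ** matrix_inv S)
      = S ** A ** (matrix_inv S ** S) ** (B ** matrix_inv S)" by (simp add: matrix_mul_assoc)
  then show ?thesis using SpV_inv[OF assms] by (simp add: matrix_mul_assoc)
qed

lemma conj_eq_0_iff:
  assumes "S \<in> SpV"
  shows "S ** A ** matrix_inv S = 0 \<longleftrightarrow> A = 0"
proof
  assume "S ** A ** matrix_inv S = 0"
  then have "matrix_inv S ** (S ** A ** matrix_inv S ** S) = 0" by (simp add: matrix_distribs)
  then show "A = 0" using assms by (simp add: SpV_cancel)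
qed (simp add: matrix_distribs)

lemma conj_in_spV:
  assumes "S \<in> SpV" "A \<in> spV"
  shows "S ** A ** matrix_inv S \<in> spV"
proof -
  have 1: "Omega (S *v u) v = Omega u (matrix_inv S *v v)" "Omega u (S *v v) = Omega (matrix_inv S *v u) v" for u v
    using Omega_SpV[OF assms(1), of u "matrix_inv S *v v"] Omega_SpV[OF assms(1), of "matrix_inv S *v u" v]
    by (simp_all add: SpV_inv_vector[OF assms(1)])
  show ?thesis using assms(2)
    by (simp add: spV_def matrix_vector_mul_assoc[symmetric] 1)
qed

lemma lie_subalgebra_pullback:
  assumes S: "S \<in> SpV" and L: "lie_subalgebra L"
  shows "lie_subalgebra (pullback S L)"
proof -
  have "subspace (pullback S L)"
    unfolding subspace_def pullback_def using lie_closed[OF L] by (simp add: matrix_distribs)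
  moreover have "lie_bracket A B \<in> pullback S L" if "A \<in> pullback S L" "B \<in> pullback S L" for A B
    using that lie_closed(5)[OF L, of "S ** A ** matrix_inv S" "S ** B ** matrix_inv S"]
    by (simp add: pullback_def lie_bracket_def conj_mult[OF S] matrix_distribs)
  ultimately show ?thesis by (simp add: lie_subalgebra_def)
qed

lemma pullback_subset_spV:
  assumes S: "S \<in> SpV" and L: "L \<subseteq> spV"
  shows "pullback S L \<subseteq> spV"
proof
  fix Y assume "Y \<in> pullback S L"
  then have "matrix_inv S ** (S ** Y ** matrix_inv S) ** matrix_inv (matrix_inv S) \<in> spV"
    using conj_in_spV[OF SpV_matrix_inv[OF S]] L by (auto simp: pullback_def)
  then show "Y \<in> spV"
    using conj_conj_inv[OF SpV_matrix_inv[OF S]] by (simp add: matrix_inv_matrix_inv[OF S])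
qed

lemma elliptic_pullback:
  assumes S: "S \<in> SpV" and L: "elliptic L"
  shows "elliptic (pullback S L)"
  unfolding elliptic_def
proof (intro allI impI)
  fix u v assume "quad u u - quad v v \<in> pullback S L \<and> quad u v \<in> pullback S L"
  then have "S *v u = 0 \<and> S *v v = 0"
    using L by (simp add: pullback_def elliptic_def matrix_distribs quad_conj[OF S])
  then show "u = 0 \<and> v = 0" by (metis S SpV_inv_vector(2) matrix_vector_mult_0_right)
qed

lemma elliptic_subalgebra_pullback: "S \<in> SpV \<Longrightarrow> elliptic_subalgebra L
  \<Longrightarrow> elliptic_subalgebra (pullback S L)"
  by (simp add: elliptic_subalgebra_def elliptic_pullback lie_subalgebra_pullback pullback_subset_spV)

lemma nilpotent_free_pullback:
  assumes S: "S \<in> SpV" and L: "nilpotent_free L"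
  shows "nilpotent_free (pullback S L)"
  unfolding nilpotent_free_def
proof (intro ballI impI)
  fix A assume A: "A \<in> pullback S L" "A ** A ** (A ** A) = 0"
  define B where "B = S ** A ** matrix_inv S"
  have "B ** B ** (B ** B) = 0"
    unfolding B_def conj_mult[OF S] A(2) by (simp add: matrix_distribs)
  moreover have "B \<in> L" using A(1) by (simp add: pullback_def B_def)
  ultimately have "B = 0" using L unfolding nilpotent_free_def by blast
  then show "A = 0" using conj_eq_0_iff[OF S] by (simp add: B_def)
qed

lemma trace_conj:
  assumes S: "S \<in> SpV"
  shows "trace (S ** A ** matrix_inv S) = trace A"
  using trace_mul_sym[of "S ** A" "matrix_inv S"] SpV_cancel[OF S] by simp

lemma trace_negative_pullback:
  assumes S: "S \<in> SpV" and L: "trace_negative L"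
  shows "trace_negative (pullback S L)"
  unfolding trace_negative_def
proof (intro ballI impI)
  fix A assume "A \<in> pullback S L" "A \<noteq> 0"
  then have "trace ((S ** A ** matrix_inv S) ** (S ** A ** matrix_inv S)) < 0"
    using L conj_eq_0_iff[OF S] by (simp add: trace_negative_def pullback_def)
  then show "trace (A ** A) < 0" by (simp add: conj_mult[OF S] trace_conj[OF S])
qed

text \<open>This licenses every normalisation below: the list is closed up to \<open>SpV\<close>, so
  an algebra may be replaced by its matrix form in any symplectic basis.\<close>

lemma listed_pullback:
  assumes S: "S \<in> SpV" and L: "listed (pullback S L)"
  shows "listed L"
proof -
  from L obtain \<gg> T where g: "\<gg> \<in> finite_type_list" "T \<in> SpV"
    "pullback S L \<subseteq> conjugate T \<gg>"
    by (auto simp: listed_def)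
  have "L \<subseteq> conjugate (S ** T) \<gg>"
  proof
    fix X assume "X \<in> L"
    then have "matrix_inv S ** X ** S \<in> pullback S L"
      using S by (intro pullback_memI[of S X]) (simp_all add: matrix_mul_assoc SpV_inv)
    then obtain A where A: "A \<in> \<gg>" "matrix_inv S ** X ** S = T ** A ** matrix_inv T"
      using g by (auto simp: conjugate_def)
    have "X = S ** (matrix_inv S ** X ** S) ** matrix_inv S"
      by (rule conj_conj_inv[OF S, symmetric])
    then have "X = (S ** T) ** A ** matrix_inv (S ** T)"
      unfolding A(2) matrix_inv_SpV_mult[OF S g(2)] by (simp add: matrix_mul_assoc)
    then show "X \<in> conjugate (S ** T) \<gg>" using A(1) by (auto simp: conjugate_def)
  qed
  then show ?thesis unfolding listed_def using g(1) SpV_mult[OF S g(2)] by blast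
qed

lemma conjugate_mat_1 [simp]: "conjugate (mat 1) \<gg> = \<gg>"
proof -
  have "matrix_inv (mat 1 :: glV) = mat 1" by (rule matrix_inv_eq) simp
  then show ?thesis by (simp add: conjugate_def)
qed

lemma listedI: "\<gg> \<in> finite_type_list \<Longrightarrow> L \<subseteq> \<gg> \<Longrightarrow> listed L"
  unfolding listed_def using mat_1_in_SpV by (metis conjugate_mat_1)

lemma conjugate_eq_pullback:
  assumes "S \<in> SpV"
  shows "conjugate S \<gg> = pullback (matrix_inv S) \<gg>"
proof -
  have "X = S ** (matrix_inv S ** X ** S) ** matrix_inv S" for X
    by (rule conj_conj_inv[OF assms, symmetric])
  moreover have "matrix_inv S ** (S ** A ** matrix_inv S) ** S = A" for A
    using conj_conj_inv[OF SpV_matrix_inv[OF assms]] by (simp add: matrix_inv_matrix_inv[OF assms])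
  ultimately show ?thesis
    by (auto simp: conjugate_def pullback_def matrix_inv_matrix_inv[OF assms])
qed


section \<open>Symplectic bases\<close>

definition symplectic_basis :: "V \<Rightarrow> V \<Rightarrow> V \<Rightarrow> V \<Rightarrow> bool" where
  "symplectic_basis P1 P2 Q1 Q2 \<longleftrightarrow> Omega Q1 P1 = 1 \<and> Omega Q2 P2 = 1 \<and> Omega P1 P2
    = 0 \<and>
     Omega P1 Q2 = 0 \<and> Omega P2 Q1 = 0 \<and> Omega Q1 Q2 = 0"

definition frame :: "V \<Rightarrow> V \<Rightarrow> V \<Rightarrow> V \<Rightarrow> glV" where
  "frame P1 P2 Q1 Q2 = transpose (vector [P1, P2, Q1, Q2])"

lemma frame_mult:
  "frame P1 P2 Q1 Q2 *v x = x$1 *\<^sub>R P1 + x$2 *\<^sub>R P2 + x$3 *\<^sub>R Q1 + x$4 *\<^sub>R Q2"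
  by (simp add: frame_def vec_eq_iff matrix_vector_mult_def sum_4 transpose_def mult.commute)

lemma symplectic_basis_sym:
  assumes "symplectic_basis P1 P2 Q1 Q2"
  shows "Omega Q1 P1 = 1" "Omega Q2 P2 = 1" "Omega P1 P2 = 0" "Omega P1 Q2 = 0" "Omega P2 Q1 = 0"
    "Omega Q1 Q2 = 0" "Omega P1 Q1 = -1" "Omega P2 Q2 = -1" "Omega P2 P1 = 0" "Omega Q2 P1 = 0"
    "Omega Q1 P2 = 0" "Omega Q2 Q1 = 0"
  using assms Omega_commute[of P1 Q1] Omega_commute[of P2 Q2] Omega_commute[of P2 P1]
    Omega_commute[of Q2 P1] Omega_commute[of Q1 P2] Omega_commute[of Q2 Q1]
  by (simp_all add: symplectic_basis_def)

lemma frame_in_SpV: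
  assumes "symplectic_basis P1 P2 Q1 Q2"
  shows "frame P1 P2 Q1 Q2 \<in> SpV"
  using symplectic_basis_sym[OF assms]
  by (simp add: SpV_def frame_mult Omega_linear) (simp add: Omega_def algebra_simps)

lemma symplectic_basis_expand:
  assumes "symplectic_basis P1 P2 Q1 Q2"
  shows "w = Omega Q1 w *\<^sub>R P1 + Omega Q2 w *\<^sub>R P2 - Omega P1 w *\<^sub>R Q1 - Omega P2 w *\<^sub>R Q2"
proof -
  let ?S = "frame P1 P2 Q1 Q2"
  obtain x where x: "w = ?S *v x"
    using SpV_inv_vector(1)[OF frame_in_SpV[OF assms], of w] by metis
  show ?thesis unfolding x frame_mult
    using symplectic_basis_sym[OF assms] by (simp add: Omega_linear)
qed

lemma frame_M_coeffs:
  assumes "X *v P1 = a *\<^sub>R P1 + c *\<^sub>R P2 + h *\<^sub>R Q1 + i *\<^sub>R Q2"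
    and "X *v P2 = b *\<^sub>R P1 + d *\<^sub>R P2 + i *\<^sub>R Q1 + j *\<^sub>R Q2"
    and "X *v Q1 = e *\<^sub>R P1 + f *\<^sub>R P2 - a *\<^sub>R Q1 - b *\<^sub>R Q2"
    and "X *v Q2 = f *\<^sub>R P1 + g *\<^sub>R P2 - c *\<^sub>R Q1 - d *\<^sub>R Q2"
  shows "X ** frame P1 P2 Q1 Q2 = frame P1 P2 Q1 Q2 ** M a b c d e f g h i j"
  unfolding matrix_eq_axis_iff forall_4 matrix_vector_mul_assoc[symmetric] frame_mult
  by (simp add: axis_def assms)

text \<open>The matrix of \<open>X\<close> in a symplectic basis. The dual vector of
  \<open>P1\<close> is \<open>Q1\<close> and that of \<open>Q1\<close> is \<open>- P1\<close>, so
  all entries are values of the symmetric form Omega(u, Xv); its ten independent values are the ten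
  arguments of \<open>M\<close>.\<close>

definition coords :: "V \<Rightarrow> V \<Rightarrow> V \<Rightarrow> V \<Rightarrow> glV \<Rightarrow> glV" where
  "coords P1 P2 Q1 Q2 X = M (Omega Q1 (X *v P1)) (Omega Q1 (X *v P2)) (Omega Q2 (X *v P1)) (Omega Q2 (X *v P2))
      (Omega Q1 (X *v Q1)) (Omega Q1 (X *v Q2)) (Omega Q2 (X *v Q2))
      (- Omega P1 (X *v P1)) (- Omega P1 (X *v P2)) (- Omega P2 (X *v P2))"

lemma frame_coords:
  assumes s: "symplectic_basis P1 P2 Q1 Q2" and X: "X \<in> spV"
  shows "X ** frame P1 P2 Q1 Q2 = frame P1 P2 Q1 Q2 ** coords P1 P2 Q1 Q2 X"
proof -
  have c: "Omega u (X *v v) = Omega v (X *v u)" for u v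
    using X Omega_commute[of v "X *v u"] by (simp add: spV_alt)
  have e: "w = Omega Q1 w *\<^sub>R P1 + Omega Q2 w *\<^sub>R P2 + (- Omega P1 w) *\<^sub>R Q1 + (- Omega P2 w) *\<^sub>R Q2"
    "w = Omega Q1 w *\<^sub>R P1 + Omega Q2 w *\<^sub>R P2 - Omega P1 w *\<^sub>R Q1 - Omega P2 w *\<^sub>R Q2" for w
    using symplectic_basis_expand[OF s, of w] by simp_all
  show ?thesis unfolding coords_def
  proof (rule frame_M_coeffs)
    show "X *v P1 = Omega Q1 (X *v P1) *\<^sub>R P1 + Omega Q2 (X *v P1) *\<^sub>R P2
        + (- Omega P1 (X *v P1)) *\<^sub>R Q1 + (- Omega P1 (X *v P2)) *\<^sub>R Q2"
      by (rule trans[OF e(1)]) (simp only: c[of P2 P1])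
    show "X *v P2 = Omega Q1 (X *v P2) *\<^sub>R P1 + Omega Q2 (X *v P2) *\<^sub>R P2
        + (- Omega P1 (X *v P2)) *\<^sub>R Q1 + (- Omega P2 (X *v P2)) *\<^sub>R Q2"
      by (rule e(1))
    show "X *v Q1 = Omega Q1 (X *v Q1) *\<^sub>R P1 + Omega Q1 (X *v Q2) *\<^sub>R P2
        - Omega Q1 (X *v P1) *\<^sub>R Q1 - Omega Q1 (X *v P2) *\<^sub>R Q2"
      by (rule trans[OF e(2)]) (simp only: c[of Q2 Q1] c[of P1 Q1] c[of P2 Q1])
    show "X *v Q2 = Omega Q1 (X *v Q2) *\<^sub>R P1 + Omega Q2 (X *v Q2) *\<^sub>R P2
        - Omega Q2 (X *v P1) *\<^sub>R Q1 - Omega Q2 (X *v P2) *\<^sub>R Q2"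
      by (rule trans[OF e(2)]) (simp only: c[of P1 Q2] c[of P2 Q2])
  qed
qed

lemma trace_M_square [simp]:
  "trace (M a b c d e f g h i j ** M a b c d e f g h i j)
   = 2 * (a*a + d*d + 2*b*c + e*h + 2*f*i + g*j)"
  by (simp add: trace_def matrix_matrix_mult_def sum_4)

text \<open>The spectrum of an element of sp(V) is symmetric under negation, so its characteristic
  polynomial is even, with the coefficient of t^2 determined by the trace of the square.\<close>

lemma spV_Cayley_Hamilton:
  assumes "A \<in> spV"
  shows "\<exists>r. A ** A ** (A ** A) = (trace (A ** A) / 2) *\<^sub>R (A ** A) - r *\<^sub>R mat 1"
proof -
  obtain a b c d e f g h i j where A: "A = M a b c d e f g h i j" using spV_cases[OF assms] .
  \<comment> \<open>\<open>K\<close> is the shape of the matrices that are selfadjoint for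
    \<open>Omega\<close>, such as the square of an element of \<open>spV\<close>. Their eigenvalues
    are double, hence they satisfy a quadratic equation.\<close>
  define K :: "real \<Rightarrow> real \<Rightarrow> real \<Rightarrow> real \<Rightarrow> real \<Rightarrow> real \<Rightarrow> glV" where
    "K x y z w u v = vector [vector [x, y, 0, u], vector [z, w, -u, 0], vector [0, v, x, z], vector [-v, 0, y, w]]"
    for x y z w u v
  have 1: "A ** A = K (a*a+b*c+e*h+f*i) (a*b+b*d+e*i+f*j) (c*a+d*c+f*h+g*i) (c*b+d*d+f*i+g*j)
      (a*f+b*g-e*c-f*d) (h*b+i*d-a*i-c*j)"
    by (simp add: A K_def vec_eq_iff forall_4 matrix_matrix_mult_def sum_4 algebra_simps)
  have 2: "K x y z w u v ** K x y z w u v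
    = (x + w) *\<^sub>R K x y z w u v - (x*w - y*z + u * v) *\<^sub>R mat 1" for x y z w u v
    by (simp add: K_def vec_eq_iff forall_4 matrix_matrix_mult_def sum_4 mat_def algebra_simps)
  have 3: "trace (A ** A) / 2 = (a*a+b*c+e*h+f*i) + (c*b+d*d+f*i+g*j)"
    unfolding A trace_M_square by simp
  show ?thesis unfolding 3 unfolding 1 2 by blast
qed

section \<open>Matrix models of the listed algebras\<close>

definition gl_std :: "glV set" where
  "gl_std = {M a b c d 0 0 0 0 0 0 | a b c d. True}"

text \<open>Written in the coordinates of \<open>u11_map\<close>: \<open>x\<close>,
  \<open>y\<close>, \<open>z\<close> parametrise sl(H) and \<open>r\<close> parametrises
  so(E).\<close>

definition u11_std :: "glV set" where
  "u11_std = {M x (- r) r x z 0 z y 0 y | x y z r. True}"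

text \<open>The action on S^3 of the matrix with rows (x, y) and (3z, -x), in the coordinates of
  \<open>S3_map\<close>; the 3 clears denominators.\<close>

definition sl24_std :: "glV set" where
  "sl24_std = {M (3*x) 0 0 (- x) 0 y (2*z) 0 (9*z) (6*y) | x y z. True}"

lemma u2_eq: "u2 = {M 0 b (- b) 0 e f g (- e) (- f) (- g) | b e f g. True}"
proof (intro set_eqI iffI)
  have J: "J *v u = vector [- u$3, - u$4, u$1, u$2]" for u
  proof -
    have "linear (\<lambda>u::V. u$1 *\<^sub>R q1 + u$2 *\<^sub>R q2 - u$3 *\<^sub>R p1 - u$4 *\<^sub>R p2)"
      by (rule linearI) (simp_all add: algebra_simps)
    then have "J *v u = u$1 *\<^sub>R q1 + u$2 *\<^sub>R q2 - u$3 *\<^sub>R p1 - u$4 *\<^sub>R p2"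
      unfolding J_def by (simp add: matrix_works)
    then show ?thesis by (simp add: vec_eq_iff forall_4 q1_def q2_def p1_def p2_def axis_def)
  qed
  fix A
  {
    assume A: "A \<in> u2"
    then have "A \<in> spV"
      by (auto simp: u2_def spV_def hermitian_form_def complex_eq_iff)
    then obtain a b c d e f g h i j where M: "A = M a b c d e f g h i j" by (rule spV_cases)
    have "A *v (J *v v) = J *v (A *v v)" for v
      using A by (auto simp: u2_def matrix_vector_mul_assoc)
    from this[of "axis 1 1"] this[of "axis 2 1"] this[of "axis 3 1"] this[of "axis 4 1"]
    have 1: "e = - h" "f = - i" "g = - j" "c = - b" by (auto simp: M J vec_eq_iff forall_4 axis_def)
    have "(A *v v) \<bullet> v + v \<bullet> (A *v v) = 0" for v
      using A by (auto simp: u2_def hermitian_form_def complex_eq_iff)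
    from this[of "axis 1 1"] this[of "axis 2 1"]
    have "a = 0" "d = 0" by (auto simp: M inner_vec_def sum_4 axis_def)
    then have "A = M 0 b (- b) 0 e f g (- e) (- f) (- g)" using 1 M by simp
    then show "A \<in> {M 0 b (- b) 0 e f g (- e) (- f) (- g) | b e f g. True}" by blast
  }
  assume "A \<in> {M 0 b (- b) 0 e f g (- e) (- f) (- g) | b e f g. True}"
  then obtain b e f g where A: "A = M 0 b (- b) 0 e f g (- e) (- f) (- g)" by blast
  have "A ** J = J ** A"
    unfolding matrix_eq_axis_iff forall_4 matrix_vector_mul_assoc[symmetric] A J
    by (simp add: vec_eq_iff forall_4 axis_def)
  then show "A \<in> u2"
    by (simp add: u2_def hermitian_form_def A complex_eq_iff inner_vec_def sum_4 Omega_def algebra_simps)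
qed

lemma subspace_gl_std: "subspace gl_std"
  by (auto simp: subspace_def gl_std_def M_eq_iff) (metis M_eq_0_iff)

lemma quad_basis:
  "quad p1 p1 = M 0 0 0 0 (-2) 0 0 0 0 0" "quad p1 p2 = M 0 0 0 0 0 (-1) 0 0 0 0"
  "quad p2 p2 = M 0 0 0 0 0 0 (-2) 0 0 0" "quad q1 q1 = M 0 0 0 0 0 0 0 2 0 0"
  "quad q1 q2 = M 0 0 0 0 0 0 0 0 1 0" "quad q2 q2 = M 0 0 0 0 0 0 0 0 0 2"
  "quad q1 p1 = M 1 0 0 0 0 0 0 0 0 0" "quad q2 p1 = M 0 1 0 0 0 0 0 0 0 0"
  "quad q1 p2 = M 0 0 1 0 0 0 0 0 0 0" "quad q2 p2 = M 0 0 0 1 0 0 0 0 0 0"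
  "quad p1 q1 = M 1 0 0 0 0 0 0 0 0 0" "quad p2 q1 = M 0 0 1 0 0 0 0 0 0 0"
  by (simp_all add: quad_M p1_def p2_def q1_def q2_def axis_def)

lemma vee_std:
  assumes Q: "Q = {v. v$1 = 0 \<and> v$2 = 0}" and P: "P = {v. v$3 = 0 \<and> v$4 = 0}"
  shows "vee Q P = gl_std"
proof
  show "vee Q P \<subseteq> gl_std"
    unfolding vee_def by (rule span_minimal[OF _ subspace_gl_std]) (auto simp: Q P quad_M gl_std_def M_eq_iff)
  show "gl_std \<subseteq> vee Q P"
  proof
    fix X assume "X \<in> gl_std"
    then obtain a b c d where X: "X = M a b c d 0 0 0 0 0 0" by (auto simp: gl_std_def)
    have "X = a *\<^sub>R quad q1 p1 + b *\<^sub>R quad q2 p1 + c *\<^sub>R quad q1 p2 + d *\<^sub>R quad q2 p2"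
      by (simp add: X quad_basis)
    moreover have "q1 \<in> Q" "q2 \<in> Q" "p1 \<in> P" "p2 \<in> P"
      by (simp_all add: Q P q1_def q2_def p1_def p2_def axis_def)
    moreover have "quad q p \<in> vee Q P" if "q \<in> Q" "p \<in> P" for q p
      using that unfolding vee_def by (intro span_base) blast
    ultimately show "X \<in> vee Q P"
      unfolding vee_def by (metis (no_types, lifting) span_add span_scale)
  qed
qed

lemma dim_coordinate_plane:
  fixes k l :: 4
  assumes "k \<noteq> l"
  shows "dim {v::V. \<forall>m. m \<noteq> k \<longrightarrow> m \<noteq> l \<longrightarrow> v $ m = 0} = 2"
proof -
  let ?B = "{axis k 1, axis l 1} :: V set"
  have "v = v$k *\<^sub>R axis k 1 + v$l *\<^sub>R axis l 1" if "\<forall>m. m \<noteq> k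
    \<longrightarrow> m \<noteq> l \<longrightarrow> v $ m = 0" for v :: V
    using that assms by (auto simp: vec_eq_iff axis_def)
  then have "{v::V. \<forall>m. m \<noteq> k \<longrightarrow> m \<noteq> l \<longrightarrow> v $ m
    = 0} \<subseteq> span ?B"
    by (smt (verit) insertCI mem_Collect_eq span_add span_base span_scale subsetI)
  moreover have "?B \<subseteq> {v::V. \<forall>m. m \<noteq> k \<longrightarrow> m \<noteq> l
    \<longrightarrow> v $ m = 0}"
    by (auto simp: axis_def)
  moreover have "independent ?B"
    by (rule independent_mono[OF independent_Basis]) (auto simp: axis_in_Basis_iff)
  moreover have "card ?B = 2" using assms by (simp add: axis_eq_axis)
  ultimately show ?thesis using dim_unique by blast
qed

lemma gl_std_mem: "gl_std \<in> gl_algebras"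
proof -
  let ?Q = "{v::V. v$1 = 0 \<and> v$2 = 0}" and ?P = "{v::V. v$3 = 0 \<and> v$4 = 0}"
  have e: "?Q = {v::V. \<forall>m. m \<noteq> 3 \<longrightarrow> m \<noteq> 4 \<longrightarrow> v $ m = 0}" "?P
    = {v::V. \<forall>m. m \<noteq> 1 \<longrightarrow> m \<noteq> 2 \<longrightarrow> v $ m = 0}"
    by (auto simp: forall_4)
  have "dim ?Q = 2" "dim ?P = 2"
    unfolding e by (rule dim_coordinate_plane, simp)+
  then have "lagrangian ?Q" "lagrangian ?P"
    by (auto simp: lagrangian_def subspace_def Omega_def)
  moreover have "?Q \<inter> ?P = {0}" by (auto simp: vec_eq_iff forall_4)
  moreover have "\<exists>q p. v = q + p \<and> q \<in> ?Q \<and> p \<in> ?P" for v :: V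
    by (intro exI[of _ "vector [0, 0, v$3, v$4]"] exI[of _ "vector [v$1, v$2, 0, 0]"])
      (simp add: vec_eq_iff forall_4)
  then have "{q + p | q p. q \<in> ?Q \<and> p \<in> ?P} = UNIV" by blast
  ultimately show ?thesis
    unfolding gl_algebras_def using vee_std by blast
qed

section \<open>The pseudo-unitary model\<close>

text \<open>The tensor of the first basis vector of H with the j-th of E goes to q_j, and that of
  the second one to p_j. This order matches the sign convention Omega(q_i, p_i) = 1.\<close>

definition u11_map :: "real^2^2 \<Rightarrow> V" where
  "u11_map N = vector [N$2$1, N$2$2, N$1$1, N$1$2]"

lemma tensor_form_eq: "tensor_form K N = K$1$1 * N$2$1 - K$2$1 * N$1$1 + K$1$2 * N$2$2 - K$2$2 * N$1$2"
  by (simp add: tensor_form_def sum_2 vol_def axis_def inner_vec_def)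

lemma u11_map_iso: "symplectic_iso UNIV tensor_form u11_map"
proof -
  have "linear u11_map" by (rule linearI) (simp_all add: u11_map_def vec_eq_iff forall_4)
  moreover have "bij u11_map"
    by (rule o_bij[of "\<lambda>v. vector [vector [v$3, v$4], vector [v$1, v$2]]"])
      (simp_all add: fun_eq_iff u11_map_def vec_eq_iff forall_4 forall_2)
  ultimately show ?thesis
    by (simp add: symplectic_iso_def tensor_form_eq Omega_def u11_map_def)
qed

lemma transport_eqI:
  assumes "bij_betw \<phi> W UNIV"
    and "\<And>X. X \<in> \<gg> \<Longrightarrow> \<exists>A\<in>G. \<forall>s\<in>W. A *v \<phi> s = \<phi> (X s)"
    and "\<And>A. A \<in> G \<Longrightarrow> \<exists>X\<in>\<gg>. \<forall>s\<in>W. A *v \<phi> s = \<phi> (X s)"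
  shows "transport W \<phi> \<gg> = G"
proof -
  have "A = B" if "\<forall>s\<in>W. A *v \<phi> s = \<phi> (X s)" "\<forall>s\<in>W. B *v \<phi> s
    = \<phi> (X s)" for A B X
  proof -
    have "A *v v = B *v v" for v
      using assms(1) that by (metis UNIV_I bij_betw_imp_surj_on imageE)
    then show ?thesis by (simp add: matrix_eq)
  qed
  then show ?thesis using assms(2,3) unfolding transport_def by blast
qed

lemma so2_entries:
  assumes "B \<in> so2"
  shows "B$1$1 = 0" "B$2$2 = 0" "B$1$2 = - (B$2$1)"
proof -
  have "B$j$i = - (B$i$j)" for i j
  proof -
    have "transpose B $ i $ j = (- B) $ i $ j" using assms by (simp add: so2_def)
    then show ?thesis by (simp only: transpose_def vec_lambda_beta vector_uminus_component)
  qed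
  from this[of 1 1] this[of 2 2] this[of 1 2]
  show "B$1$1 = 0" "B$2$2 = 0" "B$1$2 = - (B$2$1)" by linarith+
qed

lemma transport_u11: "transport UNIV u11_map sl_plus_so = u11_std"
proof (rule transport_eqI)
  show "bij u11_map" using u11_map_iso by (simp add: symplectic_iso_def)
next
  fix X assume "X \<in> sl_plus_so"
  then obtain A B where X: "X = (\<lambda>M. A ** M + M ** transpose B)" and A: "A \<in> sl2" and B: "B \<in> so2"
    by (auto simp: sl_plus_so_def)
  have A': "A$2$2 = - (A$1$1)" using A by (simp add: sl2_def trace_def sum_2)
  have B': "B$1$1 = 0" "B$2$2 = 0" "B$1$2 = - (B$2$1)"
    using so2_entries[OF B] by auto
  let ?N = "M (- (A$1$1)) (- (B$2$1)) (B$2$1) (- (A$1$1)) (A$2$1) 0 (A$2$1) (A$1$2) 0 (A$1$2)"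
  have "?N \<in> u11_std" unfolding u11_std_def by blast
  moreover have "?N *v u11_map s = u11_map (X s)" for s
    by (simp add: u11_map_def X vec_eq_iff forall_4 matrix_matrix_mult_def sum_2 A' B' transpose_def)
  ultimately show "\<exists>A\<in>u11_std. \<forall>s\<in>UNIV. A *v u11_map s = u11_map (X s)" by blast
next
  fix A assume "A \<in> u11_std"
  then obtain x y z r where A: "A = M x (- r) r x z 0 z y 0 y" by (auto simp: u11_std_def)
  let ?A = "vector [vector [- x, y], vector [z, x]] :: real^2^2"
  let ?B = "vector [vector [0, - r], vector [r, 0]] :: real^2^2"
  have "?A \<in> sl2" "?B \<in> so2"
    by (auto simp: sl2_def so2_def trace_def sum_2 transpose_def vec_eq_iff forall_2)
  then have "(\<lambda>M. ?A ** M + M ** transpose ?B) \<in> sl_plus_so" unfolding sl_plus_so_def by blast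
  then show "\<exists>X\<in>sl_plus_so. \<forall>s\<in>UNIV. A *v u11_map s = u11_map (X s)"
    by (rule bexI[rotated]) (simp add: A u11_map_def vec_eq_iff forall_4 matrix_matrix_mult_def sum_2 transpose_def)
qed

lemma u11_std_mem: "u11_std \<in> u11_algebras"
  unfolding u11_algebras_def using transport_u11 u11_map_iso by blast

section \<open>The irreducible model on binary cubics\<close>

text \<open>The invariant form on cubics carries the binomial weights 1 and 3; the factor 3 absorbs
  the second, so that pulling back \<open>Omega\<close> gives an invariant form.\<close>

definition S3_map :: "real^2^2^2 \<Rightarrow> V" where
  "S3_map T = vector [T$1$1$1, T$1$2$2, T$2$2$2, 3 * T$1$1$2]"

definition S3_form :: "real^2^2^2 \<Rightarrow> real^2^2^2 \<Rightarrow> real" where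
  "S3_form s t = Omega (S3_map s) (S3_map t)"

definition S3_vec :: "real \<Rightarrow> real \<Rightarrow> real \<Rightarrow> real \<Rightarrow> real^2^2^2" where
  "S3_vec x y z w = vector [vector [vector [x, y], vector [y, z]], vector [vector [y, z], vector [z, w]]]"

lemma S3_vec_nth [simp]:
  "S3_vec x y z w $ 1 $ 1 = vector [x, y]" "S3_vec x y z w $ 1 $ 2 = vector [y, z]"
  "S3_vec x y z w $ 2 $ 1 = vector [y, z]" "S3_vec x y z w $ 2 $ 2 = vector [z, w]"
  by (simp_all add: S3_vec_def)

lemma S3_eq_vec: "s \<in> S3 \<longleftrightarrow> (\<exists>x y z w. s = S3_vec x y z w)"
proof
  assume "s \<in> S3"
  then have s: "s$i$j$k = s$j$i$k" "s$i$j$k = s$i$k$j" for i j k by (auto simp: S3_def)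
  have "s = S3_vec (s$1$1$1) (s$1$1$2) (s$1$2$2) (s$2$2$2)"
    using s(1)[of 1 2 1] s(1)[of 1 2 2] s(2)[of 1 1 2] s(2)[of 2 1 2]
    by (simp add: vec_eq_iff forall_2)
  then show "\<exists>x y z w. s = S3_vec x y z w" by blast
qed (auto simp: S3_def forall_2)

lemma S3_action_vec:
  assumes "A \<in> sl2"
  shows "S3_action A (S3_vec x y z w) = S3_vec (3*(A$1$1*x + A$1$2*y)) (A$2$1*x + A$1$1*y + 2*A$1$2*z)
     (2*A$2$1*y - A$1$1*z + A$1$2*w) (3*(A$2$1*z - A$1$1*w))"
proof -
  have "A$2$2 = - (A$1$1)" using assms by (simp add: sl2_def trace_def sum_2)
  then show ?thesis
    by (simp add: S3_action_def vec_eq_iff forall_2 sum_2 algebra_simps)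
qed

lemma S3_map_vec: "S3_map (S3_vec x y z w) = vector [x, z, w, 3*y]"
  by (simp add: S3_map_def)

lemma S3_form_vec: "S3_form (S3_vec x y z w) (S3_vec x' y' z' w') = w*x' - x*w' + 3*(y*z' - z*y')"
  by (simp add: S3_form_def S3_map_def Omega_def algebra_simps)

lemma linear_S3_map: "linear S3_map"
  by (rule linearI) (simp_all add: S3_map_def vec_eq_iff forall_4)

lemma bij_S3_map: "bij_betw S3_map S3 UNIV"
proof (rule bij_betw_byWitness[of _ "\<lambda>v. S3_vec (v$1) (v$4 / 3) (v$2) (v$3)"])
  show "\<forall>a\<in>S3. S3_vec (S3_map a $ 1) (S3_map a $ 4 / 3) (S3_map a $ 2) (S3_map a $ 3) = a"
    by (auto simp: S3_eq_vec S3_map_vec)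
  show "\<forall>a'\<in>UNIV. S3_map (S3_vec (a'$1) (a'$4 / 3) (a'$2) (a'$3)) = a'"
    by (simp add: S3_map_vec vec_eq_iff forall_4)
qed (use S3_eq_vec in blast)+

lemma S3_map_iso: "symplectic_iso S3 S3_form S3_map"
  by (simp add: symplectic_iso_def linear_S3_map bij_S3_map S3_form_def)

lemma S3_form_symplectic: "symplectic_form_on S3 S3_form"
proof -
  have "bilinear S3_form"
    unfolding bilinear_def S3_form_def
    by (auto intro!: linearI simp: Omega_linear linear_add[OF linear_S3_map] linear_scale[OF linear_S3_map])
  moreover have "s = 0" if "s \<in> S3" "\<forall>t\<in>S3. S3_form s t = 0" for s
  proof -
    have "Omega (S3_map s) v = 0" for v
    proof -
      obtain t where "t \<in> S3" "v = S3_map t"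
        using bij_S3_map by (metis UNIV_I bij_betw_imp_surj_on imageE)
      then show ?thesis using that by (simp add: S3_form_def)
    qed
    then have "S3_map s = S3_map 0" using Omega_nondegenerate linear_0[OF linear_S3_map] by metis
    moreover have "0 \<in> S3" by (simp add: S3_def)
    ultimately show ?thesis using bij_S3_map that by (auto simp: bij_betw_def inj_on_def)
  qed
  ultimately show ?thesis by (simp add: symplectic_form_on_def S3_form_def)
qed

lemma S3_form_invariant: "sl2_invariant_on_S3 S3_form"
  unfolding sl2_invariant_on_S3_def
  by (auto simp: S3_eq_vec S3_action_vec S3_form_vec algebra_simps)

lemma transport_sl24: "transport S3 S3_map (S3_action ` sl2) = sl24_std"
proof (rule transport_eqI[OF bij_S3_map])
  fix X assume "X \<in> S3_action ` sl2"
  then obtain A where A: "A \<in> sl2" "X = S3_action A" by auto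
  define z where "z = A$2$1/3"
  then have z: "A$2$1 = 3 * z" by simp
  let ?N = "M (3*A$1$1) 0 0 (- (A$1$1)) 0 (A$1$2) (2*z) 0 (9*z) (6*A$1$2)"
  have "?N \<in> sl24_std" unfolding sl24_std_def by blast
  moreover have "?N *v S3_map (S3_vec x y u w) = S3_map (X (S3_vec x y u w))" for x y u w
    by (simp add: A(2) S3_action_vec[OF A(1)] S3_map_vec vec_eq_iff forall_4 z)
  then have "\<forall>s\<in>S3. ?N *v S3_map s = S3_map (X s)" using S3_eq_vec by metis
  ultimately show "\<exists>N\<in>sl24_std. \<forall>s\<in>S3. N *v S3_map s = S3_map (X s)" by blast
next
  fix N assume "N \<in> sl24_std"
  then obtain x y z where N: "N = M (3*x) 0 0 (- x) 0 y (2*z) 0 (9*z) (6*y)" by (auto simp: sl24_std_def)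
  let ?A = "vector [vector [x, y], vector [3*z, -x]] :: real^2^2"
  have A: "?A \<in> sl2" by (auto simp: sl2_def trace_def sum_2)
  have "N *v S3_map (S3_vec x y u w) = S3_map (S3_action ?A (S3_vec x y u w))" for x y u w
    by (simp add: N S3_action_vec[OF A] S3_map_vec vec_eq_iff forall_4)
  then have "\<forall>s\<in>S3. N *v S3_map s = S3_map (S3_action ?A s)" using S3_eq_vec by metis
  then show "\<exists>X\<in>S3_action ` sl2. \<forall>s\<in>S3. N *v S3_map s = S3_map (X s)" using A by blast
qed

lemma sl24_std_mem: "sl24_std \<in> sl24_algebras"
  unfolding sl24_algebras_def
  using transport_sl24 S3_form_symplectic S3_form_invariant S3_map_iso by blast

section \<open>The algebras of dimension at most two\<close>

lemma cartan_sum_eq: "cartan_sum = {M 0 0 0 t (- r) 0 0 r 0 0 | r t. True}"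
proof -
  have b: "block_sum A N = vector [vector [A$1$1, 0, A$1$2, 0], vector [0, N$1$1, 0, N$1$2],
      vector [A$2$1, 0, A$2$2, 0], vector [0, N$2$1, 0, N$2$2]]" for A N
  proof -
    have "linear (\<lambda>w::V. (A$1$1 * w$1 + A$1$2 * w$3) *\<^sub>R p1 + (A$2$1 * w$1 + A$2$2 * w$3) *\<^sub>R q1 +
     (N$1$1 * w$2 + N$1$2 * w$4) *\<^sub>R p2 + (N$2$1 * w$2 + N$2$2 * w$4) *\<^sub>R q2)"
      by (rule linearI) (simp_all add: algebra_simps)
    then have "block_sum A N *v w
      = (A$1$1 * w$1 + A$1$2 * w$3) *\<^sub>R p1 + (A$2$1 * w$1 + A$2$2 * w$3) *\<^sub>R q1 +
     (N$1$1 * w$2 + N$1$2 * w$4) *\<^sub>R p2 + (N$2$1 * w$2 + N$2$2 * w$4) *\<^sub>R q2" for w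
      unfolding block_sum_def by (simp add: matrix_works)
    then show ?thesis
      by (simp add: matrix_eq vec_eq_iff forall_4 p1_def p2_def q1_def q2_def axis_def
        matrix_vector_mult_def sum_4)
  qed
  show ?thesis
  proof (intro set_eqI iffI)
    fix X assume "X \<in> cartan_sum"
    then obtain A t where X: "X = block_sum A (t *\<^sub>R vector [vector [1, 0], vector [0, -1]])" "A \<in> so2"
      by (auto simp: cartan_sum_def)
    have "A$1$1 = 0" "A$2$2 = 0" "A$1$2 = - (A$2$1)"
      using so2_entries[OF X(2)] by auto
    then have "X = M 0 0 0 t (- (A$2$1)) 0 0 (A$2$1) 0 0"
      by (simp add: X(1) b vec_eq_iff forall_4)
    then show "X \<in> {M 0 0 0 t (- r) 0 0 r 0 0 | r t. True}" by blast
  next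
    fix X assume "X \<in> {M 0 0 0 t (- r) 0 0 r 0 0 | r t. True}"
    then obtain r t where X: "X = M 0 0 0 t (- r) 0 0 r 0 0" by blast
    let ?A = "vector [vector [0, - r], vector [r, 0]] :: real^2^2"
    have "?A \<in> so2" by (simp add: so2_def transpose_def vec_eq_iff forall_2)
    moreover have "X = block_sum ?A (t *\<^sub>R vector [vector [1, 0], vector [0, -1]])"
      by (simp add: X b vec_eq_iff forall_4)
    ultimately show "X \<in> cartan_sum" unfolding cartan_sum_def by blast
  qed
qed

lemma D412_eq: "D412 \<epsilon> = {M a 0 c 0 0 0 (- 2 * \<epsilon> * a) 0 0 0 | a c. True}"
proof -
  have "span {x, y} = {a *\<^sub>R x + c *\<^sub>R y | a c. True}" for x y :: glV
    by (auto simp: span_insert span_singleton algebra_simps)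
  then show ?thesis by (simp add: D412_def quad_basis mult_ac)
qed

lemma line_algebra_eq: "line_algebra \<epsilon>
  = {M 0 0 0 0 (- 2 * \<epsilon> * t) 0 (- 2 * t) 0 0 (2 * t) | t. True}"
  unfolding line_algebra_def by (auto simp: span_singleton quad_basis mult_ac)

lemma listed_gl: "L \<subseteq> gl_std \<Longrightarrow> listed L"
  and listed_u11: "L \<subseteq> u11_std \<Longrightarrow> listed L"
  and listed_sl24: "L \<subseteq> sl24_std \<Longrightarrow> listed L"
  and listed_u2: "L \<subseteq> u2 \<Longrightarrow> listed L"
  and listed_cartan: "L \<subseteq> cartan_sum \<Longrightarrow> listed L"
  and listed_D412: "L \<subseteq> D412 \<epsilon> \<Longrightarrow> \<epsilon> = 1 \<or> \<epsilon> = -1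
    \<Longrightarrow> listed L"
  and listed_line: "L \<subseteq> line_algebra \<epsilon> \<Longrightarrow> \<epsilon> = 1 \<or> \<epsilon> = -1
    \<Longrightarrow> listed L"
  using gl_std_mem u11_std_mem sl24_std_mem listedI[of _ L]
  unfolding finite_type_list_def by blast+

section \<open>Subalgebras containing a nilpotent element\<close>

lemma coords_mem:
  assumes "symplectic_basis P1 P2 Q1 Q2" "elliptic_subalgebra L" "X \<in> L"
  shows "coords P1 P2 Q1 Q2 X \<in> pullback (frame P1 P2 Q1 Q2) L"
  using assms by (intro pullback_memI[of _ X] frame_in_SpV frame_coords) (auto simp: elliptic_subalgebra_def)

lemma coords_subset:
  assumes s: "symplectic_basis P1 P2 Q1 Q2" and L: "elliptic_subalgebra L"
    and G: "\<And>X. X \<in> L \<Longrightarrow> coords P1 P2 Q1 Q2 X \<in> G"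
  shows "pullback (frame P1 P2 Q1 Q2) L \<subseteq> G"
proof
  let ?S = "frame P1 P2 Q1 Q2"
  fix Y assume "Y \<in> pullback ?S L"
  then obtain X where X: "X \<in> L" "X ** ?S = ?S ** Y" using pullback_memD[OF frame_in_SpV[OF s]] by blast
  have "X ** ?S = ?S ** coords P1 P2 Q1 Q2 X"
    using frame_coords[OF s] X L unfolding elliptic_subalgebra_def by blast
  then have "matrix_inv ?S ** (?S ** Y) = matrix_inv ?S ** (?S ** coords P1 P2 Q1 Q2 X)"
    using X by simp
  then have "Y = coords P1 P2 Q1 Q2 X" by (simp only: SpV_cancel[OF frame_in_SpV[OF s]])
  then show "Y \<in> G" using G X by simp
qed

lemma listed_frame:
  assumes "symplectic_basis P1 P2 Q1 Q2" "elliptic_subalgebra L"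
    and "elliptic_subalgebra (pullback (frame P1 P2 Q1 Q2) L)
      \<Longrightarrow> listed (pullback (frame P1 P2 Q1 Q2) L)"
  shows "listed L"
  using listed_pullback[OF frame_in_SpV[OF assms(1)]]
    elliptic_subalgebra_pullback[OF frame_in_SpV[OF assms(1)] assms(2)] assms(3) by blast

lemma listed_coordsI:
  assumes s: "symplectic_basis P1 P2 Q1 Q2" and L: "elliptic_subalgebra L"
    and G: "\<And>L. L \<subseteq> G \<Longrightarrow> listed L" "\<And>X. X \<in> L
      \<Longrightarrow> coords P1 P2 Q1 Q2 X \<in> G"
  shows "listed L"
  using listed_frame[OF s L] coords_subset[OF s L, of G] G by blast

section \<open>Real rank one elements and pencils of quadratic forms\<close>

lemma quad_linear:
  "quad (u + v) w = quad u w + quad v w" "quad w (u + v) = quad w u + quad w v"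
  "quad (u - v) w = quad u w - quad v w" "quad w (u - v) = quad w u - quad w v"
  "quad (r *\<^sub>R u) w = r *\<^sub>R quad u w" "quad w (r *\<^sub>R u) = r *\<^sub>R quad w u"
  "quad 0 w = 0" "quad w 0 = 0"
  by (simp_all add: quad_M M_eq_iff M_eq_0_iff algebra_simps)

lemma quad_commute: "quad u v = quad v u"
  by (simp add: quad_M M_eq_iff algebra_simps)

text \<open>The case v = 0 of ellipticity: no real rank one element.\<close>

lemma elliptic_subalgebra_square:
  assumes "elliptic_subalgebra L" "r *\<^sub>R quad u u \<in> L" "u \<noteq> 0"
  shows "r = 0"
proof (rule ccontr)
  assume "r \<noteq> 0"
  then have "quad u u \<in> L" using elliptic_subalgebra_closed(4)[OF assms(1,2), of "1 / r"] by simp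
  then show False using elliptic_subalgebra_elliptic[OF assms(1), of u 0] elliptic_subalgebra_closed(1)[OF assms(1)] assms(3)
    by (simp add: quad_linear)
qed

text \<open>The pencil x u^2 + y v^2 + c uv contains degenerate members. For xy > 0 these are
  squares of real vectors; for xy < 0 the form itself is a difference of squares whose mixed product
  is a multiple of uv, and ellipticity applies directly.\<close>

lemma elliptic_subalgebra_pencil:
  assumes L: "elliptic_subalgebra L" and xy: "x *\<^sub>R quad u u + y *\<^sub>R quad v v \<in> L"
    and uv: "quad u v \<in> L"
    and nz: "u \<noteq> 0" "v \<noteq> 0"
  shows "x = 0 \<and> y = 0"
proof -
  have pos: False if "x *\<^sub>R quad u u + y *\<^sub>R quad v v \<in> L" "x > 0" "y > 0" for x y
  proof -
    have "s * s = 1 \<Longrightarrow> sqrt x *\<^sub>R u + (s * sqrt y) *\<^sub>R v = 0" for s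
    proof -
      assume s: "s * s = 1"
      have "1 *\<^sub>R quad (sqrt x *\<^sub>R u + (s * sqrt y) *\<^sub>R v) (sqrt x *\<^sub>R u + (s * sqrt y) *\<^sub>R v)
          = (x *\<^sub>R quad u u + y *\<^sub>R quad v v) + (2 * s * sqrt x * sqrt y) *\<^sub>R quad u v"
        using that s quad_commute[of v u] by (simp add: quad_linear algebra_simps flip: scaleR_add_left)
      then show ?thesis using elliptic_subalgebra_square[OF L] that uv elliptic_subalgebra_closed[OF L]
        by (metis zero_neq_one)
    qed
    \<comment> \<open>Both signs are used because \<open>u\<close> and \<open>v\<close> may be
      dependent; adding the two relations eliminates \<open>v\<close>.\<close>
    from this[of 1] this[of "-1"]
    have "(sqrt x *\<^sub>R u + (1 * sqrt y) *\<^sub>R v) + (sqrt x *\<^sub>R u + (-1 * sqrt y) *\<^sub>R v) = 0"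
      by simp
    then have "2 *\<^sub>R (sqrt x *\<^sub>R u) = 0" unfolding scaleR_2 by simp
    then show False using that nz by simp
  qed
  have mixed: False if "x *\<^sub>R quad u u + y *\<^sub>R quad v v \<in> L" "x > 0" "y < 0" for x y
  proof -
    have "quad (sqrt x *\<^sub>R u) (sqrt x *\<^sub>R u) - quad (sqrt (- y) *\<^sub>R v) (sqrt (- y) *\<^sub>R v)
        = x *\<^sub>R quad u u + y *\<^sub>R quad v v"
      using that by (simp add: quad_linear)
    moreover have "quad (sqrt x *\<^sub>R u) (sqrt (- y) *\<^sub>R v) \<in> L"
      using uv elliptic_subalgebra_closed[OF L] by (simp add: quad_linear)
    ultimately have "sqrt x *\<^sub>R u = 0" using elliptic_subalgebra_elliptic[OF L] that by metis
    then show False using that nz by simp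
  qed
  have m: "(- x) *\<^sub>R quad u u + (- y) *\<^sub>R quad v v \<in> L"
    using elliptic_subalgebra_closed(6)[OF L xy] by simp
  show ?thesis
  proof (cases "x = 0 \<or> y = 0")
    case True
    then show ?thesis using elliptic_subalgebra_square[OF L] xy nz by auto
  next
    case False
    then show ?thesis using pos[of x y] pos[of "-x" "-y"] mixed[of x y] mixed[of "-x" "-y"] xy m
      by (smt (verit))
  qed
qed

lemma axis_nonzero: "p1 \<noteq> 0" "p2 \<noteq> 0" "q1 \<noteq> 0" "q2 \<noteq> 0"
  by (simp_all add: p1_def p2_def q1_def q2_def axis_eq_0_iff)

subsection \<open>Indefinite square-zero elements\<close>

context
  fixes L assumes L: "elliptic_subalgebra L" and N: "M 0 0 0 0 0 1 0 0 0 0 \<in> L"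
begin

text \<open>Here N is -p1p2, and subtracting a multiple of N leaves a combination of p1^2 and
  p2^2.\<close>

lemma indefinite_pencil: "M 0 0 0 0 x y z 0 0 0 \<in> L \<Longrightarrow> x = 0 \<and> z = 0"
proof -
  assume Y: "M 0 0 0 0 x y z 0 0 0 \<in> L"
  have "(- x/2) *\<^sub>R quad p1 p1 + (- z/2) *\<^sub>R quad p2 p2 \<in> L"
    using elliptic_subalgebra_closed(3)[OF L Y elliptic_subalgebra_closed(4)[OF L N, of y]] by (simp add: quad_basis)
  moreover have "quad p1 p2 \<in> L"
    using elliptic_subalgebra_closed(6)[OF L N] elliptic_subalgebra_closed(4)[OF L N, of "-1"]
    by (simp add: quad_basis)
  ultimately show ?thesis using elliptic_subalgebra_pencil[OF L] axis_nonzero by fastforce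
qed

lemma indefinite_lower: "M a b c d e f g h i j \<in> L \<Longrightarrow> h = 0 \<and> j = 0"
  using indefinite_pencil[of "-2*j" "-2*i"
    "-2*h"] elliptic_subalgebra_closed(5)[OF L N] elliptic_subalgebra_closed(5)[OF L N elliptic_subalgebra_closed(5)[OF L N]]
  by fastforce

lemma indefinite_stab: "M a b c d e f g 0 0 0 \<in> L \<Longrightarrow> b = 0 \<and> c = 0"
  using indefinite_pencil[of "-2*b" "-(a+d)" "-2*c"] elliptic_subalgebra_closed(5)[OF L N, of "M a b c d e f g 0 0 0"]
  by simp

lemma indefinite_graded:
  assumes H: "M 1 0 0 1 0 0 0 0 0 0 \<in> L"
  shows "L \<subseteq> {M a 0 0 d 0 f 0 0 i 0 | a d f i. True}"
proof
  fix Y assume Y: "Y \<in> L"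
  then obtain a b c d e f g h i j where M: "Y = M a b c d e f g h i j" by (rule elliptic_subalgebra_cases[OF L])
  have hj: "h = 0" "j = 0" using indefinite_lower Y M by auto
  note cl = elliptic_subalgebra_closed[OF L]
  let ?Z = "lie_bracket (M 1 0 0 1 0 0 0 0 0 0) Y"
  have Z: "?Z \<in> L" "lie_bracket (M 1 0 0 1 0 0 0 0 0 0) ?Z \<in> L" by (intro cl H Y)+
  \<comment> \<open>With H = 1 on P and -1 on Q, ad H has weights 2, 0, -2 on the upper, diagonal
    and lower blocks. Applying D^2 + 2D or D^2 - 2D isolates the upper or lower block with the
    factor 8.\<close>
  have "lie_bracket (M 1 0 0 1 0 0 0 0 0 0) ?Z + 2 *\<^sub>R ?Z \<in> L"
    "lie_bracket (M 1 0 0 1 0 0 0 0 0 0) ?Z - 2 *\<^sub>R ?Z \<in> L" by (intro cl Z)+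
  then have 1: "M 0 0 0 0 (8*e) (8*f) (8*g) 0 0 0 \<in> L" "M 0 0 0 0 0 0 0 0 (8*i) 0 \<in> L"
    by (simp_all add: M hj)
  then have 2: "e = 0" "g = 0" using indefinite_pencil[OF 1(1)] by simp_all
  have "Y - (1/8) *\<^sub>R M 0 0 0 0 (8*e) (8*f) (8*g) 0 0 0 - (1/8) *\<^sub>R M 0 0 0 0 0 0 0 0 (8*i) 0 \<in> L"
    by (intro cl 1 Y)
  then have "b = 0 \<and> c = 0" using indefinite_stab[of a b c d 0 0 0] by (simp add: M hj)
  then show "Y \<in> {M a 0 0 d 0 f 0 0 i 0 | a d f i. True}" using M hj 2 by blast
qed

end

text \<open>These matrices preserve the Lagrangian planes span(p1, q2) and span(p2, q1), so
  exchanging p2 and q2 up to sign brings them into \<open>gl_std\<close>.\<close>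

lemma listed_indefinite_diag:
  assumes L: "elliptic_subalgebra L" "L \<subseteq> {M a 0 0 d 0 f 0 0 i 0 | a d f i. True}"
  shows "listed L"
proof (rule listed_coordsI[OF _ L(1)])
  show "symplectic_basis (vector [1,0,0,0]) (vector [0,0,0,1]) (vector [0,0,1,0]) (vector [0,-1,0,0])"
    by (simp add: symplectic_basis_def Omega_def)
  show "\<And>L. L \<subseteq> gl_std \<Longrightarrow> listed L" by (rule listed_gl)
  fix X assume "X \<in> L"
  then obtain a d f i where X: "X = M a 0 0 d 0 f 0 0 i 0" using L(2) by blast
  show "coords (vector [1,0,0,0]) (vector [0,0,0,1]) (vector [0,0,1,0]) (vector [0,-1,0,0]) X \<in> gl_std"
    by (simp add: coords_def X Omega_def gl_std_def M_eq_iff)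
qed

text \<open>The shear along P fixes every pure upper block, so it can straighten another element
  without disturbing the square-zero one already normalised.\<close>

lemma symplectic_basis_unipotent:
  "symplectic_basis (vector [1,0,0,0]) (vector [0,1,0,0]) (vector [x,y,1,0]) (vector [y,z,0,1])"
  by (simp add: symplectic_basis_def Omega_def)

lemma coords_unipotent:
  "coords (vector [1,0,0,0]) (vector [0,1,0,0]) (vector [x,y,1,0]) (vector [y,z,0,1]) (M a b c d e f g 0 0 0)
   = M a b c d (e + 2*(a*x + b*y)) (f + a*y + b*z + c*x + d*y) (g + 2*(c*y + d*z)) 0 0 0"
  by (simp add: coords_def Omega_def M_eq_iff algebra_simps)

lemma listed_D412_form:
  assumes L: "elliptic_subalgebra L" "L \<subseteq> {M a 0 0 0 0 f (k*a) 0 0 0 | a f. True}"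
  shows "listed L"
proof (cases "k = 0")
  case True
  then show ?thesis using listed_indefinite_diag[OF L(1)] L(2) by fastforce
next
  case False
  \<comment> \<open>Scaling p2 by \<open>t\<close> divides the coefficient of p2^2 by t^2; the
    choice leaves twice the sign of \<open>k\<close>, the normalisation in
    \<open>D412\<close>.\<close>
  define t where "t = sqrt (\<bar>k\<bar>/2)"
  have t: "t > 0" "t * t = \<bar>k\<bar> / 2" using False by (simp_all add: t_def)
  have s: "symplectic_basis (vector [0,0,1,0]) (vector [0,t,0,0]) (vector [-1,0,0,0]) (vector [0,0,0,1/t])"
    using t by (simp add: symplectic_basis_def Omega_def)
  have e: "sgn k = 1 \<or> sgn k = -1" using False by (simp add: sgn_if)
  show ?thesis
  proof (rule listed_coordsI[OF s L(1), of "D412 (sgn k)"])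
    show "\<And>L. L \<subseteq> D412 (sgn k) \<Longrightarrow> listed L" using listed_D412 e by blast
    fix X assume "X \<in> L"
    then obtain a f where X: "X = M a 0 0 0 0 f (k*a) 0 0 0" using L(2) by blast
    have "k = 2 * sgn k * (t * t)" using t(2) by (auto simp: sgn_if abs_if)
    then have "k / (t * t) = 2 * sgn k" using t(1) by (simp add: field_simps)
    then have "k * a / (t * t) = 2 * sgn k * a" by (metis times_divide_eq_left)
    then show "coords (vector [0,0,1,0]) (vector [0,t,0,0]) (vector [-1,0,0,0]) (vector [0,0,0,1/t]) X \<in> D412 (sgn k)"
      using t(1) by (simp add: coords_def X Omega_def D412_eq M_eq_iff)
  qed
qed

text \<open>If some element has a lower block, its bracket with N is, up to a shear and a multiple
  of N, the grading element, and \<open>indefinite_graded\<close> applies. Otherwise L stabilises P,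
  acts diagonally on it, and is straightened by a shear as far as possible.\<close>

lemma listed_indefinite:
  assumes L: "elliptic_subalgebra L" and N: "M 0 0 0 0 0 1 0 0 0 0 \<in> L"
  shows "listed L"
proof (cases "\<forall>a b c d e f g h i j. M a b c d e f g h i j \<in> L \<longrightarrow> i = 0")
  case True
  note cl = elliptic_subalgebra_closed[OF L]
  have form: "\<exists>a d e f g. X = M a 0 0 d e f g 0 0 0" if X: "X \<in> L" for X
  proof -
    obtain a b c d e f g h i j where M: "X = M a b c d e f g h i j" using X by (rule elliptic_subalgebra_cases[OF L])
    have "h = 0" "j = 0" "i = 0" using indefinite_lower[OF L N] True X M by metis+
    moreover from this have "b = 0" "c = 0" using indefinite_stab[OF L N] X M by metis+
    ultimately show ?thesis using M by blast
  qed
  \<comment> \<open>The commutator is a pure upper block, hence a multiple of N. So (a, e) and (d,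
    g) are proportional between any two elements, and one shear serves all of them.\<close>
  have br: "a * e' = a' * e \<and> d * g' = d' * g"
    if "M a 0 0 d e f g 0 0 0 \<in> L" "M a' 0 0 d' e' f' g' 0 0 0 \<in> L" for a d e f g a' d' e' f' g'
    using cl(5)[OF that] indefinite_pencil[OF L N, of "2*(a*e'-a'*e)" "(a+d)*f' - (a'+d')*f" "2*(d*g'-d'*g)"]
    by (simp add: algebra_simps)
  let ?A = "\<exists>a d e f g. M a 0 0 d e f g 0 0 0 \<in> L \<and> a \<noteq> 0"
  let ?D = "\<exists>a d e f g. M a 0 0 d e f g 0 0 0 \<in> L \<and> d \<noteq> 0"
  \<comment> \<open>A shear changes \<open>g\<close> by a multiple of \<open>d\<close>. If
    \<open>d\<close> vanishes throughout, \<open>g\<close> cannot be removed but stays proportional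
    to \<open>a\<close>: this is how \<open>D412\<close> arises.\<close>
  have onlyA: "listed K" if K: "elliptic_subalgebra K" and NK: "M 0 0 0 0 0 1 0 0 0 0 \<in> K"
      and fK: "\<And>X. X \<in> K \<Longrightarrow> \<exists>a e f g. X = M a 0 0 0 e f g 0 0 0"
      and Y0: "M a0 0 0 0 e0 f0 g0 0 0 0 \<in> K" "a0 \<noteq> 0" for K a0 e0 f0 g0
  proof (rule listed_frame[OF symplectic_basis_unipotent[of "- e0/(2*a0)" 0 0] K])
    let ?K = "pullback (frame (vector [1,0,0,0]) (vector [0,1,0,0]) (vector [- e0/(2*a0),0,1,0]) (vector [0,0,0,1])) K"
    assume ad: "elliptic_subalgebra ?K"
    have "?K \<subseteq> {M a 0 0 0 0 f ((g0/a0)*a) 0 0 0 | a f. True}"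
    proof (rule coords_subset[OF symplectic_basis_unipotent K])
      fix X assume X: "X \<in> K"
      obtain a e f g where M: "X = M a 0 0 0 e f g 0 0 0" using fK[OF X] by blast
      have "X - (a/a0) *\<^sub>R M a0 0 0 0 e0 f0 g0 0 0 0 \<in> K" by (intro elliptic_subalgebra_closed[OF K] X Y0)
      then have "e = (a/a0) * e0" "g = (a/a0) * g0"
        using indefinite_pencil[OF K NK, of "e - (a/a0)*e0" "f - (a/a0)*f0" "g - (a/a0)*g0"] Y0(2) by (auto simp: M)
      then show "coords (vector [1,0,0,0]) (vector [0,1,0,0]) (vector [- e0/(2*a0),0,1,0]) (vector [0,0,0,1]) X
        \<in> {M a 0 0 0 0 f ((g0/a0)*a) 0 0 0 | a f. True}"
        using coords_unipotent[of "- e0/(2*a0)" 0 0 a 0 0 0 e f g] Y0(2)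
        by (simp add: M M_eq_iff)
    qed
    then show "listed ?K" by (rule listed_D412_form[OF ad])
  qed
  consider "?A" "?D" | "?A" "\<not> ?D" | "\<not> ?A" "?D" | "\<not> ?A" "\<not> ?D" by blast
  then show ?thesis
  proof cases
    case 1
    then obtain a0 d0 e0 f0 g0 a1 d1 e1 f1 g1 where Y0: "M a0 0 0 d0 e0 f0 g0 0 0 0 \<in> L" "a0 \<noteq> 0"
      and Y1: "M a1 0 0 d1 e1 f1 g1 0 0 0 \<in> L" "d1 \<noteq> 0" by blast
    show ?thesis
    proof (rule listed_frame[OF symplectic_basis_unipotent[of "- e0/(2*a0)" 0 "- g1/(2*d1)"] L])
      let ?K = "pullback (frame (vector [1,0,0,0]) (vector [0,1,0,0]) (vector [- e0/(2*a0),0,1,0]) (vector [0,- g1/(2*d1),0,1])) L"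
      assume ad: "elliptic_subalgebra ?K"
      have "?K \<subseteq> {M a 0 0 d 0 f 0 0 i 0 | a d f i. True}"
      proof (rule coords_subset[OF symplectic_basis_unipotent L])
        fix X assume X: "X \<in> L"
        obtain a d e f g where M: "X = M a 0 0 d e f g 0 0 0" using form[OF X] by blast
        have "a0 * e = a * e0" "d1 * g = d * g1" using br[OF Y0(1)] br[OF Y1(1)] X M by auto
        then have "e + 2*(a * (- e0/(2*a0))) = 0" "g + 2*(d*(- g1/(2*d1))) = 0"
          using Y0(2) Y1(2) by (simp_all add: field_simps)
        then show "coords (vector [1,0,0,0]) (vector [0,1,0,0]) (vector [- e0/(2*a0),0,1,0]) (vector [0,- g1/(2*d1),0,1]) X
          \<in> {M a 0 0 d 0 f 0 0 i 0 | a d f i. True}"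
          using coords_unipotent[of "- e0/(2*a0)" 0 "- g1/(2*d1)" a 0 0 d e f g]
          by (simp add: M M_eq_iff)
      qed
      then show "listed ?K" by (rule listed_indefinite_diag[OF ad])
    qed
  next
    case 2
    then obtain a0 d0 e0 f0 g0 where Y0: "M a0 0 0 d0 e0 f0 g0 0 0 0 \<in> L" "a0 \<noteq> 0" by blast
    have "d0 = 0" using 2 Y0 by blast
    moreover have "\<exists>a e f g. X = M a 0 0 0 e f g 0 0 0" if "X \<in> L" for X
      using form[OF that] 2 that by metis
    ultimately show ?thesis using onlyA[OF L N] Y0 by blast
  next
    case 3
    then obtain a0 d0 e0 f0 g0 where Y0: "M a0 0 0 d0 e0 f0 g0 0 0 0 \<in> L" "d0 \<noteq> 0" by blast
    have a0: "a0 = 0" using 3 Y0 by blast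
    have s: "symplectic_basis (vector [0,1,0,0]) (vector [1,0,0,0]) (vector [0,0,0,1]) (vector [0,0,1,0])"
      by (simp add: symplectic_basis_def Omega_def)
    have c: "coords (vector [0,1,0,0]) (vector [1,0,0,0]) (vector [0,0,0,1]) (vector [0,0,1,0])
      (M a 0 0 d e f g 0 0 0) = M d 0 0 a g f e 0 0 0" for a d e f g
      by (simp add: coords_def Omega_def)
    show ?thesis
    proof (rule listed_frame[OF s L])
      let ?K = "pullback (frame (vector [0,1,0,0]) (vector [1,0,0,0]) (vector [0,0,0,1]) (vector [0,0,1,0])) L"
      assume ad: "elliptic_subalgebra ?K"
      have "M 0 0 0 0 0 1 0 0 0 0 \<in> ?K" "M d0 0 0 0 g0 f0 e0 0 0 0 \<in> ?K"
        using coords_mem[OF s L N] coords_mem[OF s L Y0(1)] unfolding c a0 by simp_all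
      moreover have "?K \<subseteq> {X. \<exists>a e f g. X = M a 0 0 0 e f g 0 0 0}"
      proof (rule coords_subset[OF s L])
        fix X assume X: "X \<in> L"
        obtain a d e f g where M: "X = M a 0 0 d e f g 0 0 0" using form[OF X] by blast
        then have "a = 0" using 3 X by blast
        then show "coords (vector [0,1,0,0]) (vector [1,0,0,0]) (vector [0,0,0,1]) (vector [0,0,1,0]) X
          \<in> {X. \<exists>a e f g. X = M a 0 0 0 e f g 0 0 0}" unfolding M c by blast
      qed
      ultimately show "listed ?K" using onlyA[OF ad] Y0(2) by blast
    qed
  next
    case 4
    have "L \<subseteq> {M a 0 0 d 0 f 0 0 i 0 | a d f i. True}"
    proof
      fix X assume X: "X \<in> L"
      obtain a d e f g where M: "X = M a 0 0 d e f g 0 0 0" using form[OF X] by blast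
      moreover have "a = 0" "d = 0" using 4 X M by blast+
      moreover from this have "e = 0" "g = 0" using indefinite_pencil[OF L N] X M by blast+
      ultimately show "X \<in> {M a 0 0 d 0 f 0 0 i 0 | a d f i. True}" by blast
    qed
    then show ?thesis by (rule listed_indefinite_diag[OF L])
  qed
next
  case False
  then obtain a b c d e f g h i j where Y: "M a b c d e f g h i j \<in> L" "i \<noteq> 0" by blast
  have hj: "h = 0" "j = 0" using indefinite_lower[OF L N Y(1)] by auto
  note cl = elliptic_subalgebra_closed[OF L]
  \<comment> \<open>This bracket is the grading element plus an upper block; adding a multiple of N
    clears its off-diagonal entry, the shear below clears the rest.\<close>
  have "(1/i) *\<^sub>R lie_bracket (M 0 0 0 0 0 1 0 0 0 0) (M a b c d e f g h i j) \<in> L"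
    by (intro cl N Y)
  then have "M 1 0 0 1 (-2*b/i) (-(a+d)/i) (-2*c/i) 0 0 0 \<in> L" using Y(2)
    by (simp add: hj diff_divide_distrib algebra_simps)
  from cl(2)[OF this cl(4)[OF N, of "(a+d)/i"]]
  have H: "M 1 0 0 1 (-2*b/i) 0 (-2*c/i) 0 0 0 \<in> L" by (simp add: add_divide_distrib diff_divide_distrib)
  show ?thesis
  proof (rule listed_frame[OF symplectic_basis_unipotent[of "b/i" 0 "c/i"] L])
    let ?K = "pullback (frame (vector [1,0,0,0]) (vector [0,1,0,0]) (vector [b/i,0,1,0]) (vector [0,c/i,0,1])) L"
    assume ad: "elliptic_subalgebra ?K"
    have "M 0 0 0 0 0 1 0 0 0 0 \<in> ?K" "M 1 0 0 1 0 0 0 0 0 0 \<in> ?K"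
      using coords_mem[OF symplectic_basis_unipotent[of "b/i" 0 "c/i"] L N]
        coords_mem[OF symplectic_basis_unipotent[of "b/i" 0 "c/i"] L H]
      unfolding coords_unipotent by simp_all
    then show "listed ?K" using indefinite_graded[OF ad] listed_indefinite_diag[OF ad] by blast
  qed
qed

subsection \<open>Definite square-zero elements\<close>

context
  fixes L assumes L: "elliptic_subalgebra L" and N: "M 0 0 0 0 1 0 1 0 0 0 \<in> L"
begin

text \<open>Subtracting from the block its larger eigenvalue times the identity leaves a negative
  semidefinite form of rank at most one, namely \<open>quad v v\<close>. Ellipticity gives v = 0, so
  the two eigenvalues agree; \<open>\<rho>\<close> is half their difference.\<close>

lemma definite_pencil: "M 0 0 0 0 x y z 0 0 0 \<in> L \<Longrightarrow> y = 0 \<and> x = z"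
proof -
  assume Y: "M 0 0 0 0 x y z 0 0 0 \<in> L"
  define u where "u = (x - z) / 2"
  define \<rho> where "\<rho> = sqrt (u\<^sup>2 + y\<^sup>2)"
  have \<rho>: "\<rho>\<^sup>2 = u\<^sup>2 + y\<^sup>2" by (simp add: \<rho>_def)
  have "\<bar>u\<bar> \<le> \<rho>" unfolding \<rho>_def
    by (metis real_sqrt_abs real_sqrt_le_iff le_add_same_cancel1 zero_le_power2)
  then have ge: "\<rho> - u \<ge> 0" "\<rho> + u \<ge> 0" by auto
  define s where "s = (if y > 0 then -1 else 1 :: real)"
  define A where "A = sqrt ((\<rho> - u)/2)"
  define B where "B = sqrt ((\<rho> + u)/2)"
  have AB: "A * A = (\<rho> - u)/2" "B * B = (\<rho> + u)/2" using ge by (simp_all add: A_def B_def)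
  define v :: V where "v = vector [A, s * B, 0, 0]"
  have ss: "s * s = 1" by (simp add: s_def)
  have "A * B = sqrt ((\<rho>\<^sup>2 - u\<^sup>2)/4)"
    by (simp add: A_def B_def real_sqrt_mult[symmetric] power2_eq_square algebra_simps)
  also have "\<dots> = \<bar>y\<bar> / 2" by (simp add: \<rho> real_sqrt_divide)
  finally have prod: "A * B = \<bar>y\<bar> / 2" .
  have sAB: "2 * (s * (A * B)) = - y" unfolding prod by (auto simp: s_def abs_if)
  have "quad v v = M 0 0 0 0 (- 2 * A * A) (- (s * B * A + A * (s * B))) (- 2 * (s * B) * (s * B)) 0 0 0"
    by (simp add: quad_M v_def M_eq_iff)
  also have "- 2 * A * A = - (\<rho> - u)" using AB by simp
  also have "- (s * B * A + A * (s * B)) = y" using sAB by algebra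
  also have "- 2 * (s * B) * (s * B) = - (\<rho> + u)"
  proof -
    have "- 2 * (s * B) * (s * B) = - 2 * (s * s) * (B * B)" by (simp only: mult_ac)
    then show ?thesis using AB ss by simp
  qed
  also have "M 0 0 0 0 (- (\<rho> - u)) y (- (\<rho> + u)) 0 0 0
    = M 0 0 0 0 x y z 0 0 0 - (\<rho> + (x + z)/2) *\<^sub>R M 0 0 0 0 1 0 1 0 0 0"
    by (simp add: u_def M_eq_iff field_simps)
  finally have "1 *\<^sub>R quad v v \<in> L"
    using elliptic_subalgebra_closed(3)[OF L Y elliptic_subalgebra_closed(4)[OF L N]] by simp
  then have "v = 0" using elliptic_subalgebra_square[OF L] by (metis zero_neq_one)
  then have "v$1 = 0" "v$2 = 0" by simp_all
  then have "\<rho> = u" "\<rho> = - u" using ss AB by (auto simp: v_def)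
  then have "u = 0" "\<rho> = 0" by auto
  then show ?thesis using \<rho> by (simp add: u_def)
qed

lemma definite_lower: "M a b c d e f g h i j \<in> L \<Longrightarrow> i = 0 \<and> h = j"
  using definite_pencil[of "-2*h" "-2*i"
    "-2*j"] elliptic_subalgebra_closed(5)[OF L N] elliptic_subalgebra_closed(5)[OF L N elliptic_subalgebra_closed(5)[OF L N]]
  by fastforce

lemma definite_stab: "M a b c d e f g 0 0 0 \<in> L \<Longrightarrow> b = - c \<and> a = d"
  using definite_pencil[of "-2*a" "-(b+c)" "-2*d"] elliptic_subalgebra_closed(5)[OF L N, of "M a b c d e f g 0 0 0"]
  by (simp add: algebra_simps)

lemma definite_graded:
  assumes H: "M 1 0 0 1 0 0 0 0 0 0 \<in> L"
  shows "L \<subseteq> u11_std"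
proof
  fix Y assume Y: "Y \<in> L"
  then obtain a b c d e f g h i j where M: "Y = M a b c d e f g h i j" by (rule elliptic_subalgebra_cases[OF L])
  have hj: "i = 0" "h = j" using definite_lower Y M by auto
  note cl = elliptic_subalgebra_closed[OF L]
  let ?Z = "lie_bracket (M 1 0 0 1 0 0 0 0 0 0) Y"
  have Z: "?Z \<in> L" "lie_bracket (M 1 0 0 1 0 0 0 0 0 0) ?Z \<in> L" by (intro cl H Y)+
  have "lie_bracket (M 1 0 0 1 0 0 0 0 0 0) ?Z + 2 *\<^sub>R ?Z \<in> L"
    "lie_bracket (M 1 0 0 1 0 0 0 0 0 0) ?Z - 2 *\<^sub>R ?Z \<in> L" by (intro cl Z)+
  then have 1: "M 0 0 0 0 (8*e) (8*f) (8*g) 0 0 0 \<in> L" "M 0 0 0 0 0 0 0 (8*j) 0 (8*j) \<in> L"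
    by (simp_all add: M hj)
  then have 2: "f = 0" "e = g" using definite_pencil[OF 1(1)] by simp_all
  have "Y - (1/8) *\<^sub>R M 0 0 0 0 (8*e) (8*f) (8*g) 0 0 0 - (1/8) *\<^sub>R M 0 0 0 0 0 0 0 (8*j) 0 (8*j) \<in> L"
    by (intro cl 1 Y)
  then have "b = - c \<and> a = d" using definite_stab[of a b c d 0 0 0] by (simp add: M hj)
  then have "Y = M a (- c) c a g 0 g j 0 j" using M hj 2 by simp
  then show "Y \<in> u11_std" unfolding u11_std_def by blast
qed

end

text \<open>Parallel to the indefinite case. Stabilising the Euclidean form makes the action on P a
  complex number a + ir, and the trace-free part (e-g)/2 + if of the upper block takes the place of
  the pair (e, g).\<close>

lemma listed_definite:
  assumes L: "elliptic_subalgebra L" and N: "M 0 0 0 0 1 0 1 0 0 0 \<in> L"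
  shows "listed L"
proof (cases "\<forall>a b c d e f g h i j. M a b c d e f g h i j \<in> L \<longrightarrow> h = 0")
  case True
  note cl = elliptic_subalgebra_closed[OF L]
  have form: "\<exists>a r e f g. X = M a (- r) r a e f g 0 0 0" if X: "X \<in> L" for X
  proof -
    obtain a b c d e f g h i j where M: "X = M a b c d e f g h i j" using X by (rule elliptic_subalgebra_cases[OF L])
    have "i = 0" "h = j" "h = 0" using definite_lower[OF L N] True X M by metis+
    moreover from this have "b = - c" "a = d" using definite_stab[OF L N] X M by metis+
    ultimately show ?thesis using M by blast
  qed
  have br: "a * (e' - g') - 2 * r * f' = a' * (e - g) - 2 * r' * f \<and> r * (e' - g') + 2 * a * f'
    = r' * (e - g) + 2 * a' * f"
    if "M a (- r) r a e f g 0 0 0 \<in> L" "M a' (- r') r' a' e' f' g' 0 0 0 \<in> L" for a r e f g a' r' e' f' g'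
    using cl(5)[OF that] definite_pencil[OF L N, of "2*a*e'-2*r*f' - (2*a'*e - 2*r'*f)"
      "r*e'+2*a*f' - r*g' - (r'*e+2*a'*f-r'*g)"
       "2*r*f' + 2*a*g' - (2*r'*f + 2*a'*g)"]
    by (simp add: algebra_simps)
  show ?thesis
  proof (cases "\<exists>a r e f g. M a (- r) r a e f g 0 0 0 \<in> L \<and> (a \<noteq> 0 \<or> r \<noteq> 0)")
    case True
    then obtain a0 r0 e0 f0 g0 where Y0: "M a0 (- r0) r0 a0 e0 f0 g0 0 0 0 \<in> L"
      "a0 \<noteq> 0 \<or> r0 \<noteq> 0" by blast
    define n where "n = a0*a0 + r0*r0"
    have n: "n > 0" using Y0(2) by (auto simp: n_def sum_squares_gt_zero_iff)
    \<comment> \<open>Writing z for (e0-g0)/2 + i f0, the shear x + iy must solve z + 2(a0 + i r0)(x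
      + iy) = 0; \<open>n\<close> is the squared modulus of a0 + i r0. By \<open>br\<close> the same
      shear straightens every other element.\<close>
    define x where "x = - (a0*(e0 - g0)/2 + r0*f0) / (2*n)"
    define y where "y = - (a0*f0 - r0*(e0 - g0)/2) / (2*n)"
    show ?thesis
    proof (rule listed_coordsI[OF symplectic_basis_unipotent[of x y "- x"] L listed_u11])
      fix X assume X: "X \<in> L"
      obtain a r e f g where M: "X = M a (- r) r a e f g 0 0 0" using form[OF X] by blast
      have B: "a0 * (e - g) - 2 * r0 * f = a * (e0 - g0) - 2 * r * f0"
        "r0 * (e - g) + 2 * a0 * f = r * (e0 - g0) + 2 * a * f0" using br[OF Y0(1)] X M by auto
      have x: "2*n*x = - (a0*(e0 - g0)/2 + r0*f0)" and y: "2*n*y = - (a0*f0 - r0*(e0 - g0)/2)"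
        using n by (simp_all add: x_def y_def)
      have "n * ((e - g)/2 + 2*a*x - 2*r*y) = 0"
        unfolding n_def distrib_left right_diff_distrib using B x y unfolding n_def by algebra
      moreover have "n * (f + 2*a*y + 2*r*x) = 0"
        using B x y unfolding n_def by algebra
      ultimately have z: "(e - g)/2 + 2*a*x - 2*r*y = 0" "f + 2*a*y + 2*r*x = 0" using n by auto
      have "coords (vector [1,0,0,0]) (vector [0,1,0,0]) (vector [x,y,1,0]) (vector [y,-x,0,1]) X
        = M a (- r) r a ((e+g)/2) 0 ((e+g)/2) 0 0 0"
        unfolding M coords_unipotent using z by (simp add: M_eq_iff field_simps)
      then show "coords (vector [1,0,0,0]) (vector [0,1,0,0]) (vector [x,y,1,0]) (vector [y,-x,0,1]) X \<in> u11_std"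
        unfolding u11_std_def by blast
    qed
  next
    case False
    have "L \<subseteq> u11_std"
    proof
      fix X assume X: "X \<in> L"
      obtain a r e f g where M: "X = M a (- r) r a e f g 0 0 0" using form[OF X] by blast
      have 0: "a = 0" "r = 0" using False X M by blast+
      then have "f = 0" "e = g" using definite_pencil[OF L N] X M by auto
      then have "X = M 0 (- 0) 0 0 g 0 g 0 0 0" using M 0 by simp
      then show "X \<in> u11_std" unfolding u11_std_def by blast
    qed
    then show ?thesis by (rule listed_u11)
  qed
next
  case False
  then obtain a b c d e f g h i j where Y: "M a b c d e f g h i j \<in> L" "h \<noteq> 0" by blast
  have hj: "i = 0" "j = h" using definite_lower[OF L N Y(1)] by auto
  note cl = elliptic_subalgebra_closed[OF L]
  have "(1/h) *\<^sub>R lie_bracket (M 0 0 0 0 1 0 1 0 0 0) (M a b c d e f g h i j) \<in> L"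
    by (intro cl N Y)
  then have H: "M 1 0 0 1 (-2*a/h) (-(b+c)/h) (-2*d/h) 0 0 0 \<in> L"
    using Y(2) by (simp add: hj diff_divide_distrib algebra_simps)
  have bc: "(b + c)/h + (- b - c)/h = 0" by (simp add: add_divide_distrib diff_divide_distrib)
  show ?thesis
  proof (rule listed_frame[OF symplectic_basis_unipotent[of "a/h" "(b+c)/(2*h)" "d/h"] L])
    let ?K = "pullback (frame (vector [1,0,0,0]) (vector [0,1,0,0]) (vector [a/h,(b+c)/(2*h),1,0]) (vector [(b+c)/(2*h),d/h,0,1])) L"
    assume ad: "elliptic_subalgebra ?K"
    have "M 0 0 0 0 1 0 1 0 0 0 \<in> ?K" "M 1 0 0 1 0 0 0 0 0 0 \<in> ?K"
      using coords_mem[OF symplectic_basis_unipotent[of "a/h" "(b+c)/(2*h)" "d/h"] L N]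
        coords_mem[OF symplectic_basis_unipotent[of "a/h" "(b+c)/(2*h)" "d/h"] L H]
      unfolding coords_unipotent using bc by (simp_all add: field_simps)
    then show "listed ?K" using definite_graded[OF ad] listed_u11 by blast
  qed
qed

text \<open>A degenerate form would be of real rank one, so both coefficients are nonzero, and the
  signature decides between the definite and the indefinite normal form.\<close>

lemma listed_square_zero:
  assumes L: "elliptic_subalgebra L" and N: "M 0 0 0 0 e 0 g 0 0 0 \<in> L" and nz: "e \<noteq> 0 \<or> g \<noteq> 0"
  shows "listed L"
proof -
  have "e \<noteq> 0" "g \<noteq> 0"
    using elliptic_subalgebra_square[OF L, of "- e/2" p1] elliptic_subalgebra_square[OF L, of
      "- g/2" p2] N nz axis_nonzero
    by (auto simp: quad_basis)
  have pos: "listed L" if "M 0 0 0 0 e 0 g 0 0 0 \<in> L" "e > 0" "g > 0" for e g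
  proof -
    have s: "symplectic_basis (vector [sqrt e,0,0,0]) (vector [0,sqrt g,0,0]) (vector [0,0,1/sqrt e,0]) (vector [0,0,0,1/sqrt g])"
      using that by (simp add: symplectic_basis_def Omega_def)
    show ?thesis
    proof (rule listed_frame[OF s L])
      assume "elliptic_subalgebra (pullback (frame (vector [sqrt e,0,0,0]) (vector [0,sqrt g,0,0]) (vector [0,0,1/sqrt e,0]) (vector [0,0,0,1/sqrt g])) L)"
      then show "listed (pullback (frame (vector [sqrt e,0,0,0]) (vector [0,sqrt g,0,0]) (vector [0,0,1/sqrt e,0]) (vector [0,0,0,1/sqrt g])) L)"
        by (rule listed_definite) (use
          coords_mem[OF s L that(1)] that in \<open>simp add: coords_def Omega_def\<close>)
    qed
  qed
  have mixed: "listed L" if "M 0 0 0 0 e 0 g 0 0 0 \<in> L" "e > 0" "g < 0" for e g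
  proof -
    \<comment> \<open>The difference of squares is factored: the new p-vectors are the sum and the
      difference of t p1 and s p2.\<close>
    define t s where "t = sqrt e" and "s = sqrt (- g)"
    have ts: "t > 0" "s > 0" "e = t * t" "g = - (s * s)" using that by (simp_all add: t_def s_def)
    have s: "symplectic_basis (vector [t,s,0,0]) (vector [t,-s,0,0]) (vector [0,0,1/(2*t),1/(2 * s)]) (vector [0,0,1/(2*t),-1/(2 * s)])"
      using ts by (simp add: symplectic_basis_def Omega_def field_simps)
    show ?thesis
    proof (rule listed_frame[OF s L])
      assume ad: "elliptic_subalgebra (pullback (frame (vector [t,s,0,0]) (vector [t,-s,0,0]) (vector [0,0,1/(2*t),1/(2 * s)]) (vector [0,0,1/(2*t),-1/(2 * s)])) L)"
      have "2 *\<^sub>R coords (vector [t,s,0,0]) (vector [t,-s,0,0]) (vector [0,0,1/(2*t),1/(2 * s)]) (vector [0,0,1/(2*t),-1/(2 * s)])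
        (M 0 0 0 0 e 0 g 0 0 0) = M 0 0 0 0 0 1 0 0 0 0"
        using ts by (simp add: coords_def Omega_def M_eq_iff)
      then show "listed (pullback (frame (vector [t,s,0,0]) (vector [t,-s,0,0]) (vector [0,0,1/(2*t),1/(2 * s)]) (vector [0,0,1/(2*t),-1/(2 * s)])) L)"
        using listed_indefinite[OF ad] elliptic_subalgebra_closed(4)[OF ad coords_mem[OF s L that(1)], of 2] by simp
    qed
  qed
  have m: "M 0 0 0 0 (- e) 0 (- g) 0 0 0 \<in> L" using elliptic_subalgebra_closed(4)[OF L N, of "-1"] by simp
  consider "e > 0" "g > 0" | "e > 0" "g < 0" | "e < 0" "g > 0" | "e < 0" "g < 0"
    using \<open>e \<noteq> 0\<close> \<open>g \<noteq> 0\<close> by linarith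
  then show ?thesis
    by cases (use pos[OF N] mixed[OF N] pos[OF m] mixed[OF m] in auto)
qed

subsection \<open>Principal nilpotent elements\<close>

context
  fixes L assumes L: "elliptic_subalgebra L" and E: "M 0 0 0 0 0 1 0 0 0 6 \<in> L"
begin

lemma ad_E: "lie_bracket (M 0 0 0 0 0 1 0 0 0 6) (M a b c d e f g h i j)
   = M i (j - 6*f) h (i - 6*g) (-2*b) (-a-d) (-2*c) 0 (6*c) (12*d)"
  by (simp add: M_eq_iff)

text \<open>p1^2 is of rank one and is the highest weight vector of the seven-dimensional summand in
  the next lemma.\<close>

lemma long_root: "M 0 0 0 0 e 0 0 0 0 0 \<in> L \<Longrightarrow> e = 0"
  using elliptic_subalgebra_square[OF L, of "- e/2" p1] axis_nonzero by (simp add: quad_basis)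

text \<open>Under the principal sl2 containing E, sp(V) is the sum of irreducibles of dimensions 3
  and 7. A power of ad E pushes the part of Y of weight -6, -4, -2, 0 or 2 to the highest vector
  p1^2 of the larger summand, which is excluded. The linear relations left are those of the smaller
  summand.\<close>

lemma principal_form:
  assumes Y: "M a b c d e f g h i j \<in> L"
  shows "h = 0" "c = 0" "i = 9/2 * g" "a = - 3 * d" "j = 6 * f" "M (9/2*g) 0 0 (- 3/2*g) (-2*b) 0 0 0 0 0 \<in> L"
proof -
  note cl = elliptic_subalgebra_closed[OF L]
  note D = cl(5)[OF E, unfolded ad_E]
  note D1 = cl(5)[OF E Y, unfolded ad_E]
  note D2 = cl(5)[OF E D1, unfolded ad_E]
  note D3 = cl(5)[OF E D2, unfolded ad_E]
  note D4 = cl(5)[OF E D3, unfolded ad_E]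
  note D5 = cl(5)[OF E D4, unfolded ad_E]
  note D6 = cl(5)[OF E D5, unfolded ad_E]
  show h: "h = 0" using D6 long_root[of "-720*h"] by (simp add: algebra_simps)
  show c: "c = 0" using D5 long_root[of "-720*c"] by (simp add: h algebra_simps)
  show i: "i = 9/2 * g" using D4 long_root[of "216*g - 48*i"] by (simp add: h c algebra_simps)
  show a: "a = - 3 * d" using D3 long_root[of "-12*a - 36*d"] by (simp add: h c i algebra_simps)
  show j: "j = 6 * f" using cl(2)[OF D2 cl(4)[OF E, of "3*g"]] long_root[of "-2*(j-6*f)"]
    by (simp add: h c i a algebra_simps)
  show "M (9/2*g) 0 0 (- 3/2*g) (-2*b) 0 0 0 0 0 \<in> L"
    using cl(3)[OF D1 cl(4)[OF E, of "2*d"]] by (simp add: h c i a j algebra_simps)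
qed

lemma principal_graded:
  assumes H: "M 3 0 0 (-1) 0 0 0 0 0 0 \<in> L"
  shows "L \<subseteq> sl24_std"
proof
  fix Y assume Y: "Y \<in> L"
  then obtain a b c d e f g h i j where M: "Y = M a b c d e f g h i j" by (rule elliptic_subalgebra_cases[OF L])
  note pf = principal_form[OF Y[unfolded M]]
  note cl = elliptic_subalgebra_closed[OF L]
  let ?H = "M 3 0 0 (-1) 0 0 0 0 0 0"
  let ?Z = "lie_bracket ?H Y"
  let ?W = "lie_bracket ?H ?Z + 2 *\<^sub>R ?Z"
  \<comment> \<open>ad H (ad H + 2)(ad H - 2) annihilates the weights 0, 2 and -2 and multiplies the
    weights 4 and 6 by 48 and 192; \<open>principal_form\<close> excludes weights -4 and -6.\<close>
  have "lie_bracket ?H ?W - 2 *\<^sub>R ?W \<in> L" by (intro cl H Y)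
  then have 1: "M 0 (48*b) 0 0 (192*e) 0 0 0 0 0 \<in> L"
    by (simp add: M pf(1-5) algebra_simps)
  then have "b = 0" using principal_form(6)[OF 1] long_root[of "-96*b"] by simp
  then have "e = 0" using 1 long_root[of "192*e"] by simp
  have "Y = M (3*(-d)) 0 0 (- (-d)) 0 f (2*(g/2)) 0 (9*(g/2)) (6*f)"
    using \<open>b = 0\<close> \<open>e = 0\<close> by (simp add: M pf(1-5))
  then show "Y \<in> sl24_std" unfolding sl24_std_def by blast
qed

end

text \<open>A nonzero component \<open>g\<close> of weight -2 produces the grading element up to
  p1^2, which a shear removes. Without it L lies in the span of the grading element, E and p1^2; the
  coefficient of p1^2 is then proportional to \<open>d\<close> and is again sheared away.\<close>

lemma listed_principal:
  assumes L: "elliptic_subalgebra L" and E: "M 0 0 0 0 0 1 0 0 0 6 \<in> L"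
  shows "listed L"
proof (cases "\<forall>a b c d e f g h i j. M a b c d e f g h i j \<in> L \<longrightarrow> g = 0")
  case True
  note cl = elliptic_subalgebra_closed[OF L]
  have form: "\<exists>d e f. X = M (-3*d) 0 0 d e f 0 0 0 (6*f) \<and> M (-3*d) 0 0 d e 0 0 0 0 0 \<in> L" if X:
    "X \<in> L" for X
  proof -
    obtain a b c d e f g h i j where M: "X = M a b c d e f g h i j" using X by (rule elliptic_subalgebra_cases[OF L])
    have g: "g = 0" using X M True by blast
    note pf = principal_form[OF L E X[unfolded M]]
    have "b = 0" using pf(6) long_root[OF L E, of "-2*b"] g by simp
    then have 1: "X = M (-3*d) 0 0 d e f 0 0 0 (6*f)" by (simp add: M pf(1-5) g)
    moreover have "M (-3*d) 0 0 d e 0 0 0 0 0 \<in> L"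
      using cl(3)[OF X cl(4)[OF E, of f]] unfolding 1 by (simp add: mult.commute)
    ultimately show ?thesis by blast
  qed
  show ?thesis
  proof (cases "\<exists>d e. M (-3*d) 0 0 d e 0 0 0 0 0 \<in> L \<and> d \<noteq> 0")
    case True
    then obtain d0 e0 where Y0: "M (-3*d0) 0 0 d0 e0 0 0 0 0 0 \<in> L" "d0 \<noteq> 0" by blast
    define x where "x = e0 / (6 * d0)"
    show ?thesis
    proof (rule listed_coordsI[OF symplectic_basis_unipotent[of x 0 0] L listed_sl24])
      fix X assume X: "X \<in> L"
      then obtain d e f where M: "X = M (-3*d) 0 0 d e f 0 0 0 (6*f)" "M (-3*d) 0 0 d e 0 0 0 0 0 \<in> L"
        using form by blast
      have "M (-3*d) 0 0 d e 0 0 0 0 0 - (d/d0) *\<^sub>R M (-3*d0) 0 0 d0 e0 0 0 0 0 0 \<in> L"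
        by (intro cl M(2) Y0)
      then have "e - (d/d0) * e0 = 0" using long_root[OF L E, of "e - (d/d0) * e0"] Y0(2) by simp
      then have e: "e - 6 * d * x = 0" using Y0(2) by (simp add: x_def field_simps)
      have "coords (vector [1,0,0,0]) (vector [0,1,0,0]) (vector [x,0,1,0]) (vector [0,0,0,1]) X
        = M (3*(-d)) 0 0 (- (-d)) 0 f (2*0) 0 (9*0) (6*f)"
        using e by (simp add: M(1) coords_def Omega_def M_eq_iff)
      then show "coords (vector [1,0,0,0]) (vector [0,1,0,0]) (vector [x,0,1,0]) (vector [0,0,0,1]) X \<in> sl24_std"
        unfolding sl24_std_def by blast
    qed
  next
    case False
    have "L \<subseteq> sl24_std"
    proof
      fix X assume X: "X \<in> L"
      then obtain d e f where M: "X = M (-3*d) 0 0 d e f 0 0 0 (6*f)" "M (-3*d) 0 0 d e 0 0 0 0 0 \<in> L"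
        using form by blast
      have "d = 0" using M False by blast
      then have "e = 0" using M(2) long_root[OF L E] by simp
      then have "X = M (3*0) 0 0 (- 0) 0 f (2*0) 0 (9*0) (6*f)" using M \<open>d = 0\<close> by simp
      then show "X \<in> sl24_std" unfolding sl24_std_def by blast
    qed
    then show ?thesis by (rule listed_sl24)
  qed
next
  case False
  then obtain a b c d e f g h i j where Y: "M a b c d e f g h i j \<in> L" "g \<noteq> 0" by blast
  note cl = elliptic_subalgebra_closed[OF L]
  have H: "M 3 0 0 (-1) (- (4*b/(3*g))) 0 0 0 0 0 \<in> L"
    using cl(4)[OF principal_form(6)[OF L E Y(1)], of "2/(3*g)"] Y(2) by simp
  let ?x = "2*b/(9*g)"
  show ?thesis
  proof (rule listed_frame[OF symplectic_basis_unipotent[of ?x 0 0] L])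
    let ?K = "pullback (frame (vector [1,0,0,0]) (vector [0,1,0,0]) (vector [?x,0,1,0]) (vector [0,0,0,1])) L"
    assume ad: "elliptic_subalgebra ?K"
    have "M 0 0 0 0 0 1 0 0 0 6 \<in> ?K" "M 3 0 0 (-1) 0 0 0 0 0 0 \<in> ?K"
      using coords_mem[OF symplectic_basis_unipotent[of ?x 0 0] L E]
        coords_mem[OF symplectic_basis_unipotent[of ?x 0 0] L H]
      by (simp_all add: coords_def Omega_def)
    then show "listed ?K" using principal_graded[OF ad] listed_sl24 by blast
  qed
qed

subsection \<open>Normal forms of nilpotent elements\<close>

lemma spV_Omega: "X \<in> spV \<Longrightarrow> Omega (X *v u) v = - Omega u (X *v v)"
  by (simp add: spV_alt)

text \<open>Omega(u, Xv) is symmetric in u and v, so X is recovered from its quadratic form by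
  polarisation.\<close>

lemma Omega_sym_form:
  assumes X: "X \<in> spV" and nz: "X \<noteq> 0"
  shows "\<exists>v. Omega v (X *v v) \<noteq> 0"
proof (rule ccontr)
  assume "\<not> ?thesis"
  then have z: "Omega v (X *v v) = 0" for v by blast
  have "Omega (X *v v) u = 0" for u v
  proof -
    have "Omega (u + v) (X *v (u + v)) = 0" by (rule z)
    then have "Omega u (X *v v) + Omega v (X *v u) = 0"
      by (simp add: matrix_vector_right_distrib Omega_linear z)
    moreover have "Omega v (X *v u) = Omega u (X *v v)"
      using spV_Omega[OF X, of v u] Omega_commute[of u "X *v v"] by simp
    ultimately show ?thesis using spV_Omega[OF X, of v u] by simp
  qed
  then have "X *v v = 0" for v using Omega_nondegenerate by blast
  then have "X = 0" by (simp add: matrix_eq)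
  then show False using nz by simp
qed

text \<open>\<open>pr\<close> projects onto the Omega-complement of the hyperbolic plane of
  \<open>P\<close> and \<open>Q\<close>; it is nonzero because V has dimension 4.\<close>

lemma symplectic_basis_complete:
  assumes PQ: "Omega Q P = 1"
  shows "\<exists>P2 Q2. symplectic_basis P P2 Q Q2"
proof -
  have PQ': "Omega P Q = -1" using PQ Omega_commute[of P Q] by simp
  define pr where "pr w = w - Omega Q w *\<^sub>R P + Omega P w *\<^sub>R Q" for w
  have perp: "Omega P (pr w) = 0" "Omega Q (pr w) = 0" "Omega (pr w) P = 0" "Omega (pr w) Q = 0" for w
    using Omega_commute[of "pr w" P] Omega_commute[of "pr w" Q] PQ PQ' by (simp_all add: pr_def Omega_linear)
  have "\<exists>w. pr w \<noteq> 0"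
  proof (rule ccontr)
    assume "\<not> ?thesis"
    then have pr0: "pr w = 0" for w by blast
    have "w = pr w + (Omega Q w *\<^sub>R P + (- Omega P w) *\<^sub>R Q)" for w by (simp add: pr_def)
    then have "w = Omega Q w *\<^sub>R P + (- Omega P w) *\<^sub>R Q" for w unfolding pr0 by simp
    then have "w \<in> span {P, Q}" for w
      by (metis span_add span_scale span_base insertI1 insertI2)
    then have "span {P, Q} = UNIV" by blast
    then have "dim (UNIV :: V set) \<le> card {P, Q}" by (metis dim_le_card finite.emptyI finite.insertI order_refl)
    moreover have "card {P, Q} \<le> 2" by (simp add: card_insert_if)
    ultimately show False by simp
  qed
  then obtain w where w: "pr w \<noteq> 0" by blast
  then obtain z where z: "Omega z (pr w) \<noteq> 0"
    using Omega_nondegenerate[of "pr w"] Omega_commute by (metis neg_equal_0_iff_equal)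
  define k where "k = Omega z (pr w)"
  have "Omega (pr z) (pr w) = k" using perp by (simp add: pr_def[of z] Omega_linear k_def)
  then have "symplectic_basis P (pr w) Q ((1/k) *\<^sub>R pr z)"
    using z PQ perp by (simp add: symplectic_basis_def Omega_linear k_def)
  then show ?thesis by blast
qed

definition sp_similar :: "glV \<Rightarrow> glV \<Rightarrow> bool" where
  "sp_similar X Y \<longleftrightarrow> (\<exists>S\<in>SpV. X ** S = S ** Y)"

lemma sp_similar_trans:
  assumes "sp_similar X Y" "sp_similar Y Z"
  shows "sp_similar X Z"
proof -
  obtain S T where ST: "S \<in> SpV" "T \<in> SpV" "X ** S = S ** Y" "Y ** T = T ** Z"
    using assms by (auto simp: sp_similar_def)
  have "X ** (S ** T) = S ** (Y ** T)" by (simp add: matrix_mul_assoc ST(3))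
  then have "X ** (S ** T) = (S ** T) ** Z" by (simp add: ST(4) matrix_mul_assoc)
  then show ?thesis using SpV_mult ST(1,2) by (auto simp: sp_similar_def)
qed

lemma sp_similar_conj:
  assumes "sp_similar X Y"
  obtains S where "S \<in> SpV" "X = S ** Y ** matrix_inv S"
  using assms SpV_cancel(3) unfolding sp_similar_def by metis

lemma sp_similar_trace_square:
  assumes "sp_similar X Y"
  shows "trace (X ** X) = trace (Y ** Y)"
  using assms by (rule sp_similar_conj) (simp add: conj_mult trace_conj)

lemma sp_similar_square_zero:
  assumes "sp_similar X Y" "X ** X = 0"
  shows "Y ** Y = 0"
  using assms(1) by (rule sp_similar_conj) (use assms(2) in \<open>simp add: conj_mult conj_eq_0_iff\<close>)

lemma sp_similar_coords: "symplectic_basis P1 P2 Q1 Q2 \<Longrightarrow> X \<in> spV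
  \<Longrightarrow> sp_similar X (coords P1 P2 Q1 Q2 X)"
  using frame_coords frame_in_SpV unfolding sp_similar_def by blast

text \<open>\<open>K\<close> is L in the new basis. The two extra properties are passed on
  conditionally, so that one lemma serves the stages of the proof where different properties of L
  are known.\<close>

lemma listed_sp_similar:
  assumes L: "elliptic_subalgebra L" "X \<in> L" and XY: "sp_similar X Y"
    and listed: "\<And>K. elliptic_subalgebra K \<Longrightarrow> (nilpotent_free L
      \<Longrightarrow> nilpotent_free K) \<Longrightarrow> (trace_negative L \<Longrightarrow> trace_negative K)
      \<Longrightarrow> Y \<in> K \<Longrightarrow> listed K"
  shows "listed L"
proof -
  obtain S where S: "S \<in> SpV" "X ** S = S ** Y" using XY by (auto simp: sp_similar_def)
  show ?thesis
    using listed_pullback[OF S(1)] listed[OF elliptic_subalgebra_pullback[OF S(1) L(1)]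
      nilpotent_free_pullback[OF S(1)] trace_negative_pullback[OF S(1)]]
      pullback_memI[OF S(1) L(2) S(2)] by blast
qed

section \<open>Splitting an element into two-dimensional blocks\<close>

text \<open>The plane of v and Xv is invariant, and nondegenerate because c is nonzero. Its
  Omega-complement is then invariant too.\<close>

lemma block_form:
  assumes Xs: "X \<in> spV" and c: "Omega v (X *v v) = c" "c \<noteq> 0" and m: "X *v (X *v v) = m *\<^sub>R v"
  shows "\<exists>d g j. sp_similar X (M 0 0 0 d c 0 g (m/c) 0 j)"
proof -
  define P where "P = (1/c) *\<^sub>R (X *v v)"
  have "Omega v P = 1" using c by (simp add: P_def Omega_linear)
  then obtain P2 Q2 where s: "symplectic_basis P P2 v Q2" using symplectic_basis_complete by blast
  have Xv: "X *v v = c *\<^sub>R P" using c by (simp add: P_def)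
  have XP: "X *v P = (m/c) *\<^sub>R v" by (simp add: P_def matrix_vector_mult_scaleR m)
  note ss = symplectic_basis_sym[OF s]
  have o: "Omega P (X *v u) = - (m/c) * Omega v u" "Omega v (X *v u) = - c * Omega P u" for u
    using spV_Omega[OF Xs, of P u] spV_Omega[OF Xs, of v u] by (simp_all add: Xv XP Omega_linear)
  have "coords P P2 v Q2 X = M 0 0 0 (Omega Q2 (X *v P2)) c 0 (Omega Q2 (X *v Q2)) (m/c) 0 (- Omega P2 (X *v P2))"
    by (simp add: coords_def XP Xv ss o Omega_linear)
  then show ?thesis using sp_similar_coords[OF s Xs] by metis
qed

lemma sp_similar_refl: "sp_similar X X"
  unfolding sp_similar_def using mat_1_in_SpV by (intro bexI[of _ "mat 1"]) simp_all

text \<open>A 2 by 2 block of trace zero is conjugate within the symplectic group of its plane to an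
  antidiagonal one with the same determinant. The final clause fixes the position of a nilpotent
  block.\<close>

lemma block_companion:
  "\<exists>g' j'. sp_similar (M a 0 0 d e 0 g h 0 j) (M a 0 0 0 e 0 g' h 0 j') \<and> g' * j' = d*d + g*j
    \<and> (g' = 0 \<longrightarrow> j' = 0)"
proof -
  \<comment> \<open>\<open>k\<close> is Omega(v, Xv) for v = x p2 + y q2, and (u, w) are the
    coordinates of Xv/k. The vectors q2, p2 and p2 + q2, tried at the end, suffice to make
    \<open>k\<close> nonzero for a nonzero block.\<close>
  have gen: ?thesis if k: "k = 2*x*y*d + y*y*g - x*x*j" "k \<noteq> 0" for x y k
  proof -
    define u w where "u = (d * x + g * y) / k" and "w = (j * x - d * y) / k"
    have u: "u * k = d * x + g * y" "w * k = j * x - d * y" using k(2) by (simp_all add: u_def w_def)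
    have "(y * u - x * w) * k = 1 * k" using u k(1) by algebra
    then have uw: "y * u - x * w = 1" using k(2) by simp
    have s: "symplectic_basis (vector [1,0,0,0]) (vector [0,u,0,w]) (vector [0,0,1,0]) (vector [0,x,0,y])"
      using uw by (simp add: symplectic_basis_def Omega_def algebra_simps)
    have "y*(d*u + g*w) - x*(j*u - d*w) = 0"
    proof -
      have "(y*(d*u + g*w) - x*(j*u - d*w)) * k = 0" using u k(1) by algebra
      then show ?thesis using k(2) by simp
    qed
    moreover have "y*(d*x + g*y) - x*(j*x - d*y) = k" using k(1) by algebra
    moreover have "w*(d*u+g*w) - u*(j*u - d*w) = - ((d*d+g*j)/k)"
    proof -
      define E where "E = w*(d*u+g*w) - u*(j*u - d*w)"
      have "(E * k + (d*d+g*j)) * k = 0" using u k(1) unfolding E_def by algebra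
      then have "E * k = - (d*d+g*j)" using k(2) by simp
      then have "E = - ((d*d+g*j)/k)" using k(2) by (metis nonzero_eq_divide_eq minus_divide_left)
      then show ?thesis unfolding E_def .
    qed
    ultimately have "coords (vector [1,0,0,0]) (vector [0,u,0,w]) (vector [0,0,1,0]) (vector [0,x,0,y]) (M a 0 0 d e 0 g h 0 j)
      = M a 0 0 0 e 0 k h 0 ((d*d+g*j)/k)"
      by (simp add: coords_def Omega_def M_eq_iff algebra_simps)
    then have "sp_similar (M a 0 0 d e 0 g h 0 j) (M a 0 0 0 e 0 k h 0 ((d*d+g*j)/k))"
      using sp_similar_coords[OF s M_in_spV] by metis
    moreover have "k * ((d*d+g*j)/k) = d*d+g*j" using k(2) by simp
    ultimately show ?thesis using k(2) by blast
  qed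
  show ?thesis
  proof (cases "g = 0 \<and> j = 0 \<and> d = 0")
    case True
    then show ?thesis using sp_similar_refl by (intro exI[of _ 0]) auto
  next
    case False
    then consider "g \<noteq> 0" | "j \<noteq> 0" | "g = 0" "j = 0" "d \<noteq> 0" by blast
    then show ?thesis by cases (use gen[of g 0 1] gen[of "-j" 1 0] gen[of "2*d" 1 1] in auto)
  qed
qed

lemma listed_nilpotent2:
  assumes L: "elliptic_subalgebra L" and X: "X \<in> L" "X \<noteq> 0" and X2: "X ** X = 0"
  shows "listed L"
proof -
  have Xs: "X \<in> spV" using L X by (auto simp: elliptic_subalgebra_def)
  obtain v where v: "Omega v (X *v v) \<noteq> 0" using Omega_sym_form[OF Xs X(2)] by blast
  have "X *v (X *v v) = 0 *\<^sub>R v" using X2 by (simp add: matrix_vector_mul_assoc)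
  then obtain c d g j where c: "c \<noteq> 0" and s1: "sp_similar X (M 0 0 0 d c 0 g (0/c) 0 j)"
    using block_form[OF Xs refl v] v by blast
  then obtain g' j' where s2: "sp_similar (M 0 0 0 d c 0 g 0 0 j) (M 0 0 0 0 c 0 g' 0 0 j')" "g' = 0
    \<longrightarrow> j' = 0"
    using block_companion by blast
  have s: "sp_similar X (M 0 0 0 0 c 0 g' 0 0 j')" using sp_similar_trans[OF s1] s2(1) by simp
  have "(M 0 0 0 0 c 0 g' 0 0 j' ** M 0 0 0 0 c 0 g' 0 0 j') $ 2 $ 2 = 0"
    using sp_similar_square_zero[OF s X2] by simp
  then have "g' * j' = 0" by (simp add: matrix_matrix_mult_def sum_4)
  then have "j' = 0" using s2(2) by auto
  then show ?thesis using listed_sp_similar[OF L X(1) s] listed_square_zero[of _ c g'] c by blast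
qed

lemma spV_square_selfadjoint:
  "X \<in> spV \<Longrightarrow> Omega (X *v (X *v u)) v = Omega u (X *v (X *v v))"
  using spV_Omega by simp

lemma Omega_square_alternating:
  assumes "X \<in> spV"
  shows "Omega u (X *v (X *v u)) = 0"
  using spV_Omega[OF assms, of u "X *v u"] by simp

text \<open>Jordan blocks of odd size occur in pairs in a symplectic space, so size 3 does not fit
  into dimension 4. Concretely, X^2 w and X^2 z span a Lagrangian plane that would contain Xw and is
  annihilated by X.\<close>

lemma spV_cube_zero:
  assumes X: "X \<in> spV" and X3: "X ** X ** X = 0"
  shows "X ** X = 0"
proof (rule ccontr)
  assume "X ** X \<noteq> 0"
  have XXX: "X *v (X *v (X *v u)) = 0" for u
    using X3 by (simp add: matrix_vector_mul_assoc matrix_mul_assoc)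
  obtain w0 where w0: "X *v (X *v w0) \<noteq> 0"
    using \<open>X ** X \<noteq> 0\<close> by (auto simp: matrix_eq matrix_vector_mul_assoc)
  obtain z0 where z0: "Omega z0 (X *v (X *v w0)) \<noteq> 0"
    using Omega_nondegenerate[of "X *v (X *v w0)"] w0 Omega_commute by (metis neg_equal_0_iff_equal)
  define k where "k = Omega z0 (X *v (X *v w0))"
  define z where "z = (1/k) *\<^sub>R z0"
  define w where "w = w0 - Omega z w0 *\<^sub>R (X *v (X *v w0))"
  have Kw: "X *v (X *v w) = X *v (X *v w0)"
    by (simp add: w_def matrix_vector_mult_diff_distrib matrix_vector_mult_scaleR XXX)
  have zk: "Omega z (X *v (X *v w0)) = 1" using z0 by (simp add: z_def Omega_linear k_def)
  have zw: "Omega z w = 0" by (simp add: w_def Omega_linear zk)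
  note sa = spV_square_selfadjoint[OF X]
  have "symplectic_basis (X *v (X *v w)) (X *v (X *v z)) z (- w)"
    using zk zw Omega_square_alternating[OF X, of w] Omega_square_alternating[OF X, of z]
      Omega_commute[of w "X *v (X *v z)"] Omega_commute[of "X *v (X *v w)" z]
    by (simp add: symplectic_basis_def sa Kw[symmetric] Omega_linear XXX)
  from symplectic_basis_expand[OF this, of "X *v w"]
  have "X *v w = Omega z (X *v w) *\<^sub>R (X *v (X *v w)) + Omega (- w) (X *v w) *\<^sub>R (X *v (X *v z))"
    by (simp add: sa XXX Omega_linear)
  then have "X *v (X *v w) = X *v (Omega z (X *v w) *\<^sub>R (X *v (X *v w)) + Omega (- w) (X *v w) *\<^sub>R (X *v (X *v z)))"
    by simp
  then have "X *v (X *v w) = 0"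
    by (simp add: matrix_vector_right_distrib matrix_vector_mult_scaleR XXX)
  then show False using Kw w0 by simp
qed

text \<open>A cyclic vector gives the principal normal form. Scaling by t multiplies Omega(v, X^3 v)
  by t^2, so its sign is adjusted by passing to -X instead.\<close>

lemma listed_nilpotent4:
  assumes L: "elliptic_subalgebra L" and X: "X \<in> L" and X4: "X ** X ** (X ** X) = 0"
    and X3: "X ** X ** X \<noteq> 0"
  shows "listed L"
proof -
  have Xs: "X \<in> spV" using L X by (auto simp: elliptic_subalgebra_def)
  have X3s: "X ** X ** X \<in> spV"
    by (simp add: spV_alt matrix_vector_mul_assoc[symmetric] spV_Omega[OF Xs])
  obtain v where v: "Omega v (X *v (X *v (X *v v))) \<noteq> 0"
    using Omega_sym_form[OF X3s X3] by (auto simp: matrix_vector_mul_assoc matrix_mul_assoc)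
  have pos: "listed L" if X: "X \<in> L" and X4: "X ** X ** (X ** X) = 0"
    and v: "Omega v (X *v (X *v (X *v v))) > 0" for X
  proof -
    have Xs: "X \<in> spV" using L X by (auto simp: elliptic_subalgebra_def)
    note o = spV_Omega[OF Xs]
    have XXXX: "X *v (X *v (X *v (X *v u))) = 0" for u
      using X4 by (simp add: matrix_vector_mul_assoc matrix_mul_assoc)
    define c where "c = Omega v (X *v (X *v (X *v v)))"
    have c: "c > 0" using v by (simp add: c_def)
    \<comment> \<open>Chosen to make Omega(u, Xu) vanish.\<close>
    define t where "t = - Omega v (X *v v) / (2 * c)"
    define u where "u = v + t *\<^sub>R (X *v (X *v v))"
    have Xu: "X *v u = X *v v + t *\<^sub>R (X *v (X *v (X *v v)))" "X *v (X *v u) = X *v (X *v v)"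
      "X *v (X *v (X *v u)) = X *v (X *v (X *v v))"
      by (simp_all add: u_def matrix_vector_right_distrib matrix_vector_mult_scaleR XXXX)
    have uu: "Omega u (X *v u) = 0" unfolding Xu
      using c by (simp add: u_def Omega_linear o XXXX c_def[symmetric] t_def)
    have u3: "Omega u (X *v (X *v (X *v u))) = c" unfolding Xu(3)
      by (simp add: u_def Omega_linear o XXXX c_def[symmetric])
    \<comment> \<open>The value 6 for Omega(w, X^3 w) matches the coefficient 6 in the principal
      element, which goes back to the factors 3 and 2 of the raising operator on cubics.\<close>
    define w where "w = sqrt (6/c) *\<^sub>R u"
    have ww: "Omega w (X *v w) = 0" "Omega w (X *v (X *v (X *v w))) = 6" "Omega w (X *v (X *v w)) = 0"
      using uu u3 c Omega_square_alternating[OF Xs, of u]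
      by (simp_all add: w_def matrix_vector_mult_scaleR Omega_linear real_sqrt_mult[symmetric] mult.assoc[symmetric])
    define P1 where "P1 = (1/6) *\<^sub>R (X *v (X *v (X *v w)))"
    define Q2 where "Q2 = (1/6) *\<^sub>R (X *v (X *v w))"
    have s: "symplectic_basis P1 (X *v w) w Q2"
      using ww by (simp add: symplectic_basis_def P1_def Q2_def Omega_linear o XXXX)
    have "coords P1 (X *v w) w Q2 X = M 0 0 0 0 0 1 0 0 0 6"
      using ww by (simp add: coords_def P1_def Q2_def Omega_linear matrix_vector_mult_scaleR o XXXX)
    then show ?thesis using listed_frame[OF s L] coords_mem[OF s L X] listed_principal by metis
  qed
  show ?thesis
  proof (cases "Omega v (X *v (X *v (X *v v))) > 0")
    case True
    then show ?thesis using pos[OF X X4] by blast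
  next
    case False
    then have "Omega v ((- X) *v ((- X) *v ((- X) *v v))) > 0"
      using v by (simp add: minus_vector_mult matrix_minus_vector_right Omega_linear)
    moreover have "(- X) ** (- X) ** ((- X) ** (- X)) = 0" using X4 by (simp add: matrix_distribs)
    ultimately show ?thesis using pos[of "- X"] elliptic_subalgebra_closed(6)[OF L X] by blast
  qed
qed

lemma listed_or_nilpotent_free:
  assumes L: "elliptic_subalgebra L"
  shows "listed L \<or> nilpotent_free L"
proof (rule ccontr)
  assume n: "\<not> ?thesis"
  then obtain X where X: "X \<in> L" "X ** X ** (X ** X) = 0" "X \<noteq> 0" by (auto simp: nilpotent_free_def)
  have Xs: "X \<in> spV" using L X by (auto simp: elliptic_subalgebra_def)
  show False
  proof (cases "X ** X ** X = 0")
    case True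
    then show False using spV_cube_zero[OF Xs] listed_nilpotent2[OF L X(1,3)] n by blast
  next
    case False
    then show False using listed_nilpotent4[OF L X(1,2)] n by blast
  qed
qed

section \<open>Subalgebras without nilpotent elements: hyperbolic elements\<close>

lemma nilpotent_freeD: "nilpotent_free L \<Longrightarrow> Y \<in> L \<Longrightarrow> Y ** Y = 0 \<Longrightarrow> Y = 0"
  unfolding nilpotent_free_def by (metis matrix_zero_right)

lemma nilpotent_free_M:
  assumes "nilpotent_free L"
  shows "M 0 0 0 0 e f g 0 0 0 \<in> L \<Longrightarrow> e = 0 \<and> f = 0 \<and> g = 0"
    and "M 0 0 0 0 0 0 0 h i j \<in> L \<Longrightarrow> h = 0 \<and> i = 0 \<and> j = 0"
    and "M 0 b 0 0 0 f 0 0 0 0 \<in> L \<Longrightarrow> b = 0 \<and> f = 0"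
    and "M 0 0 c 0 0 0 0 0 i 0 \<in> L \<Longrightarrow> c = 0 \<and> i = 0"
  using nilpotent_freeD[OF assms, of "M 0 0 0 0 e f g 0 0 0"] nilpotent_freeD[OF assms, of "M 0 0 0 0 0 0 0 h i j"]
    nilpotent_freeD[OF assms, of "M 0 b 0 0 0 f 0 0 0 0"] nilpotent_freeD[OF assms, of "M 0 0 c 0 0 0 0 0 i 0"]
  by (simp_all add: M_eq_0_iff vec_eq_iff forall_4 matrix_matrix_mult_def sum_4)

definition ad_shift :: "glV \<Rightarrow> real \<Rightarrow> glV \<Rightarrow> glV" where
  "ad_shift X l Y = lie_bracket X Y - l *\<^sub>R Y"

lemma trace_mult_comm: "trace ((A::real^'n^'n) ** B ** C) = trace (B ** C ** A)"
  using trace_mul_sym[of A "B ** C"] by (simp add: matrix_mul_assoc)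

lemma trace_mat_1: "trace (mat 1 :: glV) = 4"
  by (simp add: trace_def mat_def sum_4)

text \<open>An eigenvector of \<open>ad X\<close> for a nonzero eigenvalue has vanishing power traces, so it is nilpotent.\<close>
lemma nilpotent_free_eigen:
  assumes L: "elliptic_subalgebra L" "nilpotent_free L" and Z: "Z \<in> L" and e: "lie_bracket X Z = l *\<^sub>R Z"
    and l: "l \<noteq> 0"
  shows "Z = 0"
proof -
  have Zs: "Z \<in> spV" using L Z by (auto simp: elliptic_subalgebra_def)
  have XZ: "l *\<^sub>R Z = X ** Z - Z ** X" using e by (simp add: lie_bracket_def)
  have tr: "trace (Z ** W) = 0" if "Z ** W = W ** Z" for W
  proof -
    have "l * trace (Z ** W) = trace ((X ** Z - Z ** X) ** W)"
      by (simp add: XZ[symmetric] matrix_scaleR_left trace_scaleR)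
    also have "\<dots> = trace (X ** (Z ** W)) - trace (Z ** X ** W)"
      by (simp add: matrix_distribs trace_sub matrix_mul_assoc)
    also have "trace (Z ** X ** W) = trace (X ** (W ** Z))"
      by (rule trans[OF trace_mult_comm]) (simp add: matrix_mul_assoc)
    finally show ?thesis using l that by simp
  qed
  have t2: "trace (Z ** Z) = 0" by (rule tr) simp
  obtain r where r: "Z ** Z ** (Z ** Z) = (trace (Z ** Z) / 2) *\<^sub>R (Z ** Z) - r *\<^sub>R mat 1"
    using spV_Cayley_Hamilton[OF Zs] by blast
  have "trace (Z ** (Z ** (Z ** Z))) = 0" by (rule tr) (simp add: matrix_mul_assoc)
  then have "trace (Z ** Z ** (Z ** Z)) = 0" by (simp add: matrix_mul_assoc)
  then have "r = 0" unfolding r t2 trace_sub trace_scaleR trace_mat_1 by simp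
  then have "Z ** Z ** (Z ** Z) = 0" using r t2 by simp
  then show ?thesis using L Z by (simp add: nilpotent_free_def)
qed

lemma ad_shift_mem: "elliptic_subalgebra L \<Longrightarrow> X \<in> L \<Longrightarrow> Y \<in> L
  \<Longrightarrow> ad_shift X l Y \<in> L"
  unfolding ad_shift_def by (intro elliptic_subalgebra_closed)

lemma ad_shift_foldr_mem: "elliptic_subalgebra L \<Longrightarrow> X \<in> L \<Longrightarrow> Y \<in> L
  \<Longrightarrow> foldr (ad_shift X) ls Y \<in> L"
  by (induction ls) (auto intro: ad_shift_mem)

text \<open>By \<open>nilpotent_free_eigen\<close> every factor ad X - l with l nonzero is injective
  on L, so it can be cancelled from an annihilating product even if repeated.\<close>

lemma ad_shift_cancel:
  assumes "elliptic_subalgebra L" "nilpotent_free L" "X \<in> L" "Y \<in> L" "\<forall>l\<in>set ls. l \<noteq> 0"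
    "foldr (ad_shift X) ls Y = 0"
  shows "Y = 0"
  using assms(5,6)
proof (induction ls)
  case (Cons l ls)
  then have "lie_bracket X (foldr (ad_shift X) ls Y) = l *\<^sub>R foldr (ad_shift X) ls Y"
    using ad_shift_def[of X l "foldr (ad_shift X) ls Y"] by simp
  then have "foldr (ad_shift X) ls Y = 0"
    using nilpotent_free_eigen[OF assms(1,2) ad_shift_foldr_mem[OF assms(1,3,4)]] Cons.prems(1) by simp
  then show ?case using Cons by simp
qed simp

lemma ad_shift_diag:
  "ad_shift (M a 0 0 b 0 0 0 0 0 0) l (M a' b' c' d' e f g h i j) = M (- l*a') ((a-b-l)*b') ((b-a-l)*c') (- l*d')
    ((2*a-l)*e) ((a+b-l)*f) ((2*b-l)*g) ((- 2*a-l)*h) ((- a-b-l)*i) ((- 2*b-l)*j)"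
  by (simp add: ad_shift_def M_eq_iff algebra_simps)

lemma listed_real_diag:
  assumes L: "elliptic_subalgebra L" "nilpotent_free L" and X: "M a 0 0 b 0 0 0 0 0 0 \<in> L"
    and ab: "a \<noteq> 0" "b \<noteq> 0" "a*a \<noteq> b*b"
  shows "listed L"
proof -
  have ne: "a - b \<noteq> 0" "b - a \<noteq> 0" "a + b \<noteq> 0" "- a - b \<noteq> 0"
    using ab by (auto simp: eq_neg_iff_add_eq_0[symmetric] square_eq_iff)
  have "L \<subseteq> gl_std"
  proof
    fix Y assume Y: "Y \<in> L"
    then obtain a' b' c' d' e f g h i j where M: "Y = M a' b' c' d' e f g h i j"
      by (rule elliptic_subalgebra_cases[OF L(1)])
    let ?X = "M a 0 0 b 0 0 0 0 0 0"
    \<comment> \<open>The list consists of all nonzero roots at X. After cancelling them only the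
      factor ad X is left, so Y commutes with X.\<close>
    have z: "foldr (ad_shift ?X) [2*a, - 2*a, 2*b, - 2*b, a+b, - a-b, a-b, b-a] (ad_shift ?X 0 Y) = 0"
      by (simp only: foldr.simps o_apply id_apply M ad_shift_diag) (simp add: M_eq_0_iff)
    have "ad_shift ?X 0 Y = 0"
      by (rule ad_shift_cancel[OF L X ad_shift_mem[OF L(1) X Y] _ z]) (use ab ne in auto)
    then have "b' = 0" "c' = 0" "e = 0" "f = 0" "g = 0" "h = 0" "i = 0" "j = 0"
      using ab ne unfolding M ad_shift_diag by (auto simp: M_eq_0_iff)
    then show "Y \<in> gl_std" unfolding gl_std_def M by blast
  qed
  then show ?thesis by (rule listed_gl)
qed

lemma ad_shift_jordan:
  "ad_shift (M a 0 0 0 0 0 k 0 0 0) l (M a' b' c' d' e f g h i j)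
    = M (- l*a') ((a-l)*b') ((- a-l)*c' + k*i) (k*j - l*d')
    ((2*a-l)*e) ((a-l)*f - k*b') (- 2*k*d' - l*g) ((- 2*a-l)*h) ((- a-l)*i) (- l*j)"
  by (simp add: ad_shift_def M_eq_iff algebra_simps)

text \<open>L lies in the weight zero space of ad X. Since ad X need not be semisimple, weight 0
  takes the third power and the weights a and -a take double factors.\<close>

lemma jordan_centralizer:
  assumes L: "elliptic_subalgebra L" "nilpotent_free L" and X: "M a 0 0 0 0 0 k 0 0 0 \<in> L" and a: "a \<noteq> 0"
    and Y: "Y \<in> L"
  shows "\<exists>a' d g j. Y = M a' 0 0 d 0 0 g 0 0 j"
proof -
  obtain a' b' c' d' e f g h i j where M: "Y = M a' b' c' d' e f g h i j" using Y
    by (rule elliptic_subalgebra_cases[OF L(1)])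
  let ?X = "M a 0 0 0 0 0 k 0 0 0"
  let ?W = "ad_shift ?X 0 (ad_shift ?X 0 (ad_shift ?X 0 Y))"
  have W: "?W = M 0 (a*(a*(a*b'))) (- (a*(a*(a*c'))) + 3*k*(a*(a*i))) 0 (8*(a*(a*(a*e))))
    (a*(a*(a*f)) - 3*k*(a*(a*b'))) 0 (- 8*(a*(a*(a*h)))) (- (a*(a*(a*i)))) 0"
    unfolding M ad_shift_jordan by (simp add: M_eq_iff algebra_simps)
  have z: "foldr (ad_shift ?X) [- a, - a, a, a, - 2*a, 2*a] ?W = 0"
    unfolding W by (simp add: ad_shift_jordan M_eq_0_iff algebra_simps)
  have "?W = 0"
    by (rule ad_shift_cancel[OF L X _ _ z]) (use a ad_shift_mem[OF L(1) X] Y in auto)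
  then have "b' = 0" "c' = 0" "e = 0" "f = 0" "h = 0" "i = 0"
    using a unfolding W by (auto simp: M_eq_0_iff)
  then show ?thesis using M by blast
qed

text \<open>On the weight zero space the second power of ad X maps \<open>j\<close>, and then ad X
  maps \<open>d\<close>, into the direction of p2^2, which is nilpotent; this leaves
  \<open>g\<close> as a fixed multiple of the entry in the first block.\<close>

lemma listed_real_jordan:
  assumes L: "elliptic_subalgebra L" "nilpotent_free L" and X: "M a 0 0 0 0 0 k 0 0 0 \<in> L"
    and a: "a \<noteq> 0" "k \<noteq> 0"
  shows "listed L"
proof -
  note cl = elliptic_subalgebra_closed[OF L(1)]
  have "L \<subseteq> {M a' 0 0 0 0 f ((k/a)*a') 0 0 0 | a' f. True}"
  proof
    fix Y assume Y: "Y \<in> L"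
    obtain a' d g j where M: "Y = M a' 0 0 d 0 0 g 0 0 j" using jordan_centralizer[OF L X a(1) Y] by blast
    let ?X = "M a 0 0 0 0 0 k 0 0 0"
    have "lie_bracket ?X (lie_bracket ?X Y) \<in> L" by (intro cl X Y)
    then have "M 0 0 0 0 0 0 (- 2*k*(k*j)) 0 0 0 \<in> L" by (simp add: M algebra_simps)
    then have j: "j = 0" using nilpotent_free_M(1)[OF L(2)] a by fastforce
    have "lie_bracket ?X Y \<in> L" by (intro cl X Y)
    then have "M 0 0 0 0 0 0 (- 2*k*d) 0 0 0 \<in> L" by (simp add: M j algebra_simps)
    then have d: "d = 0" using nilpotent_free_M(1)[OF L(2)] a by fastforce
    have "Y - (a'/a) *\<^sub>R ?X \<in> L" by (intro cl X Y)
    then have "M 0 0 0 0 0 0 (g - (a'/a)*k) 0 0 0 \<in> L" using a by (simp add: M j d)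
    then have "g = (k/a)*a'" using nilpotent_free_M(1)[OF L(2)] by fastforce
    then show "Y \<in> {M a' 0 0 0 0 f ((k/a)*a') 0 0 0 | a' f. True}" using M d j by blast
  qed
  then show ?thesis by (rule listed_D412_form[OF L(1)])
qed

text \<open>Multiplication of x + iy by the nonzero complex number p + iq.\<close>

lemma rot_eq_0:
  fixes p q x y :: real
  assumes "p*x - q*y = 0" "q*x + p*y = 0" "p \<noteq> 0 \<or> q \<noteq> 0"
  shows "x = 0 \<and> y = 0"
proof -
  have "(p*p + q*q) * x = 0" "(p*p + q*q) * y = 0" using assms(1,2) by algebra+
  moreover have "p*p + q*q \<noteq> 0" using assms(3) by (simp add: sum_squares_eq_zero_iff)
  ultimately show ?thesis by auto
qed

text \<open>For (x, y) nonzero the two elements span the same plane as the real and imaginary parts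
  of (p2 + i q2)^2.\<close>

lemma elliptic_plane:
  assumes L: "elliptic_subalgebra L" and A: "M 0 0 0 x 0 0 y 0 0 y \<in> L" and B: "M 0 0 0 (- y) 0 0 x 0 0 x \<in> L"
  shows "x = 0 \<and> y = 0"
proof (rule ccontr)
  assume "\<not> ?thesis"
  then have n: "x*x + y*y \<noteq> 0" by (simp add: sum_squares_eq_zero_iff)
  note cl = elliptic_subalgebra_closed[OF L]
  have "(1/(x*x+y*y)) *\<^sub>R (x *\<^sub>R M 0 0 0 x 0 0 y 0 0 y - y *\<^sub>R M 0 0 0 (- y) 0 0 x 0 0 x) \<in> L"
    by (intro cl A B)
  then have 1: "quad p2 q2 \<in> L" using n quad_commute[of p2 q2]
    by (simp add: quad_basis split: if_splits flip: add_divide_distrib)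
  have "(- 2/(x*x+y*y)) *\<^sub>R (y *\<^sub>R M 0 0 0 x 0 0 y 0 0 y + x *\<^sub>R M 0 0 0 (- y) 0 0 x 0 0 x) \<in> L"
    by (intro cl A B)
  moreover have "(- 2/(x*x+y*y)) *\<^sub>R (y *\<^sub>R M 0 0 0 x 0 0 y 0 0 y + x *\<^sub>R M 0 0 0 (- y) 0 0 x 0 0 x)
      = quad p2 p2 - quad q2 q2"
    using n by (simp add: quad_basis M_eq_iff field_simps)
  ultimately show False using elliptic_subalgebra_elliptic[OF L, of p2 q2] 1 axis_nonzero by simp
qed

text \<open>The real factor of a polynomial in ad X that belongs to a conjugate pair of
  weights.\<close>

definition ad_quadratic :: "glV \<Rightarrow> real \<Rightarrow> real \<Rightarrow> glV \<Rightarrow> glV" where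
  "ad_quadratic X p q Y = lie_bracket X (lie_bracket X Y) + p *\<^sub>R lie_bracket X Y + q *\<^sub>R Y"

lemma ad_quadratic_mem: "elliptic_subalgebra L \<Longrightarrow> X \<in> L \<Longrightarrow> Y \<in> L
  \<Longrightarrow> ad_quadratic X p q Y \<in> L"
  unfolding ad_quadratic_def by (intro elliptic_subalgebra_closed)

lemma ad_quadratic_mixed:
  "ad_quadratic (M a 0 0 0 0 0 (- b) 0 0 b) p q (M a' b' c' d' e f g h i j) = M (q*a')
    ((a*a-b*b+p*a+q)*b' - (2*a*b+p*b)*f) ((a*a-b*b-p*a+q)*c' - (p*b-2*a*b)*i) (q*d' - 4*b*b*d' - p*b*(g+j))
    ((4*a*a+2*p*a+q)*e) ((2*a*b+p*b)*b' + (a*a-b*b+p*a+q)*f) (q*g - 2*b*b*(g+j) + 2*p*b*d')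
    ((4*a*a-2*p*a+q)*h) ((p*b-2*a*b)*c' + (a*a-b*b-p*a+q)*i) (q*j - 2*b*b*(g+j) + 2*p*b*d')"
  by (simp add: ad_quadratic_def M_eq_iff algebra_simps)

lemma bracket_mixed:
  "lie_bracket (M a 0 0 0 0 0 (- b) 0 0 b) (M a' b' c' d' e f g h i j) = M 0 (a*b'-b*f) (- a*c' - b*i) (- b*(g+j))
     (2*a*e) (b*b' + a*f) (2*b*d') (- 2*a*h) (b*c' + (- a)*i) (2*b*d')"
  by (simp add: M_eq_iff algebra_simps)

text \<open>X has eigenvalues a, -a, ib, -ib. The weights +-a +- ib and +-2a lead to nilpotent
  elements of L, and +-2ib leads to a complex rank one plane, so only the centralizer of X
  remains.\<close>

lemma listed_mixed:
  assumes L: "elliptic_subalgebra L" "nilpotent_free L" and X: "M a 0 0 0 0 0 (- b) 0 0 b \<in> L"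
    and ab: "a \<noteq> 0" "b \<noteq> 0"
  shows "listed L"
proof -
  note cl = elliptic_subalgebra_closed[OF L(1)]
  let ?X = "M a 0 0 0 0 0 (- b) 0 0 b"
  have sq: "a*a + b*b > 0" "- (3*a*a) - b*b < 0" "a*a + 3*b*b > 0"
  proof -
    have "a*a > 0" "b*b > 0" using ab by (auto simp: zero_less_mult_iff linorder_neq_iff)
    then show "a*a + b*b > 0" "- (3*a*a) - b*b < 0" "a*a + 3*b*b > 0" unfolding mult.assoc by linarith+
  qed
  have form: "\<exists>a' k. Y = M a' 0 0 0 0 0 (- k) 0 0 k" if Y: "Y \<in> L" for Y
  proof -
    obtain a' b' c' d' e f g h i j where M: "Y = M a' b' c' d' e f g h i j" using Y
      by (rule elliptic_subalgebra_cases[OF L(1)])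
    \<comment> \<open>D(D^2 + 4b^2)(D^2 - 4a^2) leaves only the weights +-a +- ib. A further
      quadratic factor then removes one sign of the real part, and the rest is square-zero.\<close>
    define W where "W = ad_quadratic ?X 0 (- 4*a*a) (ad_quadratic ?X 0 (4*b*b) (lie_bracket ?X Y))"
    have WL: "W \<in> L" unfolding W_def by (intro ad_quadratic_mem[OF L(1) X] cl X Y)
    \<comment> \<open>On b' + if, D is multiplication by a + ib, on c' + ii by -a + ib. The indices
      1, 2, 3 count the factors of the polynomial applied so far.\<close>
    define b1 f1 c1 i1 where "b1 = a*b'-b*f" and "f1 = b*b'+a*f" and "c1 = (- a)*c' - b*i" and "i1 = b*c' + (- a)*i"
    define b2 f2 c2 i2 where "b2 = (a*a+3*b*b)*b1 - (2*a*b)*f1" and "f2 = (2*a*b)*b1 + (a*a+3*b*b)*f1"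
      and "c2 = (a*a+3*b*b)*c1 - (- 2*a*b)*i1" and "i2 = (- 2*a*b)*c1 + (a*a+3*b*b)*i1"
    define b3 f3 c3 i3 where "b3 = (- (3*a*a) - b*b)*b2 - (2*a*b)*f2" and "f3 = (2*a*b)*b2 + (- (3*a*a) - b*b)*f2"
      and "c3 = (- (3*a*a) - b*b)*c2 - (- 2*a*b)*i2" and "i3 = (- 2*a*b)*c2 + (- (3*a*a) - b*b)*i2"
    have W2: "ad_quadratic ?X 0 (4*b*b) (lie_bracket ?X Y)
      = M 0 b2 c2 0 ((4*a*a+4*b*b)*(2*a*e)) f2 0 ((4*a*a+4*b*b)*(-2*a*h)) i2 0"
      unfolding M bracket_mixed ad_quadratic_mixed
      by (simp add: M_eq_iff b1_def f1_def c1_def i1_def b2_def f2_def c2_def i2_def algebra_simps)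
    have W3: "W = M 0 b3 c3 0 0 f3 0 0 i3 0"
      unfolding W_def W2 ad_quadratic_mixed by (simp add: M_eq_iff b3_def f3_def c3_def i3_def)
    have "ad_quadratic ?X (2*a) (a*a+b*b) W = M 0 ((4*a*a)*b3 - (4*a*b)*f3) 0 0 0 ((4*a*b)*b3 + (4*a*a)*f3) 0 0 0 0"
      unfolding W3 ad_quadratic_mixed by (simp add: M_eq_iff)
    then have "M 0 ((4*a*a)*b3 - (4*a*b)*f3) 0 0 0 ((4*a*b)*b3 + (4*a*a)*f3) 0 0 0 0 \<in> L"
      using ad_quadratic_mem[OF L(1) X WL, of "2*a" "a*a+b*b"] by simp
    then have "(4*a*a)*b3 - (4*a*b)*f3 = 0 \<and> (4*a*b)*b3 + (4*a*a)*f3 = 0" by (rule nilpotent_free_M(3)[OF L(2)])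
    then have "b3 = 0 \<and> f3 = 0" using ab rot_eq_0[of "4*a*a" b3 "4*a*b" f3] by simp
    then have "b2 = 0 \<and> f2 = 0" using rot_eq_0[of "- (3*a*a) - b*b" b2 "2*a*b" f2] sq
      by (simp add: b3_def f3_def)
    then have "b1 = 0 \<and> f1 = 0" using rot_eq_0[of "a*a+3*b*b" b1 "2*a*b" f1] sq by (simp add: b2_def f2_def)
    then have bf: "b' = 0" "f = 0" using rot_eq_0[of a b' b f] ab by (auto simp add: b1_def f1_def)
    have "ad_quadratic ?X (- 2*a) (a*a+b*b) W
      = M 0 0 ((4*a*a)*c3 - (- 4*a*b)*i3) 0 0 0 0 0 ((- 4*a*b)*c3 + (4*a*a)*i3) 0"
      unfolding W3 ad_quadratic_mixed by (simp add: M_eq_iff)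
    then have "M 0 0 ((4*a*a)*c3 - (- 4*a*b)*i3) 0 0 0 0 0 ((- 4*a*b)*c3 + (4*a*a)*i3) 0 \<in> L"
      using ad_quadratic_mem[OF L(1) X WL, of "- 2*a" "a*a+b*b"] by simp
    then have "(4*a*a)*c3 - (- 4*a*b)*i3 = 0 \<and> (- 4*a*b)*c3 + (4*a*a)*i3 = 0"
      by (rule nilpotent_free_M(4)[OF L(2)])
    then have "c3 = 0 \<and> i3 = 0" using ab rot_eq_0[of "4*a*a" c3 "- 4*a*b" i3] by simp
    then have "c2 = 0 \<and> i2 = 0" using rot_eq_0[of "- (3*a*a) - b*b" c2 "- 2*a*b" i2] sq
      by (simp add: c3_def i3_def)
    then have "c1 = 0 \<and> i1 = 0" using rot_eq_0[of "a*a+3*b*b" c1 "- 2*a*b" i1] sq by (simp add: c2_def i2_def)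
    then have ci: "c' = 0" "i = 0" using rot_eq_0[of "- a" c' b i] ab by (auto simp add: c1_def i1_def)
    define k where "k = (4*a*a+4*b*b)*(2*a)"
    have k: "k \<noteq> 0" using sq ab by (simp add: k_def flip: distrib_left)
    define U where "U = ad_quadratic ?X 0 (4*b*b) (lie_bracket ?X Y)"
    have UL: "U \<in> L" unfolding U_def by (intro ad_quadratic_mem[OF L(1) X] cl X Y)
    have U: "U = M 0 0 0 0 (k*e) 0 0 (- k*h) 0 0"
      unfolding U_def W2 by (simp add: b1_def f1_def c1_def i1_def b2_def f2_def c2_def i2_def bf ci k_def mult.assoc)
    have "lie_bracket ?X U + (2*a) *\<^sub>R U \<in> L" "lie_bracket ?X U - (2*a) *\<^sub>R U \<in> L"
      by (intro cl X UL)+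
    then have "M 0 0 0 0 (4*a*(k*e)) 0 0 0 0 0 \<in> L" "M 0 0 0 0 0 0 0 (4*a*(k*h)) 0 0 \<in> L"
      unfolding U by (simp_all add: algebra_simps)
    then have "4*a*(k*e) = 0" "4*a*(k*h) = 0" using nilpotent_free_M(1,2)[OF L(2)] by blast+
    then have eh: "e = 0" "h = 0" using ab k by auto
    have D1: "lie_bracket ?X Y = M 0 0 0 (- b*(g+j)) 0 0 (2*b*d') 0 0 (2*b*d')"
      unfolding M bracket_mixed by (simp add: bf ci eh)
    have "lie_bracket ?X Y \<in> L" "(1/(2*b)) *\<^sub>R lie_bracket ?X (lie_bracket ?X Y) \<in> L" by (intro cl X Y)+
    then have "M 0 0 0 (- b*(g+j)) 0 0 (2*b*d') 0 0 (2*b*d') \<in> L"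
      "M 0 0 0 (- (2*b*d')) 0 0 (- b*(g+j)) 0 0 (- b*(g+j)) \<in> L"
      unfolding D1 using ab by (simp_all add: algebra_simps)
    then have "- b*(g+j) = 0 \<and> 2*b*d' = 0" by (rule elliptic_plane[OF L(1)])
    then have "d' = 0" "g = - j" using ab by auto
    then show ?thesis using M bf ci eh by blast
  qed
  have s: "symplectic_basis (vector [0,1,0,0]) (vector [1,0,0,0]) (vector [0,0,0,1]) (vector [0,0,1,0])"
    by (simp add: symplectic_basis_def Omega_def)
  show ?thesis
  proof (rule listed_coordsI[OF s L(1) listed_cartan])
    fix Y assume "Y \<in> L"
    then obtain a' k where Y: "Y = M a' 0 0 0 0 0 (- k) 0 0 k" using form by blast
    show "coords (vector [0,1,0,0]) (vector [1,0,0,0]) (vector [0,0,0,1]) (vector [0,0,1,0]) Y \<in> cartan_sum"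
      unfolding Y coords_def cartan_sum_eq by (simp add: Omega_def M_eq_iff)
  qed
qed

section \<open>Normal forms of hyperbolic and elliptic blocks\<close>

lemma sp_similar_diagonalize:
  assumes "e * h = a * a" "a \<noteq> 0"
  shows "sp_similar (M 0 0 0 d e 0 g h 0 j) (M a 0 0 d 0 0 g 0 0 j)"
proof -
  have "e \<noteq> 0" using assms by auto
  have s: "symplectic_basis (vector [e,0,a,0]) (vector [0,1,0,0]) (vector [-1/(2*a),0,1/(2*e),0]) (vector [0,0,0,1])"
    using assms \<open>e \<noteq> 0\<close> by (simp add: symplectic_basis_def Omega_def field_simps)
  have h: "h = a * a / e" using assms \<open>e \<noteq> 0\<close> by (simp add: field_simps)
  have "coords (vector [e,0,a,0]) (vector [0,1,0,0]) (vector [-1/(2*a),0,1/(2*e),0]) (vector [0,0,0,1]) (M 0 0 0 d e 0 g h 0 j)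
    = M a 0 0 d 0 0 g 0 0 j"
    using assms \<open>e \<noteq> 0\<close> by (simp add: coords_def Omega_def M_eq_iff h field_simps)
  then show ?thesis using sp_similar_coords[OF s M_in_spV] by metis
qed

lemma sp_similar_swap: "sp_similar (M a 0 0 d e 0 g h 0 j) (M d 0 0 a g 0 e j 0 h)"
proof -
  have s: "symplectic_basis (vector [0,1,0,0]) (vector [1,0,0,0]) (vector [0,0,0,1]) (vector [0,0,1,0])"
    by (simp add: symplectic_basis_def Omega_def)
  have "coords (vector [0,1,0,0]) (vector [1,0,0,0]) (vector [0,0,0,1]) (vector [0,0,1,0]) (M a 0 0 d e 0 g h 0 j)
    = M d 0 0 a g 0 e j 0 h" by (simp add: coords_def Omega_def)
  then show ?thesis using sp_similar_coords[OF s M_in_spV] by metis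
qed

text \<open>Scaling p2 by t divides \<open>g\<close> and multiplies \<open>j\<close> by t^2; the
  fourth root of -g/j balances them. The witness has the sign of \<open>j\<close>.\<close>

lemma sp_similar_rotate:
  assumes "g * j < 0"
  shows "\<exists>b. b \<noteq> 0 \<and> b * b = - (g * j)
    \<and> sp_similar (M a 0 0 0 e 0 g h 0 j) (M a 0 0 0 e 0 (- b) h 0 b)"
proof -
  define k w t where "k = - g / j" and "w = sqrt k" and "t = sqrt w"
  have "k > 0" using assms by (auto simp: k_def mult_less_0_iff divide_pos_neg divide_neg_pos)
  then have "w > 0" "w * w = k" by (simp_all add: w_def)
  then have t: "t > 0" "t*t*(t*t) = - g/j" by (simp_all add: t_def k_def)
  have j: "j \<noteq> 0" using assms by auto
  have g: "g = - j * (t*t*(t*t))" using t j by simp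
  have s: "symplectic_basis (vector [1,0,0,0]) (vector [0,t,0,0]) (vector [0,0,1,0]) (vector [0,0,0,1/t])"
    using t by (simp add: symplectic_basis_def Omega_def)
  have "coords (vector [1,0,0,0]) (vector [0,t,0,0]) (vector [0,0,1,0]) (vector [0,0,0,1/t]) (M a 0 0 0 e 0 g h 0 j)
    = M a 0 0 0 e 0 (- (j*t*t)) h 0 (j*t*t)"
    using t(1) by (simp add: coords_def Omega_def M_eq_iff g)
  then have "sp_similar (M a 0 0 0 e 0 g h 0 j) (M a 0 0 0 e 0 (- (j*t*t)) h 0 (j*t*t))"
    using sp_similar_coords[OF s M_in_spV] by metis
  moreover have "(j*t*t)*(j*t*t) = - (g * j)" by (simp add: g algebra_simps)
  ultimately show ?thesis using j t(1) by (intro exI[of _ "j*t*t"]) simp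
qed

lemma listed_hyperbolic_pair:
  assumes L: "elliptic_subalgebra L" "nilpotent_free L" and X: "M a 0 0 d 0 0 g 0 0 j \<in> L"
    and a: "a \<noteq> 0" "d*d + g*j \<noteq> 0" "d*d + g*j \<noteq> a*a"
  shows "listed L"
proof -
  obtain g' j' where s: "sp_similar (M a 0 0 d 0 0 g 0 0 j) (M a 0 0 0 0 0 g' 0 0 j')" "g' * j' = d*d + g*j"
    using block_companion by blast
  show ?thesis
  proof (cases "g' * j' > 0")
    case True
    define b where "b = sqrt (g' * j')"
    have b: "b \<noteq> 0" "g' * j' = b * b" using True by (auto simp: b_def)
    have "sp_similar (M a 0 0 0 0 0 g' 0 0 j') (M 0 0 0 a g' 0 0 j' 0 0)" by (rule sp_similar_swap)
    moreover have "sp_similar (M 0 0 0 a g' 0 0 j' 0 0) (M b 0 0 a 0 0 0 0 0 0)"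
      by (rule sp_similar_diagonalize[OF b(2,1)])
    ultimately have "sp_similar (M a 0 0 d 0 0 g 0 0 j) (M b 0 0 a 0 0 0 0 0 0)" using s(1) sp_similar_trans by blast
    then show ?thesis by (rule
      listed_sp_similar[OF L(1) X]) (rule listed_real_diag[of _ b a], use L(2) a s(2) b in auto)
  next
    case False
    then have "g' * j' < 0" using s(2) a by simp
    then obtain b where b: "b \<noteq> 0" "sp_similar (M a 0 0 0 0 0 g' 0 0 j') (M a 0 0 0 0 0 (- b) 0 0 b)"
      using sp_similar_rotate by blast
    show ?thesis by (rule listed_sp_similar[OF L(1) X
      sp_similar_trans[OF s(1) b(2)]]) (rule listed_mixed[of _ a b], use L(2) a b in auto)
  qed
qed

text \<open>The weight zero space of ad X is the line of X plus sl2 of the second plane. Any element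
  of L in that second summand is non-nilpotent and is added to X to reach the case of two
  blocks.\<close>

lemma listed_hyperbolic_single:
  assumes L: "elliptic_subalgebra L" "nilpotent_free L" and X: "M a 0 0 0 0 0 0 0 0 0 \<in> L" and a: "a \<noteq> 0"
  shows "listed L"
proof (cases "\<exists>d g j. M 0 0 0 d 0 0 g 0 0 j \<in> L
  \<and> (d \<noteq> 0 \<or> g \<noteq> 0 \<or> j \<noteq> 0)")
  case True
  then obtain d g j where Z: "M 0 0 0 d 0 0 g 0 0 j \<in> L" "d \<noteq> 0 \<or> g \<noteq> 0 \<or> j \<noteq> 0"
    by blast
  define n where "n = d*d + g*j"
  have n: "n \<noteq> 0"
  proof
    assume "n = 0"
    then have "M 0 0 0 d 0 0 g 0 0 j ** M 0 0 0 d 0 0 g 0 0 j = 0"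
      by (simp add: n_def vec_eq_iff forall_4 matrix_matrix_mult_def sum_4 algebra_simps)
    then show False using nilpotent_freeD[OF L(2) Z(1)] Z(2) by (simp add: M_eq_0_iff)
  qed
  \<comment> \<open>The factor 2 avoids equal squares of the eigenvalues in the two blocks.\<close>
  define t :: real where "t = (if n = a*a then 2 else 1)"
  have t: "t*t*n \<noteq> a*a" "t \<noteq> 0" using n a by (auto simp: t_def)
  have "M a 0 0 0 0 0 0 0 0 0 + t *\<^sub>R M 0 0 0 d 0 0 g 0 0 j \<in> L"
    by (intro elliptic_subalgebra_closed[OF L(1)] X Z)
  then have "M a 0 0 (t*d) 0 0 (t*g) 0 0 (t*j) \<in> L" by simp
  moreover have "(t*d)*(t*d) + (t*g)*(t*j) = t*t*n" by (simp add: n_def algebra_simps)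
  ultimately show ?thesis using listed_hyperbolic_pair[OF L] a t n by simp
next
  case False
  have "L \<subseteq> gl_std"
  proof
    fix Y assume Y: "Y \<in> L"
    obtain a' d g j where M: "Y = M a' 0 0 d 0 0 g 0 0 j" using jordan_centralizer[OF L X a Y] by blast
    have "Y - (a'/a) *\<^sub>R M a 0 0 0 0 0 0 0 0 0 \<in> L" by (intro elliptic_subalgebra_closed[OF L(1)] X Y)
    then have "M 0 0 0 d 0 0 g 0 0 j \<in> L" using a by (simp add: M)
    then have "d = 0" "g = 0" "j = 0" using False by blast+
    then show "Y \<in> gl_std" unfolding gl_std_def M by blast
  qed
  then show ?thesis by (rule listed_gl)
qed

lemma listed_hyperbolic_block:
  assumes L: "elliptic_subalgebra L" "nilpotent_free L" and X: "M 0 0 0 0 e 0 g h 0 j \<in> L"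
    and eh: "e * h > 0" "e * h \<noteq> g * j"
    and gj: "g = 0 \<longrightarrow> j = 0"
  shows "listed L"
proof -
  define a where "a = sqrt (e * h)"
  have a: "a \<noteq> 0" "e * h = a * a" using eh by (auto simp: a_def)
  have s: "sp_similar (M 0 0 0 0 e 0 g h 0 j) (M a 0 0 0 0 0 g 0 0 j)" by (rule sp_similar_diagonalize[OF a(2,1)])
  show ?thesis
  proof (rule listed_sp_similar[OF L(1) X s])
    fix K assume K: "elliptic_subalgebra K" "nilpotent_free L \<Longrightarrow> nilpotent_free K"
      "M a 0 0 0 0 0 g 0 0 j \<in> K"
    note KK = K(1) K(2)[OF L(2)]
    consider "g * j \<noteq> 0" | "g = 0" | "g \<noteq> 0" "j = 0" by auto
    then show "listed K"
    proof cases
      case 1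
      then show ?thesis using listed_hyperbolic_pair[OF KK K(3) a(1)] eh a(2) by simp
    next
      case 2
      then show ?thesis using listed_hyperbolic_single[OF KK _ a(1)] K(3) gj by simp
    next
      case 3
      then show ?thesis using listed_real_jordan[OF KK _ a(1) 3(1)] K(3) by simp
    qed
  qed
qed

subsection \<open>Elements preserving a Lagrangian splitting\<close>

lemma vec_two_mult: "2 * (x::real^'n) = 2 *\<^sub>R x" "(x::real^'n) * 2 = 2 *\<^sub>R x"
  by (simp_all add: vec_eq_iff)

text \<open>Omega vanishes on P and on Q, so it pairs one with the other. Once a first pair is
  chosen, any completion to a symplectic basis can be projected to P and Q without losing
  orthogonality to that pair.\<close>

lemma lagrangian_frame:
  assumes P: "subspace P" "\<And>u v. u \<in> P \<Longrightarrow> v \<in> P \<Longrightarrow> Omega u v = 0"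
    and Q: "subspace Q" "\<And>u v. u \<in> Q \<Longrightarrow> v \<in> Q \<Longrightarrow> Omega u v = 0"
    and sum: "\<And>v. \<exists>p\<in>P. \<exists>q\<in>Q. v = p + q"
  shows "\<exists>P1\<in>P. \<exists>P2\<in>P. \<exists>Q1\<in>Q. \<exists>Q2\<in>Q. symplectic_basis P1 P2 Q1 Q2"
proof -
  obtain u1 q0 where u1: "u1 \<in> P" "q0 \<in> Q" "Omega q0 u1 \<noteq> 0"
  proof -
    obtain pa qa where a: "pa \<in> P" "qa \<in> Q" "q1 = pa + qa" using sum by blast
    obtain pb qb where b: "pb \<in> P" "qb \<in> Q" "p1 = pb + qb" using sum by blast
    have "Omega q1 p1 = 1" by (simp add: Omega_def q1_def p1_def axis_def)
    then have "Omega pa pb + Omega qa pb + (Omega pa qb + Omega qa qb) = 1"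
      unfolding a(3) b(3) Omega_left Omega_right by simp
    then have "Omega pa qb + Omega qa pb = 1"
      using P(2)[OF a(1) b(1)] Q(2)[OF a(2) b(2)] by simp
    then have "Omega qa pb \<noteq> 0 \<or> Omega qb pa \<noteq> 0" using Omega_commute[of pa qb] by auto
    then show thesis using that a b by blast
  qed
  define Q1 where "Q1 = (1 / Omega q0 u1) *\<^sub>R q0"
  have Q1: "Q1 \<in> Q" "Omega Q1 u1 = 1" using u1 Q(1) by (simp_all add: Q1_def subspace_scale Omega_linear)
  obtain w z where s: "symplectic_basis u1 w Q1 z" using symplectic_basis_complete[OF Q1(2)] by blast
  obtain wP wQ where w: "wP \<in> P" "wQ \<in> Q" "w = wP + wQ" using sum by blast
  obtain zP zQ where z: "zP \<in> P" "zQ \<in> Q" "z = zP + zQ" using sum by blast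
  note ss = symplectic_basis_sym[OF s]
  have perp: "Omega u1 wP = 0" "Omega u1 zP = 0" "Omega Q1 wQ = 0" "Omega Q1 zQ = 0"
    using P Q u1 Q1 w z by auto
  have "Omega u1 wP + Omega u1 wQ = 0" "Omega u1 zP + Omega u1 zQ = 0" "Omega wP Q1 + Omega wQ Q1 = 0"
    "Omega Q1 zP + Omega Q1 zQ = 0"
    using ss(3-6) unfolding w(3) z(3) Omega_left Omega_right by simp_all
  then have perp2: "Omega u1 wQ = 0" "Omega u1 zQ = 0" "Omega wP Q1 = 0" "Omega zP Q1 = 0"
    using perp Q(2)[OF w(2) Q1(1)] Omega_commute[of zP Q1] by simp_all
  have "Omega zP wQ + Omega zQ wP = 1"
    using ss(2) P(2)[OF z(1) w(1)] Q(2)[OF z(2) w(2)] unfolding w(3) z(3) Omega_left Omega_right by simp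
  then consider "Omega zQ wP \<noteq> 0" | "Omega wQ zP \<noteq> 0" using Omega_commute[of zP wQ] by fastforce
  then show ?thesis
  proof cases
    case 1
    have "symplectic_basis u1 wP Q1 ((1 / Omega zQ wP) *\<^sub>R zQ)"
      using 1 perp perp2 Q1(2) by (simp add: symplectic_basis_def Omega_linear)
    then show ?thesis using u1 Q1 w z Q(1) by (meson subspace_scale)
  next
    case 2
    have "symplectic_basis u1 zP Q1 ((1 / Omega wQ zP) *\<^sub>R wQ)"
      using 2 perp perp2 Q1(2) by (simp add: symplectic_basis_def Omega_linear)
    then show ?thesis using u1 Q1 w z Q(1) by (meson subspace_scale)
  qed
qed

text \<open>The possible eigenvalues of n are 0 and +-i sqrt(k), so none is the nonzero real number
  -c. No semisimplicity is assumed when k = 0.\<close>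

lemma cubic_shift_inj:
  fixes n :: "'a::real_vector \<Rightarrow> 'a"
  assumes n: "linear n" "n (n (n y)) = - k *\<^sub>R n y" and k: "k \<ge> 0" and c: "c \<noteq> 0"
    and y: "n y + c *\<^sub>R y = 0"
  shows "y = 0"
proof -
  have ny: "n y = - c *\<^sub>R y" using y by (simp add: eq_neg_iff_add_eq_0)
  have "(- c * (- c * - c)) *\<^sub>R y = (- k * - c) *\<^sub>R y"
    using n(2) by (simp add: ny linear_scale[OF n(1)] linear_neg[OF n(1)] mult.assoc)
  then have "(- c * (- c * - c) - (- k * - c)) *\<^sub>R y = 0" by (simp only: scaleR_diff_left) simp
  moreover have "- c * (- c * - c) - (- k * - c) = - c * (c * c + k)" by (simp add: algebra_simps)
  moreover have "c * c > 0" using c by (auto simp: zero_less_mult_iff linorder_neq_iff)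
  then have "c * c + k > 0" using k by simp
  ultimately show ?thesis using c by auto
qed

text \<open>The polynomial is (n + c)^2 + k; its roots have nonzero real part -c and are no
  eigenvalues of n.\<close>

lemma cubic_quadratic_inj:
  fixes n :: "'a::real_vector \<Rightarrow> 'a"
  assumes n: "linear n" "n (n (n y)) = - k *\<^sub>R n y" and k: "k \<ge> 0" and c: "c \<noteq> 0"
    and y: "n (n y) + (c + c) *\<^sub>R n y + (c*c + k) *\<^sub>R y = 0"
  shows "y = 0"
proof -
  define w where "w = n y"
  note l = linear_add[OF n(1)] linear_scale[OF n(1)] linear_0[OF n(1)] linear_neg[OF n(1)]
  have "n (n (n y) + (c + c) *\<^sub>R n y + (c*c + k) *\<^sub>R y) = 0" using y by (simp add: l)
  then have "- k *\<^sub>R w + (c + c) *\<^sub>R n w + (c*c + k) *\<^sub>R w = 0" by (simp add: l n(2) w_def)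
  then have "(2*c) *\<^sub>R (n w + (c/2) *\<^sub>R w) = 0" by (simp add: algebra_simps mult_2)
  then have "n w + (c/2) *\<^sub>R w = 0" using c by simp
  moreover have "n (n (n w)) = - k *\<^sub>R n w" using n(2) by (simp add: w_def l)
  ultimately have "w = 0" using cubic_shift_inj[OF n(1) _ k, of w "c/2"] c by simp
  then have "(c*c + k) *\<^sub>R y = 0" using y by (simp add: w_def[symmetric] l)
  moreover have "c * c > 0" using c by (auto simp: zero_less_mult_iff linorder_neq_iff)
  then have "c * c + k > 0" using k by simp
  ultimately show ?thesis by simp
qed

lemma linear_lie_bracket: "linear (lie_bracket X)"
  by (rule linearI) (simp_all add: lie_bracket_def matrix_distribs algebra_simps)

text \<open>Polynomials in D = n - p or D = n + p rewritten as polynomials in n.\<close>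

lemma scaleR_shift:
  fixes u v w :: "'a::real_vector"
  shows "(w - p *\<^sub>R v) - p *\<^sub>R (v - p *\<^sub>R u) + (p + p) *\<^sub>R (v - p *\<^sub>R u) + (p*p + k) *\<^sub>R u = w + k *\<^sub>R u"
    and "(w + p *\<^sub>R v) + p *\<^sub>R (v + p *\<^sub>R u) + k *\<^sub>R u
      = w + (p + p) *\<^sub>R v + (p*p + k) *\<^sub>R u"
    and "(w + p *\<^sub>R v) + p *\<^sub>R (v + p *\<^sub>R u) + (p + p) *\<^sub>R (v + p *\<^sub>R u) + (p*p + k) *\<^sub>R u
      = w + ((p + p) + (p + p)) *\<^sub>R v + ((p + p)*(p + p) + k) *\<^sub>R u"
  by (simp_all only: scaleR_left_distrib scaleR_right_distrib scaleR_right_diff_distrib scaleR_scaleR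
        distrib_left distrib_right) (simp_all add: add_ac diff_diff_eq2 diff_add_eq)

text \<open>X is a times the grading element plus a part that acts on P without trace and with
  imaginary or zero eigenvalues. With \<open>n\<close> for ad of that part and p = 2a, ad X equals
  n, n + p and n - p on the diagonal, upper and lower blocks, and n^3 = -kn. This covers the
  nilpotent case k = 0 as well.\<close>

lemma split_upper_zero:
  assumes L: "elliptic_subalgebra L" "nilpotent_free L" and X: "M (a+x) b c (a-x) 0 0 0 0 0 0 \<in> L"
    and a: "a \<noteq> 0" "x*x + b*c \<le> 0" and Y: "M a' b' c' d' e f g h i j \<in> L"
  shows "e = 0 \<and> f = 0 \<and> g = 0"
proof -
  let ?X = "M (a+x) b c (a-x) 0 0 0 0 0 0"
  define k where "k = - 4 * (x*x + b*c)"
  have k: "k \<ge> 0" using a by (simp add: k_def)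
  define p where "p = 2 * a"
  have p: "p \<noteq> 0" using a by (simp add: p_def)
  define D where "D = lie_bracket ?X"
  define n where "n = lie_bracket (M x b c (- x) 0 0 0 0 0 0)"
  have lin: "linear n" "linear D" unfolding n_def D_def by (rule linear_lie_bracket)+
  note lD = linear_add[OF lin(2)] linear_scale[OF lin(2)] linear_0[OF lin(2)]
  note ln = linear_add[OF lin(1)] linear_scale[OF lin(1)] linear_0[OF lin(1)]
  have n3: "n (n (n (M a b c d e f g h i j))) = - k *\<^sub>R n (M a b c d e f g h i j)" for a b c d e f g h i j
    unfolding n_def k_def by (simp add: M_eq_iff algebra_simps)
  have n3': "n (n (n Z)) = - k *\<^sub>R n Z" if "Z \<in> spV" for Z
    using that n3 by (metis spV_cases)
  define A B C where "A = {M a b c d 0 0 0 0 0 0 | a b c d. True}"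
    and "B = {M 0 0 0 0 e f g 0 0 0 | e f g. True}" and "C = {M 0 0 0 0 0 0 0 h i j | h i j. True}"
  have nB: "n (M 0 0 0 0 e f g 0 0 0) = M 0 0 0 0 (2*(x*e+b*f)) (b*g+c*e) (2*(c*f-x*g)) 0 0 0" for e f g
    by (simp add: n_def M_eq_iff algebra_simps)
  have nC: "n (M 0 0 0 0 0 0 0 h i j) = M 0 0 0 0 0 0 0 (- 2*(x*h+c*i)) (- (c*j+b*h)) (- 2*(b*i-x*j))" for h i j
    by (simp add: n_def M_eq_iff algebra_simps)
  have nA: "n (M p q r t 0 0 0 0 0 0) = M (b*r-c*q) (2*x*q+b*(t-p)) (c*(p-t)-2*x*r) (c*q-b*r) 0 0 0 0 0 0" for p q r t
    by (simp add: n_def M_eq_iff algebra_simps)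
  have DA: "D Z = n Z" if "Z \<in> A" for Z
    using that by (auto simp: A_def D_def nA M_eq_iff algebra_simps)
  have An: "n Z \<in> A" if "Z \<in> A" for Z
    using that nA unfolding A_def by blast
  have DB: "D Z = n Z + p *\<^sub>R Z" if "Z \<in> B" for Z
    using that by (auto simp: B_def D_def nB M_eq_iff p_def algebra_simps)
  have Bn: "n Z \<in> B" if "Z \<in> B" for Z
    using that nB unfolding B_def by blast
  have DC: "D Z = n Z - p *\<^sub>R Z" if "Z \<in> C" for Z
    using that by (auto simp: C_def D_def nC M_eq_iff p_def algebra_simps)
  have Cn: "n Z \<in> C" if "Z \<in> C" for Z
    using that nC unfolding C_def by blast
  have sB: "Z \<in> B \<Longrightarrow> W \<in> B \<Longrightarrow> Z + W \<in> B" "Z \<in> B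
    \<Longrightarrow> r *\<^sub>R Z \<in> B" for Z W r
    unfolding B_def by (auto, blast+)
  have sC: "Z \<in> C \<Longrightarrow> W \<in> C \<Longrightarrow> Z + W \<in> C" "Z \<in> C
    \<Longrightarrow> W \<in> C \<Longrightarrow> Z - W \<in> C" "Z \<in> C
    \<Longrightarrow> r *\<^sub>R Z \<in> C" for Z W r
    unfolding C_def by (auto, blast+)
  have spV: "Z \<in> spV" if "Z \<in> B \<or> Z \<in> C \<or> Z \<in> A" for Z using that
    by (auto simp: A_def B_def C_def)
  have DB': "D Z \<in> B" if "Z \<in> B" for Z unfolding DB[OF that] by (intro sB Bn that)
  have DC': "D Z \<in> C" if "Z \<in> C" for Z unfolding DC[OF that] by (intro sC Cn that)
  define f2 f3 f4 where "f2 Z = D (D Z) + k *\<^sub>R Z" and "f3 Z = D Z + p *\<^sub>R Z"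
    and "f4 Z = D (D Z) + (p + p) *\<^sub>R D Z + (p*p + k) *\<^sub>R Z" for Z
  \<comment> \<open>(D^2 + k)D is n^3 + kn = 0 on the diagonal block, (D + p)((D + p)^2 + k) is the
    same on the lower one, and on the upper block all factors are injective. So F(Y) is a
    square-zero element of L, and its vanishing forces the upper block of Y to vanish.\<close>
  define F where "F Z = f4 (f3 (f2 (D Z)))" for Z
  have Fadd: "F (Z + W) = F Z + F W" for Z W
    by (simp add: F_def f2_def f3_def f4_def lD algebra_simps)
  have FA: "F Z = 0" if "Z \<in> A" for Z
  proof -
    have "n Z \<in> A" "n (n Z) \<in> A" by (intro An that)+
    then have "f2 (D Z) = 0" using that n3' spV by (simp add: f2_def DA)
    then show ?thesis by (simp add: F_def f3_def f4_def lD)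
  qed
  have FC: "F Z = 0" if "Z \<in> C" for Z
  proof -
    define W where "W = f2 (D Z)"
    have W: "W \<in> C" unfolding W_def f2_def by (intro sC DC' that)
    have "f3 W = n W" by (simp add: f3_def DC[OF W])
    moreover have "f4 (n W) = n (n (n W)) + k *\<^sub>R n W"
      unfolding f4_def DC[OF Cn[OF W]] linear_diff[OF lin(2)] lD DC[OF Cn[OF W]] DC[OF Cn[OF Cn[OF W]]]
      by (rule scaleR_shift(1))
    ultimately show ?thesis using n3' spV W by (simp add: F_def W_def)
  qed
  have injB: "Z = 0" if Z: "Z \<in> B" and F: "F Z = 0" for Z
  proof -
    have f2: "f2 W = n (n W) + (p + p) *\<^sub>R n W + (p*p + k) *\<^sub>R W" if "W \<in> B" for W
      unfolding f2_def DB[OF that] lD DB[OF that] DB[OF Bn[OF that]] by (rule scaleR_shift(2))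
    have f3: "f3 W = n W + (p + p) *\<^sub>R W" if "W \<in> B" for W
      unfolding f3_def DB[OF that] by (simp only: scaleR_left_distrib add.assoc)
    have f4: "f4 W = n (n W) + ((p + p) + (p + p)) *\<^sub>R n W + ((p + p)*(p + p) + k) *\<^sub>R W" if
      "W \<in> B" for W
      unfolding f4_def DB[OF that] lD DB[OF that] DB[OF Bn[OF that]] by (rule scaleR_shift(3))
    have m: "D Z \<in> B" "f2 (D Z) \<in> B" "f3 (f2 (D Z)) \<in> B"
      unfolding f2_def f3_def by (intro sB DB' Z)+
    note i1 = cubic_shift_inj[OF lin(1) n3' k] and i2 = cubic_quadratic_inj[OF lin(1) n3' k]
    have "f3 (f2 (D Z)) = 0"
      by (rule i2[of _ "p + p"]) (use F f4[OF m(3)] spV m p in \<open>auto simp: F_def\<close>)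
    then have z2: "n (f2 (D Z)) + (p + p) *\<^sub>R f2 (D Z) = 0" unfolding f3[OF m(2)] .
    have "f2 (D Z) = 0" by (rule i1[OF _ _ z2]) (use spV m p in auto)
    then have z1: "n (n (D Z)) + (p + p) *\<^sub>R n (D Z) + (p*p + k) *\<^sub>R D Z = 0" unfolding f2[OF m(1)] .
    have "D Z = 0" by (rule i2[OF _ _ z1]) (use spV m p in auto)
    then have z0: "n Z + p *\<^sub>R Z = 0" unfolding DB[OF Z] .
    show "Z = 0" by (rule i1[OF _ _ z0]) (use spV Z p in auto)
  qed
  have DL: "D Z \<in> L" if "Z \<in> L" for Z unfolding D_def by (intro elliptic_subalgebra_closed[OF L(1)] X that)
  have "F (M a' b' c' d' e f g h i j) \<in> L"
    unfolding F_def f2_def f3_def f4_def by (intro elliptic_subalgebra_closed(2,4)[OF L(1)] DL Y)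
  moreover have "M a' b' c' d' e f g h i j
    = M a' b' c' d' 0 0 0 0 0 0 + (M 0 0 0 0 e f g 0 0 0 + M 0 0 0 0 0 0 0 h i j)"
    by simp
  moreover have "M a' b' c' d' 0 0 0 0 0 0 \<in> A" "M 0 0 0 0 0 0 0 h i j \<in> C"
    and B: "M 0 0 0 0 e f g 0 0 0 \<in> B"
    unfolding A_def B_def C_def by blast+
  ultimately have FL: "F (M 0 0 0 0 e f g 0 0 0) \<in> L" by (simp only: Fadd FA FC add_0_left add_0_right)
  have "F (M 0 0 0 0 e f g 0 0 0) \<in> B"
    unfolding F_def f2_def f3_def f4_def by (intro sB DB' B)
  then have "F (M 0 0 0 0 e f g 0 0 0) = 0" using FL nilpotent_free_M(1)[OF L(2)] by (auto simp: B_def M_eq_0_iff)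
  then have "M 0 0 0 0 e f g 0 0 0 = 0" by (rule injB[OF B])
  then show ?thesis by (simp add: M_eq_0_iff)
qed

text \<open>The lower block is treated by exchanging P and Q, which turns it into an upper
  one.\<close>

lemma listed_split:
  assumes L: "elliptic_subalgebra L" "nilpotent_free L" and X: "M (a+x) b c (a-x) 0 0 0 0 0 0 \<in> L"
    and a: "a \<noteq> 0" "x*x + b*c \<le> 0"
  shows "listed L"
proof -
  have s: "symplectic_basis (vector [0,0,1,0]) (vector [0,0,0,1]) (vector [-1,0,0,0]) (vector [0,-1,0,0])"
    by (simp add: symplectic_basis_def Omega_def)
  let ?S = "frame (vector [0,0,1,0]) (vector [0,0,0,1]) (vector [-1,0,0,0]) (vector [0,-1,0,0])"
  have c: "coords (vector [0,0,1,0]) (vector [0,0,0,1]) (vector [-1,0,0,0]) (vector [0,-1,0,0]) (M a b c d e f g h i j)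
    = M (- a) (- c) (- b) (- d) (- h) (- i) (- j) (- e) (- f) (- g)" for a b c d e f g h i j
    by (simp add: coords_def Omega_def)
  have K: "elliptic_subalgebra (pullback ?S L)" "nilpotent_free (pullback ?S L)"
    using elliptic_subalgebra_pullback[OF frame_in_SpV[OF s] L(1)] nilpotent_free_pullback[OF frame_in_SpV[OF s] L(2)]
    by auto
  have XK: "M (- a + - x) (- c) (- b) (- a - - x) 0 0 0 0 0 0 \<in> pullback ?S L"
    using coords_mem[OF s L(1) X] unfolding c by simp
  have "L \<subseteq> gl_std"
  proof
    fix Y assume Y: "Y \<in> L"
    then obtain a' b' c' d' e f g h i j where M: "Y = M a' b' c' d' e f g h i j"
      by (rule elliptic_subalgebra_cases[OF L(1)])
    have "e = 0" "f = 0" "g = 0" using split_upper_zero[OF L X a] Y M by auto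
    moreover have "- h = 0 \<and> - i = 0 \<and> - j = 0"
      by (rule split_upper_zero[OF K XK _ _
        coords_mem[OF s L(1) Y, unfolded M c]]) (use a in \<open>simp_all add: mult.commute\<close>)
    ultimately show "Y \<in> gl_std" unfolding gl_std_def M by auto
  qed
  then show ?thesis by (rule listed_gl)
qed

text \<open>The hypotheses on s and r make t^4 - s t^2 + r factor as (t^2 - 2at + \<rho>)(t^2 + 2at
  + \<rho>) with a > 0, also for a double real root. The kernels of the two factors at X are
  invariant and Lagrangian, and \<open>listed_split\<close> applies.\<close>

lemma listed_complex_eigenvalues:
  assumes L: "elliptic_subalgebra L" "nilpotent_free L" and X: "X \<in> L"
    and CH: "X ** X ** (X ** X) = s *\<^sub>R (X ** X) - r *\<^sub>R mat 1"
    and D: "s * s \<le> 4*r" "s > 0 \<or> s * s < 4*r"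
  shows "listed L"
proof -
  have Xs: "X \<in> spV" using L X by (auto simp: elliptic_subalgebra_def)
  note o = spV_Omega[OF Xs]
  note lX = matrix_vector_right_distrib matrix_vector_mult_scaleR matrix_vector_mult_diff_distrib
  have X4: "X *v (X *v (X *v (X *v v))) = s *\<^sub>R (X *v (X *v v)) - r *\<^sub>R v" for v
  proof -
    have "(X ** X ** (X ** X)) *v v = (s *\<^sub>R (X ** X) - r *\<^sub>R mat 1) *v v" using CH by simp
    then show ?thesis
      by (simp add: matrix_vector_mult_diff_rdistrib scaleR_vector_mult matrix_vector_mul_assoc[symmetric] matrix_mul_assoc)
  qed
  have r: "r > 0"
  proof (cases "s > 0")
    case True
    then have "s * s > 0" by simp
    then show ?thesis using D by linarith
  next
    case False
    then have "s * s < 4*r" using D by auto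
    then show ?thesis using zero_le_square[of s] by linarith
  qed
  define \<rho> where "\<rho> = sqrt r"
  have \<rho>: "\<rho> > 0" "\<rho> * \<rho> = r" using r by (simp_all add: \<rho>_def)
  have "s\<^sup>2 \<le> (2 * \<rho>)\<^sup>2" using D(1) \<rho> by (simp add: power2_eq_square)
  then have "\<bar>s\<bar> \<le> \<bar>2 * \<rho>\<bar>" unfolding abs_le_square_iff .
  then have s2: "\<bar>s\<bar> \<le> 2 * \<rho>" using \<rho> by simp
  have sp: "s + 2*\<rho> > 0"
  proof (cases "s > 0")
    case False
    then have "s * s < 4 * (\<rho> * \<rho>)" using D \<rho> by auto
    then have "s \<noteq> - (2 * \<rho>)" by auto
    then show ?thesis using s2 by linarith
  qed (use \<rho> in simp)
  define a where "a = sqrt (s + 2*\<rho>) / 2"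
  have a: "a > 0" "4 * (a * a) = s + 2*\<rho>" using sp by (simp_all add: a_def)
  define P where "P t = {v. X *v (X *v v) = (2*t) *\<^sub>R (X *v v) - \<rho> *\<^sub>R v}" for t
  have sub: "subspace (P t)" for t
  proof (rule subspaceI)
    fix c v assume "v \<in> P t"
    then have "c *\<^sub>R (X *v (X *v v)) = c *\<^sub>R ((2*t) *\<^sub>R (X *v v) - \<rho> *\<^sub>R v)"
      by (simp add: P_def)
    then show "c *\<^sub>R v \<in> P t" by (simp add: P_def lX scaleR_right_diff_distrib mult.commute)
  qed (auto simp: P_def lX algebra_simps)
  have inv: "X *v v \<in> P t" if "v \<in> P t" for v t
    using that by (simp add: P_def lX)
  have iso: "Omega u v = 0" if "u \<in> P t" "v \<in> P t" "t \<noteq> 0" for u v t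
  proof -
    have 1: "Omega u (X *v v) = 0" if "u \<in> P t" "v \<in> P t" for u v
    proof -
      have "Omega (X *v (X *v u)) v = Omega u (X *v (X *v v))" by (simp add: o)
      moreover have e: "X *v (X *v u) = (2*t) *\<^sub>R (X *v u) - \<rho> *\<^sub>R u" "X *v (X *v v)
        = (2*t) *\<^sub>R (X *v v) - \<rho> *\<^sub>R v"
        using that by (simp_all add: P_def)
      ultimately have "(4*t) * Omega u (X *v v) = 0" unfolding e Omega_left Omega_right o by simp
      then show ?thesis using \<open>t \<noteq> 0\<close> by simp
    qed
    have "\<rho> *\<^sub>R v = (2*t) *\<^sub>R (X *v v) - X *v (X *v v)" using that by (simp add: P_def)
    then have "Omega u (\<rho> *\<^sub>R v) = (2*t) * Omega u (X *v v) - Omega u (X *v (X *v v))"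
      by (simp add: Omega_linear)
    then have "\<rho> * Omega u v = 0" using 1[OF that(1,2)] 1[OF that(1) inv[OF that(2)]] by (simp add: Omega_linear)
    then show ?thesis using \<rho> by simp
  qed
  have proj: "X *v (X *v w) + (2*t) *\<^sub>R (X *v w) + \<rho> *\<^sub>R w \<in> P t" if "4*(t*t)
    = s + 2*\<rho>" for t w
  proof -
    have "X *v (X *v (X *v (X *v w))) = (4*(t*t) - 2*\<rho>) *\<^sub>R (X *v (X *v w)) - (\<rho>*\<rho>) *\<^sub>R w"
      using X4 that \<rho> by simp
    then show ?thesis by (simp add: P_def lX algebra_simps vec_two_mult)
  qed
  have sum: "\<exists>p\<in>P a. \<exists>q\<in>P (- a). v = p + q" for v
  proof -
    \<comment> \<open>This is (1/(4a)) times the preimage of v under X, read off from the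
      characteristic equation. The difference of its two projections is 4a Xw = v.\<close>
    define w where "w = (1/(4*a*r)) *\<^sub>R (s *\<^sub>R (X *v v) - X *v (X *v (X *v v)))"
    have "X *v w = (1/(4*a*r)) *\<^sub>R (r *\<^sub>R v)" unfolding w_def by (simp add: lX X4)
    then have Xw: "(4*a) *\<^sub>R (X *v w) = v" using a r by simp
    have p: "X *v (X *v w) + (2*a) *\<^sub>R (X *v w) + \<rho> *\<^sub>R w \<in> P a"
      "X *v (X *v w) + (2*(- a)) *\<^sub>R (X *v w) + \<rho> *\<^sub>R w \<in> P (- a)"
      by (rule proj, use a in simp)+
    have "v = (X *v (X *v w) + (2*a) *\<^sub>R (X *v w) + \<rho> *\<^sub>R w) + (-1) *\<^sub>R (X *v (X *v w) + (2*(- a)) *\<^sub>R (X *v w) + \<rho> *\<^sub>R w)"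
      unfolding Xw[symmetric] by (simp add: algebra_simps flip: scaleR_add_left)
    then show ?thesis using p subspace_scale[OF sub p(2), of "-1"] by blast
  qed
  have isoA: "u \<in> P a \<Longrightarrow> v \<in> P a \<Longrightarrow> Omega u v = 0"
    and isoB: "u \<in> P (- a) \<Longrightarrow> v \<in> P (- a) \<Longrightarrow> Omega u v = 0" for u v
    using iso[of u a v] iso[of u "- a" v] a(1) by simp_all
  obtain P1 P2 Q1 Q2 where PQ: "P1 \<in> P a" "P2 \<in> P a" "Q1 \<in> P (- a)" "Q2 \<in> P (- a)"
    and s: "symplectic_basis P1 P2 Q1 Q2"
    using lagrangian_frame[OF sub isoA sub isoB sum] by blast
  define \<alpha> b c \<delta> where "\<alpha> = Omega Q1 (X *v P1)" and "b = Omega Q1 (X *v P2)"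
    and "c = Omega Q2 (X *v P1)" and "\<delta> = Omega Q2 (X *v P2)"
  have z: "Omega P1 (X *v P1) = 0" "Omega P1 (X *v P2) = 0" "Omega P2 (X *v P2) = 0" "Omega P2 (X *v P1) = 0"
    "Omega Q1 (X *v Q1) = 0" "Omega Q1 (X *v Q2) = 0" "Omega Q2 (X *v Q2) = 0"
    by (intro isoA isoB inv PQ)+
  have XP: "X *v P1 = \<alpha> *\<^sub>R P1 + c *\<^sub>R P2" "X *v P2 = b *\<^sub>R P1 + \<delta> *\<^sub>R P2"
    using symplectic_basis_expand[OF s, of "X *v P1"] symplectic_basis_expand[OF s, of "X *v P2"] z
    by (simp_all add: \<alpha>_def b_def c_def \<delta>_def)
  have cX: "coords P1 P2 Q1 Q2 X = M \<alpha> b c \<delta> 0 0 0 0 0 0"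
    by (simp add: coords_def z \<alpha>_def b_def c_def \<delta>_def)
  note ss = symplectic_basis_sym[OF s]
  have e1: "X *v (X *v P1) = (2*a) *\<^sub>R (X *v P1) - \<rho> *\<^sub>R P1" "X *v (X *v P2)
    = (2*a) *\<^sub>R (X *v P2) - \<rho> *\<^sub>R P2"
    using PQ by (simp_all add: P_def)
  have e2: "Omega w (X *v (X *v P1)) = 2*a * Omega w (X *v P1) - \<rho> * Omega w P1"
    "Omega w (X *v (X *v P2)) = 2*a * Omega w (X *v P2) - \<rho> * Omega w P2" for w
    unfolding e1 by (simp_all add: Omega_linear)
  have q: "\<alpha>*\<alpha> + b*c = 2*a*\<alpha> - \<rho>" "c*(\<alpha> + \<delta>) = 2*a*c"
    "b*(\<alpha> + \<delta>) = 2*a*b" "\<delta>*\<delta> + b*c = 2*a*\<delta> - \<rho>"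
    using e2(1)[of Q1] e2(1)[of Q2] e2(2)[of Q1] e2(2)[of Q2] unfolding XP
    by (simp_all add: lX XP Omega_linear ss algebra_simps)
  have a\<rho>: "a * a \<le> \<rho>" using a s2 by linarith
  \<comment> \<open>If the trace on P were different from 2a, the quadratic equation would make X
    diagonal on P with both entries equal to a, a contradiction.\<close>
  have tr: "\<alpha> + \<delta> = 2*a"
  proof (rule ccontr)
    assume n: "\<alpha> + \<delta> \<noteq> 2*a"
    then have "b = 0" "c = 0" using q(2,3) by (auto simp: mult.commute)
    then have "(\<alpha> - a)*(\<alpha> - a) = a*a - \<rho>" "(\<delta> - a)*(\<delta> - a) = a*a - \<rho>"
      using q(1,4) by (simp_all add: algebra_simps)
    then have "\<alpha> = a" "\<delta> = a"
      using a\<rho> zero_le_square[of "\<alpha> - a"] zero_le_square[of "\<delta> - a"]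
      by (metis diff_le_0_iff_le eq_iff_diff_eq_0 mult_eq_0_iff order_antisym)+
    then show False using n by simp
  qed
  define x where "x = \<alpha> - a"
  have "x*x + b*c \<le> 0" using q(1) a\<rho> by (simp add: x_def algebra_simps)
  moreover have "M (a + x) b c (a - x) 0 0 0 0 0 0 = M \<alpha> b c \<delta> 0 0 0 0 0 0"
    using tr by (simp add: x_def M_eq_iff)
  ultimately show ?thesis
    using listed_frame[OF s L(1)] listed_split[OF _ nilpotent_free_pullback[OF frame_in_SpV[OF s] L(2)], of a x b c]
      coords_mem[OF s L(1) X] a(1) unfolding cX by auto
qed

subsection \<open>Non-semisimple elements with imaginary eigenvalues\<close>

lemma bracket_imaginary_jordan:
  "lie_bracket (M 0 (-1) 1 0 k 0 k 0 0 0) (M a b c d e f g h i j) = M (k*h - (b + c)) (a - d + k*i)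
    (a - d + k*i) (b + c + k*j) (- 2*(f + k*a)) (e - g - k*(b + c)) (2*(f - k*d)) (- 2*i) (h - j) (2*i)"
  by (simp add: M_eq_iff algebra_simps)

text \<open>\<open>u11_std\<close> is the centralizer of the rotation part of X, and D^3 annihilates
  it. On the complement D^2 + 4 is nilpotent; applying it twice, once and not at all peels off the
  entries, each time leaving a square-zero upper block.\<close>

lemma listed_imaginary_jordan:
  assumes L: "elliptic_subalgebra L" "nilpotent_free L" and X: "M 0 (- w) w 0 k 0 k 0 0 0 \<in> L"
    and w: "w \<noteq> 0" "k \<noteq> 0"
  shows "listed L"
proof -
  have "(1/w) *\<^sub>R M 0 (- w) w 0 k 0 k 0 0 0 \<in> L" by (intro elliptic_subalgebra_closed[OF L(1)] X)
  then have X1: "M 0 (-1) 1 0 (k/w) 0 (k/w) 0 0 0 \<in> L" using w by simp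
  define m where "m = k/w"
  have m: "m \<noteq> 0" "M 0 (-1) 1 0 m 0 m 0 0 0 \<in> L" using w X1 by (simp_all add: m_def)
  let ?X = "M 0 (-1) 1 0 m 0 m 0 0 0"
  have "L \<subseteq> u11_std"
  proof
    fix Y assume Y: "Y \<in> L"
    then obtain a b c d e f g h i j where M: "Y = M a b c d e f g h i j" by (rule elliptic_subalgebra_cases[OF L(1)])
    define D where "D = lie_bracket ?X"
    have DL: "D Z \<in> L" if "Z \<in> L" for Z unfolding D_def by (intro elliptic_subalgebra_closed[OF L(1)] m that)
    note DX = bracket_imaginary_jordan[of m]
    define Z where "Z = D (D (D Y))"
    have ZL: "Z \<in> L" unfolding Z_def by (intro DL Y)
    define q where "q W = D (D W) + 4 *\<^sub>R W" for W
    have qL: "q W \<in> L" if "W \<in> L" for W unfolding q_def by (intro elliptic_subalgebra_closed[OF L(1)] DL that)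
    have qqZ: "q (q Z) = M 0 0 0 0 (256*m*m*i) (- 128*m*m*(h - j)) (- 256*m*m*i) 0 0 0"
      unfolding q_def Z_def D_def M DX M_plus M_scaleR by (simp add: M_eq_iff algebra_simps)
    have "256*m*m*i = 0 \<and> - 128*m*m*(h - j) = 0 \<and> - 256*m*m*i = 0"
      by (rule nilpotent_free_M(1)[OF L(2) qL[OF qL[OF ZL], unfolded qqZ]])
    then have ij: "i = 0" "h = j" using m(1) by auto
    have qZ: "q Z = M 0 0 0 0 (- 32*m*(a-d)) (- 32*m*(b+c)) (32*m*(a-d)) 0 0 0"
      unfolding q_def Z_def D_def M DX M_plus M_scaleR by (simp add: M_eq_iff ij algebra_simps)
    have "- 32*m*(a-d) = 0 \<and> - 32*m*(b+c) = 0 \<and> 32*m*(a-d) = 0"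
      by (rule nilpotent_free_M(1)[OF L(2) qL[OF ZL, unfolded qZ]])
    then have ad: "a = d" "b = - c" using m(1) by auto
    have Z: "Z = M 0 0 0 0 (8*f) (- 4*(e-g)) (- 8*f) 0 0 0"
      unfolding Z_def D_def M DX by (simp add: M_eq_iff ij ad algebra_simps)
    have "8*f = 0 \<and> - 4*(e-g) = 0 \<and> - 8*f = 0"
      by (rule nilpotent_free_M(1)[OF L(2) ZL[unfolded Z]])
    then have "f = 0" "e = g" by auto
    then have "Y = M d (- c) c d g 0 g j 0 j" by (simp add: M ij ad)
    then show "Y \<in> u11_std" unfolding u11_std_def by blast
  qed
  then show ?thesis by (rule listed_u11)
qed

text \<open>Jordan decomposition X = wI + N with I^2 = -1 and N^2 = 0, both parts in sp(V). A vector
  with Omega(v, Nv) nonzero generates the basis.\<close>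

lemma listed_imaginary_double:
  assumes L: "elliptic_subalgebra L" "nilpotent_free L" and X: "X \<in> L" and w: "w \<noteq> 0"
    and CH: "\<And>v. X *v (X *v (X *v (X *v v))) = (- 2*(w*w)) *\<^sub>R (X *v (X *v v)) - (w*w*(w*w)) *\<^sub>R v"
    and ns: "X *v (X *v v0) \<noteq> (- (w*w)) *\<^sub>R v0"
  shows "listed L"
proof -
  have Xs: "X \<in> spV" using L X by (auto simp: elliptic_subalgebra_def)
  define c where "c = 1/(2*(w*w))"
  have c: "2*c*(w*w) = 1" using w by (simp add: c_def)
  \<comment> \<open>From (wI + N)^3 = -w^3 I - 3w^2 N one gets X^3 + w^2 X = -2w^2 N.\<close>
  define N where "N = (- c) *\<^sub>R (X ** X ** X + (w*w) *\<^sub>R X)"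
  define I where "I = (1/w) *\<^sub>R (X - N)"
  note lX = matrix_vector_right_distrib matrix_vector_mult_scaleR matrix_vector_mult_diff_distrib matrix_minus_vector_right
  have Nv: "N *v v = - c *\<^sub>R (X *v (X *v (X *v v)) + (w*w) *\<^sub>R (X *v v))" for v
    by (simp add: N_def scaleR_vector_mult matrix_vector_mult_add_rdistrib matrix_vector_mul_assoc matrix_mul_assoc minus_vector_mult)
  have Ns: "N \<in> spV"
    by (simp add: spV_alt Nv Omega_linear spV_Omega[OF Xs] algebra_simps)
  have Is: "I \<in> spV"
    using Ns Xs by (simp add: I_def spV_alt scaleR_vector_mult matrix_vector_mult_diff_rdistrib Omega_linear diff_divide_distrib)
  have Iv: "I *v v = (1/w) *\<^sub>R (X *v v - N *v v)" for v
    by (simp add: I_def scaleR_vector_mult matrix_vector_mult_diff_rdistrib)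
  have XN: "X *v (N *v v) = N *v (X *v v)" for v by (simp add: Nv lX)
  have NN: "N *v (N *v v) = 0" for v
    by (simp add: Nv lX CH algebra_simps vec_two_mult)
  have XX: "X *v (X *v v) = (- (w*w)) *\<^sub>R v + (2::real) *\<^sub>R (X *v (N *v v))" for v
  proof -
    have "2 *\<^sub>R (X *v (N *v v)) = (2*c*(w*w)) *\<^sub>R (X *v (X *v v) + (w*w) *\<^sub>R v)"
      by (simp add: Nv lX CH algebra_simps vec_two_mult)
    then show ?thesis using c by simp
  qed
  have II: "I *v (I *v v) = - v" for v
  proof -
    have "I *v (I *v v) = (1/(w*w)) *\<^sub>R (X *v (X *v v) - 2 *\<^sub>R (X *v (N *v v)))"
      by (simp add: Iv lX XN[symmetric] NN vec_two_mult algebra_simps)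
    then show ?thesis using w by (simp add: XX)
  qed
  have IN: "I *v (N *v v) = N *v (I *v v)" for v by (simp add: Iv lX XN NN)
  have N0: "N \<noteq> 0" using XX[of v0] ns by auto
  note oI = spV_Omega[OF Is] and oN = spV_Omega[OF Ns]
  obtain v where v: "Omega v (N *v v) \<noteq> 0" using Omega_sym_form[OF Ns N0] by blast
  define k where "k = Omega v (N *v v)"
  \<comment> \<open>Chosen to make Omega(Q1, I Q1) vanish.\<close>
  define t where "t = Omega v (I *v v) / (2*k)"
  define Q1 where "Q1 = v + t *\<^sub>R (N *v (I *v v))"
  have k: "k \<noteq> 0" using v by (simp add: k_def)
  have alt: "Omega u (N *v (I *v u)) = 0" for u
    using oN[of u "I *v u"] oI[of "N *v u" u] Omega_commute[of u "N *v (I *v u)"] IN[of u]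
      Omega_commute[of "N *v u" "I *v u"] oI[of u "N *v u"] by simp
  have NQ: "N *v Q1 = N *v v" by (simp add: Q1_def lX NN)
  have IQ: "I *v Q1 = I *v v - t *\<^sub>R (N *v v)" by (simp add: Q1_def lX IN II)
  have k1: "Omega Q1 (N *v Q1) = k" unfolding NQ by (simp add: Q1_def Omega_linear oN NN k_def)
  have q: "Omega Q1 (I *v Q1) = 0" unfolding IQ
    using k by (simp add: Q1_def Omega_linear oN oI NN II IN[symmetric] k_def[symmetric] t_def) 
  define P1 P2 Q2 where "P1 = (1/k) *\<^sub>R (N *v Q1)" and "P2 = (1/k) *\<^sub>R (N *v (I *v Q1))"
    and "Q2 = I *v Q1"
  have s: "symplectic_basis P1 P2 Q1 Q2"
    using k k1 q alt[of Q1] by (simp add: symplectic_basis_def P1_def P2_def Q2_def Omega_linear oN oI NN II IN lX)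
  have XQ: "X *v u = w *\<^sub>R (I *v u) + N *v u" for u using w by (simp add: Iv)
  have "coords P1 P2 Q1 Q2 X = M 0 (- w) w 0 k 0 k 0 0 0"
    using k k1 q alt[of Q1] symplectic_basis_sym[OF s]
    by (simp add: coords_def XQ P1_def P2_def Q2_def Omega_linear lX NN II IN oN oI)
  then show ?thesis
    using listed_frame[OF s L(1)] listed_imaginary_jordan[OF _
      nilpotent_free_pullback[OF frame_in_SpV[OF s] L(2)] _ w k]
      coords_mem[OF s L(1) X] by auto
qed

section \<open>Subalgebras on which the trace form is negative definite\<close>

lemma trace_negative_M:
  assumes "trace_negative L" "M a b c d e f g h i j \<in> L" "0 \<le> a*a + d*d + 2*b*c + e*h + 2*f*i + g*j"
  shows "a = 0 \<and> b = 0 \<and> c = 0 \<and> d = 0 \<and> e = 0 \<and> f = 0 \<and> g = 0 \<and> h = 0 \<and> i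
    = 0 \<and> j = 0"
proof (rule ccontr)
  assume "\<not> ?thesis"
  then have "M a b c d e f g h i j \<noteq> 0" unfolding M_eq_0_iff .
  then have "trace (M a b c d e f g h i j ** M a b c d e f g h i j) < 0"
    using assms(1,2) unfolding trace_negative_def by blast
  then show False using assms(3) unfolding trace_M_square by simp
qed

text \<open>The matrix is symmetric, so the trace of its square is a sum of squares.\<close>

lemma trace_negative_M_symmetric:
  assumes "trace_negative L" "M a b b d e f g e f g \<in> L"
  shows "a = 0 \<and> b = 0 \<and> d = 0 \<and> e = 0 \<and> f = 0 \<and> g = 0"
proof -
  have "0 \<le> a*a + d*d + 2*b*b + e*e + 2*f*f + g*g"
    by (simp add: mult.assoc)
  then show ?thesis using trace_negative_M[OF assms] by blast
qed

section \<open>A nilpotent block next to a rotation\<close>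

lemma elliptic_subalgebra_long_root: "elliptic_subalgebra L \<Longrightarrow> M 0 0 0 0 e 0 0 0 0 0 \<in> L
  \<Longrightarrow> e = 0"
  using elliptic_subalgebra_square[of L "- e/2" p1] axis_nonzero by (simp add: quad_basis)

lemma bracket_line:
  "lie_bracket (M 0 0 0 0 k 0 (- b) 0 0 b) (M a' b' c' d' e f g h i j) = M (k*h) (k*i - b*f) (- b*i) (- b*(g+j))
     (- 2*k*a') (b*b' - k*c') (2*b*d') 0 (b*c') (2*b*d')"
  by (simp add: M_eq_iff algebra_simps)

text \<open>The argument uses only ellipticity, so it serves for maximality as well. The weights of
  ad X are 0, +-ib and +-2ib, the first two with nilpotent parts coming from the block p1^2.\<close>

lemma line_subset:
  assumes L: "elliptic_subalgebra L" and X: "M 0 0 0 0 k 0 (- b) 0 0 b \<in> L" and kb: "k \<noteq> 0" "b \<noteq> 0"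
    and Y: "Y \<in> L"
  shows "\<exists>t. Y = M 0 0 0 0 ((k/b)*t) 0 (- t) 0 0 t"
proof -
  note cl = elliptic_subalgebra_closed[OF L]
  let ?X = "M 0 0 0 0 k 0 (- b) 0 0 b"
  obtain a' b' c' d' e f g h i j where M: "Y = M a' b' c' d' e f g h i j" using Y
    by (rule elliptic_subalgebra_cases[OF L])
  \<comment> \<open>The bracket of such an element with its rotated copy is 2(x^2 + y^2) times the
    direction of p1^2.\<close>
  have mixed0: "x = 0 \<and> y = 0" if "M 0 x 0 0 0 y 0 0 0 0 \<in> L" for x y
  proof -
    have "lie_bracket (M 0 x 0 0 0 y 0 0 0 0) ((1/b) *\<^sub>R lie_bracket ?X (M 0 x 0 0 0 y 0 0 0 0)) \<in> L"
      by (intro cl X that)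
    then have "M 0 0 0 0 (2*(x*x+y*y)) 0 0 0 0 0 \<in> L" using kb by (simp add: algebra_simps)
    then have "2*(x*x+y*y) = 0" by (rule elliptic_subalgebra_long_root[OF L])
    then have "x*x + y*y = 0" unfolding mult_eq_0_iff[of 2]
      by (rule disjE) (simp_all only: zero_neq_numeral[symmetric])
    then show ?thesis by (simp add: sum_squares_eq_zero_iff)
  qed
  define D where "D = lie_bracket ?X"
  have DL: "D Z \<in> L" if "Z \<in> L" for Z unfolding D_def by (intro cl X that)
  note DX = bracket_line[of k b]
  define Z where "Z = D (D (D Y))"
  have ZL: "Z \<in> L" unfolding Z_def by (intro DL Y)
  \<comment> \<open>D^3 kills the weight 0 space and D^2 + 4b^2 the weights +-2ib. One more factor
    D^2 + b^2 reaches the nilpotent part of the weights +-ib, giving \<open>c'\<close> and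
    \<open>i\<close> first.\<close>
  define W where "W = D (D Z) + (4*b*b) *\<^sub>R Z"
  have WL: "W \<in> L" unfolding W_def by (intro cl DL ZL)
  have W: "W = M 0 (3*b^5*f - 7*k*b^4*i) (3*b^5*i) 0 0 (- 3*b^5*b' + 7*k*b^4*c') 0 0 (- 3*b^5*c') 0"
    unfolding W_def Z_def D_def M DX M_plus M_scaleR by (simp add: M_eq_iff algebra_simps eval_nat_numeral)
  have "D (D W) + (b*b) *\<^sub>R W = M 0 (6*k*b^6*i) 0 0 0 (- 6*k*b^6*c') 0 0 0 0"
    unfolding W D_def DX M_plus M_scaleR by (simp add: M_eq_iff algebra_simps eval_nat_numeral)
  moreover have "D (D W) + (b*b) *\<^sub>R W \<in> L" by (intro cl DL WL)
  ultimately have "6*k*b^6*i = 0 \<and> - 6*k*b^6*c' = 0" using mixed0 by metis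
  then have ci: "c' = 0" "i = 0" using kb by auto
  have "M 0 (3*b^5*f) 0 0 0 (- 3*b^5*b') 0 0 0 0 \<in> L" using WL unfolding W ci by simp
  then have "3*b^5*f = 0 \<and> - 3*b^5*b' = 0" by (rule mixed0)
  then have bf: "b' = 0" "f = 0" using kb by auto
  have Z: "Z = M 0 0 0 (4*b^3*(g+j)) 0 0 (- 8*b^3*d') 0 0 (- 8*b^3*d')"
    unfolding Z_def D_def M DX ci bf by (simp add: M_eq_iff algebra_simps eval_nat_numeral)
  have "(1/(2*b)) *\<^sub>R D Z \<in> L" by (intro cl DL ZL)
  then have "M 0 0 0 (- (- 8*b^3*d')) 0 0 (4*b^3*(g+j)) 0 0 (4*b^3*(g+j)) \<in> L"
    unfolding Z D_def DX using kb by (simp add: algebra_simps eval_nat_numeral)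
  then have "4*b^3*(g+j) = 0 \<and> - 8*b^3*d' = 0" using elliptic_plane[OF L ZL[unfolded Z]] by blast
  then have gd: "d' = 0" "g = - j" using kb by auto
  have "D (D Y) \<in> L" by (intro DL Y)
  then have "M 0 0 0 0 (- 2*k*(k*h)) 0 0 0 0 0 \<in> L" unfolding D_def M DX ci bf gd by simp
  then have "- 2*k*(k*h) = 0" by (rule elliptic_subalgebra_long_root[OF L])
  then have h: "h = 0" using kb by simp
  have "D Y \<in> L" by (intro DL Y)
  then have "M 0 0 0 0 (- 2*k*a') 0 0 0 0 0 \<in> L" unfolding D_def M DX ci bf gd h by simp
  then have "- 2*k*a' = 0" by (rule elliptic_subalgebra_long_root[OF L])
  then have a: "a' = 0" using kb by simp
  have "Y - (j/b) *\<^sub>R ?X \<in> L" by (intro cl X Y)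
  then have "M 0 0 0 0 (e - (j/b)*k) 0 0 0 0 0 \<in> L" using kb by (simp add: M ci bf gd h a)
  then have "e - (j/b)*k = 0" by (rule elliptic_subalgebra_long_root[OF L])
  then show ?thesis using M ci bf gd h a by (intro exI[of _ j]) (simp add: M_eq_iff)
qed

lemma listed_line_form:
  assumes L: "elliptic_subalgebra L" and X: "M 0 0 0 0 k 0 (- b) 0 0 b \<in> L" and kb: "k \<noteq> 0" "b \<noteq> 0"
  shows "listed L"
proof -
  define m where "m = k/b"
  define t where "t = sqrt \<bar>m\<bar>"
  have m: "m \<noteq> 0" using kb by (simp add: m_def)
  then have t: "t > 0" "t * t = \<bar>m\<bar>" by (simp_all add: t_def)
  have s: "symplectic_basis (vector [t,0,0,0]) (vector [0,1,0,0]) (vector [0,0,1/t,0]) (vector [0,0,0,1])"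
    using t by (simp add: symplectic_basis_def Omega_def)
  have e: "- sgn m = 1 \<or> - sgn m = -1" using m by (auto simp: sgn_if)
  have mt: "m = sgn m * (t * t)" unfolding t(2) by (simp add: mult_sgn_abs)
  show ?thesis
  proof (rule listed_coordsI[OF s L, of "line_algebra (- sgn m)"])
    show "\<And>L. L \<subseteq> line_algebra (- sgn m) \<Longrightarrow> listed L" using listed_line e by blast
    fix Y assume "Y \<in> L"
    then obtain u where Y: "Y = M 0 0 0 0 (m*u) 0 (- u) 0 0 u" using line_subset[OF L X kb] unfolding m_def by blast
    have "m * u / (t * t) = sgn m * u" using t(1) by (subst mt) simp
    then have "coords (vector [t,0,0,0]) (vector [0,1,0,0]) (vector [0,0,1/t,0]) (vector [0,0,0,1]) Y
        = M 0 0 0 0 (- 2 * (- sgn m) * (u/2)) 0 (- 2 * (u/2)) 0 0 (2 * (u/2))"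
      using t(1) by (simp add: coords_def Y Omega_def M_eq_iff)
    then show "coords (vector [t,0,0,0]) (vector [0,1,0,0]) (vector [0,0,1/t,0]) (vector [0,0,0,1]) Y \<in> line_algebra (- sgn m)"
      unfolding line_algebra_eq by blast
  qed
qed

section \<open>Pairs of plane rotations\<close>

lemma bracket_rotations:
  "lie_bracket (M 0 0 0 0 (- a) 0 (- b) a 0 b) (M a' b' c' d' e f g h i j) = M (- a*(e+h)) (- a*i - b*f) (- b*i - a*f)
     (- b*(g+j)) (2*a*a') (b*b' + a*c') (2*b*d') (2*a*a') (a*b' + b*c') (2*b*d')"
  by (simp add: M_eq_iff algebra_simps)

lemma u2_memI: "c = - b \<Longrightarrow> h = - e \<Longrightarrow> i = - f \<Longrightarrow> j = - g
  \<Longrightarrow> M 0 b c 0 e f g h i j \<in> u2"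
  unfolding u2_eq by blast

text \<open>The weights are 0, +-2ai, +-2bi, +-(a+b)i and +-(a-b)i, where u2 carries 0 and +-(a-b)i.
  The polynomial D(D^2 + (a-b)^2) annihilates u2 and leaves a symmetric matrix, excluded by the
  trace form; the hypotheses on a and b keep its factors nonzero.\<close>

lemma rotations_generic:
  assumes L: "elliptic_subalgebra L" "trace_negative L" and X: "M 0 0 0 0 (- a) 0 (- b) a 0 b \<in> L"
    and ab: "a \<noteq> 0" "b \<noteq> 0" "a + b \<noteq> 0" "b \<noteq> 3*a" "a \<noteq> 3*b"
  shows "L \<subseteq> u2"
proof
  fix Y assume Y: "Y \<in> L"
  then obtain a' b' c' d' e f g h i j where M: "Y = M a' b' c' d' e f g h i j"
    by (rule elliptic_subalgebra_cases[OF L(1)])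
  note cl = elliptic_subalgebra_closed[OF L(1)]
  define D where "D = lie_bracket (M 0 0 0 0 (- a) 0 (- b) a 0 b)"
  have DL: "D Z \<in> L" if "Z \<in> L" for Z unfolding D_def by (intro cl X that)
  note DX = bracket_rotations[of a b]
  define W where "W = D (D (D Y)) + ((a-b)*(a-b)) *\<^sub>R D Y"
  have WL: "W \<in> L" unfolding W_def by (intro cl DL Y)
  have W: "W = M ((a+b)*(3*a-b)*a*(e+h)) (2*a*b*(a+b)*(f+i)) (2*a*b*(a+b)*(f+i)) ((a+b)*(3*b-a)*b*(g+j))
    (- (a+b)*(3*a-b)*(2*a)*a') (- 2*a*b*(a+b)*(b'+c')) (- (a+b)*(3*b-a)*(2*b)*d')
    (- (a+b)*(3*a-b)*(2*a)*a') (- 2*a*b*(a+b)*(b'+c')) (- (a+b)*(3*b-a)*(2*b)*d')"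
    unfolding W_def D_def M DX M_plus M_scaleR by (simp add: M_eq_iff algebra_simps)
  have "3*a - b \<noteq> 0" "3*b - a \<noteq> 0" using ab by auto
  then have "e + h = 0" "f + i = 0" "g + j = 0" "a' = 0" "b' + c' = 0" "d' = 0"
    using trace_negative_M_symmetric[OF L(2) WL[unfolded W]] ab by auto
  then show "Y \<in> u2" unfolding M by (simp add: u2_memI add_eq_0_iff)
qed

lemma sp_similar_two_rotations:
  assumes eh: "e * h < 0" and gj: "g * j < 0"
  shows "\<exists>a b. a*a = - (e*h) \<and> b*b = - (g*j)
    \<and> sp_similar (M 0 0 0 0 e 0 g h 0 j) (M 0 0 0 0 (- a) 0 (- b) a 0 b)"
proof -
  obtain b where b: "b*b = - (g*j)" "sp_similar (M 0 0 0 0 e 0 g h 0 j) (M 0 0 0 0 e 0 (- b) h 0 b)"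
    using sp_similar_rotate[OF gj] by blast
  obtain a where a: "a*a = - (e*h)" "sp_similar (M 0 0 0 0 (- b) 0 e b 0 h) (M 0 0 0 0 (- b) 0 (- a) b 0 a)"
    using sp_similar_rotate[OF eh] by blast
  have "sp_similar (M 0 0 0 0 e 0 g h 0 j) (M 0 0 0 0 (- a) 0 (- b) a 0 b)"
    using sp_similar_trans[OF b(2) sp_similar_trans[OF sp_similar_swap sp_similar_trans[OF a(2) sp_similar_swap]]] .
  then show ?thesis using a(1) b(1) by blast
qed

text \<open>Now ad X does not separate sl2 of the first plane from the torus. If L meets that sl2, a
  second rotation is available and a generic pair is formed; otherwise a bracket of the mixed
  components falls into it and must vanish.\<close>

lemma listed_single_rotation:
  assumes L: "elliptic_subalgebra L" "trace_negative L" and X: "M 0 0 0 0 0 0 (- b) 0 0 b \<in> L"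
    and b: "b \<noteq> 0"
  shows "listed L"
proof -
  note cl = elliptic_subalgebra_closed[OF L(1)]
  have "(1/b) *\<^sub>R M 0 0 0 0 0 0 (- b) 0 0 b \<in> L" by (intro cl X)
  then have X: "M 0 0 0 0 (- 0) 0 (- 1) 0 0 1 \<in> L" using b by simp
  define D where "D = lie_bracket (M 0 0 0 0 (- 0) 0 (- 1) 0 0 1)"
  have DL: "D Z \<in> L" if "Z \<in> L" for Z unfolding D_def by (intro cl X that)
  note DX = bracket_rotations[of 0 1]
  have form: "\<exists>a b c e f h i j. Y = M a b c 0 e f (- j) h i j \<and> M a 0 0 0 e 0 0 h 0 0 \<in> L" if Y:
    "Y \<in> L" for Y
  proof -
    obtain a b c d e f g h i j where M: "Y = M a b c d e f g h i j" using Y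
      by (rule elliptic_subalgebra_cases[OF L(1)])
    define W where "W = D (D (D Y)) + D Y"
    have WL: "W \<in> L" unfolding W_def by (intro cl DL Y)
    have W: "W = M 0 0 0 (3*(g+j)) 0 0 (- 6*d) 0 0 (- 6*d)"
      unfolding W_def D_def M DX M_plus M_scaleR by (simp add: M_eq_iff algebra_simps)
    have dg: "d = 0" "g = - j" using trace_negative_M_symmetric[OF L(2) WL[unfolded W]] by auto
    have "Y + D (D Y) - j *\<^sub>R M 0 0 0 0 (- 0) 0 (- 1) 0 0 1 \<in> L" by (intro cl DL Y X)
    then have "M a 0 0 0 e 0 0 h 0 0 \<in> L" unfolding M D_def DX dg by simp
    then show ?thesis using M dg by blast
  qed
  show ?thesis
  proof (cases "\<exists>a e h. M a 0 0 0 e 0 0 h 0 0 \<in> L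
    \<and> (a \<noteq> 0 \<or> e \<noteq> 0 \<or> h \<noteq> 0)")
    case True
    then obtain a e h where Z: "M a 0 0 0 e 0 0 h 0 0 \<in> L" "a \<noteq> 0 \<or> e \<noteq> 0 \<or> h \<noteq> 0"
      by blast
    have n: "a*a + e*h < 0" using trace_negative_M[OF L(2) Z(1)] Z(2) by (auto simp: not_less[symmetric])
    \<comment> \<open>The factor 2 puts the frequencies in ratio 2, away from the exceptional ratios
      1 and 3.\<close>
    define t where "t = 2 * sqrt (- (a*a + e*h))"
    have t: "t > 0" "t * t = - 4 * (a*a + e*h)" using n by (simp_all add: t_def)
    have "M a 0 0 0 e 0 0 h 0 0 + t *\<^sub>R M 0 0 0 0 (- 0) 0 (- 1) 0 0 1 \<in> L" by (intro cl X Z)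
    then have P: "M a 0 0 0 e 0 (- t) h 0 t \<in> L" by simp
    obtain g' j' where s: "sp_similar (M 0 0 0 a (- t) 0 e t 0 h) (M 0 0 0 0 (- t) 0 g' t 0 j')" "g' * j' = a*a + e*h"
      using block_companion by blast
    have "(- t) * t < 0" using t(1) by simp
    moreover have "g' * j' < 0" using s n by simp
    ultimately obtain x y where xy: "x*x = - ((- t)*t)" "y*y = - (g'*j')"
      "sp_similar (M 0 0 0 0 (- t) 0 g' t 0 j') (M 0 0 0 0 (- x) 0 (- y) x 0 y)" using sp_similar_two_rotations
        by blast
    have "sp_similar (M a 0 0 0 e 0 (- t) h 0 t) (M 0 0 0 0 (- x) 0 (- y) x 0 y)"
      using sp_similar_trans[OF sp_similar_swap sp_similar_trans[OF s(1) xy(3)]] .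
    then show ?thesis
    proof (rule listed_sp_similar[OF L(1) P])
      fix K assume K: "elliptic_subalgebra K" "trace_negative L \<Longrightarrow> trace_negative K"
        "M 0 0 0 0 (- x) 0 (- y) x 0 y \<in> K"
      have x4: "x*x = 4*(y*y)" and y: "y*y > 0" using xy t s n by simp_all
      have "x \<noteq> 0" "y \<noteq> 0" "x + y \<noteq> 0" "y \<noteq> 3*x" "x \<noteq> 3*y" using x4 y
        by (auto simp: add_eq_0_iff)
      then show "listed K" using rotations_generic[OF K(1) K(2)[OF L(2)] K(3)] listed_u2 by blast
    qed
  next
    case False
    have "L \<subseteq> u2"
    proof
      fix Y assume Y: "Y \<in> L"
      obtain a b c e f h i j where M: "Y = M a b c 0 e f (- j) h i j" "M a 0 0 0 e 0 0 h 0 0 \<in> L"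
        using form[OF Y] by blast
      have z: "a = 0" "e = 0" "h = 0" using False M(2) by blast+
      \<comment> \<open>\<open>W\<close> is the mixed part of Y, rotated. In [DW, W] the entries in
        the first plane are sums of squares up to sign.\<close>
      define W where "W = D Y"
      have WL: "W \<in> L" "lie_bracket (D W) W \<in> L" unfolding W_def by (intro cl DL Y)+
      have W: "W = M 0 (- f) (- i) 0 0 b 0 0 c 0" unfolding W_def D_def M(1) DX z by simp
      have DW: "D W = M 0 (- b) (- c) 0 0 (- f) 0 0 (- i) 0" unfolding D_def W DX by simp
      obtain a1 b1 c1 e1 f1 h1 i1 j1 where B: "lie_bracket (D W) W = M a1 b1 c1 0 e1 f1 (- j1) h1 i1 j1"
        "M a1 0 0 0 e1 0 0 h1 0 0 \<in> L" using form[OF WL(2)] by blast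
      have "e1 = 0" "h1 = 0" using False B(2) by blast+
      then have "- (f*f) = b*b" "2*(c*c) + 2*(i*i) = 0"
        using B(1)[unfolded DW, unfolded W] by (simp_all add: M_eq_iff)
      then have "b*b = 0" "f*f = 0" "c*c = 0" "i*i = 0"
        using zero_le_square[of b] zero_le_square[of f] zero_le_square[of c] zero_le_square[of i] by linarith+
      then have "b = 0" "f = 0" "c = 0" "i = 0" by simp_all
      then show "Y \<in> u2" unfolding M(1) z by (simp add: u2_memI)
    qed
    then show ?thesis by (rule listed_u2)
  qed
qed

text \<open>At ratio 3 the weight 2a coincides with b - a, so weight +-2i mixes u2 with symmetric
  matrices. D^3 + 4D still removes the weights 4 and 6, and 1 + D^2/4 shows that the torus part of
  every element lies in L.\<close>

lemma listed_resonant_rotations: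
  assumes L: "elliptic_subalgebra L" "trace_negative L" and X: "M 0 0 0 0 (- a) 0 (- (3*a)) a 0 (3*a) \<in> L"
    and a: "a \<noteq> 0"
  shows "listed L"
proof -
  note cl = elliptic_subalgebra_closed[OF L(1)]
  have "(1/a) *\<^sub>R M 0 0 0 0 (- a) 0 (- (3*a)) a 0 (3*a) \<in> L" by (intro cl X)
  then have X: "M 0 0 0 0 (- 1) 0 (- 3) 1 0 3 \<in> L" using a by simp
  define D where "D = lie_bracket (M 0 0 0 0 (- 1) 0 (- 3) 1 0 3)"
  have DL: "D Z \<in> L" if "Z \<in> L" for Z unfolding D_def by (intro cl X that)
  note DX = bracket_rotations[of 1 3]
  have form: "\<exists>a b e f h j. Y = M a b (- b) 0 e f (- j) h (- f) j
    \<and> M 0 0 0 0 ((e-h)/2) 0 (- j) (- (e-h)/2) 0 j \<in> L" if Y: "Y \<in> L" for Y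
  proof -
    obtain a b c d e f g h i j where M: "Y = M a b c d e f g h i j" using Y
      by (rule elliptic_subalgebra_cases[OF L(1)])
    define W where "W = D (D (D Y)) + 4 *\<^sub>R D Y"
    have WL: "W \<in> L" unfolding W_def by (intro cl DL Y)
    have W: "W = M 0 (24*(f+i)) (24*(f+i)) (96*(g+j)) 0 (- 24*(b+c)) (- 192*d) 0 (- 24*(b+c)) (- 192*d)"
      unfolding W_def D_def M DX M_plus M_scaleR by (simp add: M_eq_iff algebra_simps)
    have z: "d = 0" "g = - j" "c = - b" "i = - f" using trace_negative_M_symmetric[OF L(2) WL[unfolded W]] by auto
    have "Y + (1/4) *\<^sub>R D (D Y) = M 0 0 0 0 ((e-h)/2) 0 (- j) (- (e-h)/2) 0 j"
      unfolding M D_def DX z M_plus M_scaleR by (simp add: M_eq_iff) (simp add: field_simps)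
    moreover have "Y + (1/4) *\<^sub>R D (D Y) \<in> L" by (intro cl DL Y X)
    ultimately have "M 0 0 0 0 ((e-h)/2) 0 (- j) (- (e-h)/2) 0 j \<in> L" by simp
    then show ?thesis using M z by blast
  qed
  show ?thesis
  proof (cases "\<exists>e j. M 0 0 0 0 e 0 (- j) (- e) 0 j \<in> L \<and> j \<noteq> - 3 * e")
    case True
    then obtain e j where Z: "M 0 0 0 0 e 0 (- j) (- e) 0 j \<in> L" "j \<noteq> - 3 * e" by blast
    \<comment> \<open>A torus element independent of X is combined with X to the ratio 1:4, which is
      generic.\<close>
    define k where "k = j + 3*e"
    have k: "k \<noteq> 0" using Z by (simp add: k_def)
    have "(1/k) *\<^sub>R (M 0 0 0 0 e 0 (- j) (- e) 0 j + (k+e) *\<^sub>R M 0 0 0 0 (- 1) 0 (- 3) 1 0 3) \<in> L"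
      by (intro cl Z X)
    moreover have "M 0 0 0 0 e 0 (- j) (- e) 0 j + (k+e) *\<^sub>R M 0 0 0 0 (- 1) 0 (- 3) 1 0 3
      = k *\<^sub>R M 0 0 0 0 (- 1) 0 (- 4) 1 0 4"
      by (simp add: M_eq_iff k_def algebra_simps)
    ultimately have "M 0 0 0 0 (- 1) 0 (- 4) 1 0 4 \<in> L" using k by (simp del: M_scaleR M_plus)
    then show ?thesis using rotations_generic[OF L, of 1 4] listed_u2 by simp
  next
    case False
    have "L \<subseteq> u2"
    proof
      fix Y assume Y: "Y \<in> L"
      obtain a b e f h j where M: "Y = M a b (- b) 0 e f (- j) h (- f) j"
        "M 0 0 0 0 ((e-h)/2) 0 (- j) (- (e-h)/2) 0 j \<in> L" using form[OF Y] by blast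
      define q where "q = (1/2) *\<^sub>R D Y"
      define x where "x = (e+h)/2"
      have qL: "q \<in> L" "lie_bracket ((1/2) *\<^sub>R D q) q \<in> L" unfolding q_def by (intro cl DL Y)+
      have q: "q = M (- x) (- f) f 0 a b 0 a (- b) 0"
        unfolding q_def D_def M(1) DX by (simp add: M_eq_iff x_def field_simps)
      have Dq: "(1/2) *\<^sub>R D q = M (- a) (- b) b 0 (- x) (- f) 0 (- x) f 0"
        unfolding D_def q DX by (simp add: M_eq_iff)
      have B: "lie_bracket ((1/2) *\<^sub>R D q) q
        = M 0 0 0 0 (- 2*(a*a+b*b+x*x+f*f)) 0 (2*(b*b+f*f)) (2*(a*a+b*b+x*x+f*f)) 0 (- 2*(b*b+f*f))"
        unfolding Dq unfolding q by (simp add: M_eq_iff algebra_simps)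
      \<comment> \<open>The torus element [Dq/2, q] has both frequencies nonpositive, while
        proportionality to X demands T = -3S; hence q = 0.\<close>
      define S T where "S = - 2*(a*a+b*b+x*x+f*f)" and "T = - 2*(b*b+f*f)"
      have "M 0 0 0 0 S 0 (- T) (- S) 0 T \<in> L" using qL(2) unfolding B by (simp add: S_def T_def algebra_simps)
      then have "T = - 3 * S" using False by blast
      then have "a*a + x*x + (b*b + f*f) + (b*b/3 + f*f/3) = 0" by (simp add: S_def T_def field_simps)
      moreover have "a*a \<ge> 0" "x*x \<ge> 0" "b*b \<ge> 0" "f*f \<ge> 0" by simp_all
      moreover have "p = 0 \<and> q = 0 \<and> r = 0 \<and> s = 0"
        if "p + q + (r + s) + (r/3 + s/3) = 0" "p \<ge> 0" "q \<ge> 0" "r \<ge> 0" "s \<ge> 0" for p q r s :: real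
        using that by auto
      ultimately have "a*a = 0 \<and> x*x = 0 \<and> b*b = 0 \<and> f*f = 0" by blast
      then have "a = 0" "x = 0" "b = 0" "f = 0" by simp_all
      then show "Y \<in> u2" unfolding M(1) by (simp add: u2_memI x_def)
    qed
    then show ?thesis by (rule listed_u2)
  qed
qed

lemma listed_rotations:
  assumes L: "elliptic_subalgebra L" "trace_negative L" and X: "M 0 0 0 0 (- a) 0 (- b) a 0 b \<in> L"
    and ab: "a \<noteq> 0" "b \<noteq> 0" "a*a \<noteq> b*b"
  shows "listed L"
proof -
  have "a + b \<noteq> 0" using ab by (auto simp: add_eq_0_iff)
  consider "b = 3*a" | "a = 3*b" | "b \<noteq> 3*a" "a \<noteq> 3*b" by blast
  then show ?thesis
  proof cases
    case 1
    then show ?thesis using listed_resonant_rotations[OF L] X ab by simp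
  next
    case 2
    show ?thesis
      by (rule listed_sp_similar[OF L(1) X sp_similar_swap], rule listed_resonant_rotations[of _ b]) (use L ab 2 in auto)
  next
    case 3
    then show ?thesis using rotations_generic[OF L X ab(1,2)] \<open>a + b \<noteq> 0\<close> listed_u2 by blast
  qed
qed

subsection \<open>Quaternionic elements\<close>

text \<open>The expression is a real part of (A + iB)(c + is)^2, so half an angle makes it vanish;
  the witness solves A c^2 - 2Bc - A = 0 with s = 1.\<close>

lemma isotropic_angle: "\<exists>c s. (c \<noteq> 0 \<or> s \<noteq> 0) \<and> (c*c - s * s) * A - 2*c * s * B
  = (0::real)"
proof (cases "A = 0")
  case True
  then show ?thesis by (intro exI[of _ 1] exI[of _ 0]) simp
next
  case False
  define q where "q = sqrt (B*B + A*A)"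
  have q: "q * q = B*B + A*A" by (simp add: q_def)
  define c where "c = (B + q)/A"
  have c: "c * A = B + q" using False by (simp add: c_def)
  have "((c*c - 1*1) * A - 2*c*1 * B) * A = 0" using c q by algebra
  then show ?thesis using False by (intro exI[of _ c] exI[of _ 1]) simp
qed

lemma coords_linear:
  "coords P1 P2 Q1 Q2 (A + B) = coords P1 P2 Q1 Q2 A + coords P1 P2 Q1 Q2 B"
  "coords P1 P2 Q1 Q2 (r *\<^sub>R A) = r *\<^sub>R coords P1 P2 Q1 Q2 A"
  "coords P1 P2 Q1 Q2 (- A) = - coords P1 P2 Q1 Q2 A"
proof -
  show "coords P1 P2 Q1 Q2 (A + B) = coords P1 P2 Q1 Q2 A + coords P1 P2 Q1 Q2 B"
    and s: "coords P1 P2 Q1 Q2 (r *\<^sub>R A) = r *\<^sub>R coords P1 P2 Q1 Q2 A" for r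
    by (simp_all add: coords_def matrix_vector_mult_add_rdistrib scaleR_vector_mult Omega_linear)
  show "coords P1 P2 Q1 Q2 (- A) = - coords P1 P2 Q1 Q2 A" using s[of "-1"] by simp
qed

lemma u2_closed: "A \<in> u2 \<Longrightarrow> B \<in> u2 \<Longrightarrow> A + B \<in> u2" "A \<in> u2
  \<Longrightarrow> r *\<^sub>R A \<in> u2" "A \<in> u2 \<Longrightarrow> - A \<in> u2"
proof -
  show "A + B \<in> u2" if "A \<in> u2" "B \<in> u2"
  proof -
    obtain b e f g b' e' f' g' where "A = M 0 b (- b) 0 e f g (- e) (- f) (- g)"
      "B = M 0 b' (- b') 0 e' f' g' (- e') (- f') (- g')" using \<open>A \<in> u2\<close> \<open>B \<in> u2\<close>
        unfolding u2_eq by blast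
    then show ?thesis by (simp add: u2_memI)
  qed
  show s: "r *\<^sub>R A \<in> u2" if "A \<in> u2" for r
    using that unfolding u2_eq[THEN eqset_imp_iff, of A] by (auto simp: u2_memI)
  show "A \<in> u2 \<Longrightarrow> - A \<in> u2" using s[of "-1"] by simp
qed

lemma quaternion_frame_pos:
  assumes sp: "X \<in> spV" "Y \<in> spV"
    and q: "\<And>v. X *v (X *v v) = - v" "\<And>v. Y *v (Y *v v) = - v" "\<And>v. Y *v (X *v v) = - (X *v (Y *v v))"
    and u: "Omega u (X *v u) > 0" "Omega u (Y *v u) = 0" "Omega u (X *v (Y *v u)) = 0"
  shows "\<exists>P1 P2 Q1 Q2. symplectic_basis P1 P2 Q1 Q2 \<and> coords P1 P2 Q1 Q2 X \<in> u2
    \<and> coords P1 P2 Q1 Q2 Y \<in> u2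
    \<and> coords P1 P2 Q1 Q2 (X ** Y) \<in> u2"
proof -
  note o = spV_Omega[OF sp(1)] spV_Omega[OF sp(2)]
  note l = matrix_vector_mult_scaleR matrix_minus_vector_right
  define t where "t = 1 / sqrt (Omega u (X *v u))"
  define w where "w = t *\<^sub>R u"
  have "t * t * Omega u (X *v u) = 1" using u(1) by (simp add: t_def)
  then have w: "Omega w (X *v w) = 1" "Omega w (Y *v w) = 0" "Omega w (X *v (Y *v w)) = 0"
    using u by (simp_all add: w_def l Omega_linear)
  have s: "symplectic_basis (X *v w) (Y *v w) w (X *v (Y *v w))"
    by (simp add: symplectic_basis_def o q l Omega_linear w)
  have "coords (X *v w) (Y *v w) w (X *v (Y *v w)) X = M 0 0 (- 0) 0 1 0 (- 1) (- 1) (- 0) (- (- 1))"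
    "coords (X *v w) (Y *v w) w (X *v (Y *v w)) Y = M 0 0 (- 0) 0 0 1 0 (- 0) (- 1) (- 0)"
    "coords (X *v w) (Y *v w) w (X *v (Y *v w)) (X ** Y) = M 0 (- 1) (- (- 1)) 0 0 0 0 (- 0) (- 0) (- 0)"
    by (simp_all add: coords_def o q l Omega_linear w matrix_vector_mul_assoc[symmetric])
  then show ?thesis using s unfolding u2_eq by blast
qed

text \<open>A vector is needed on which the quadratic forms of Y and XY vanish. Rotating by X
  disposes of the form of Y; a rotation by Y then disposes of that of XY and preserves the zero
  already obtained. The remaining form must be nonzero, and its sign is corrected by replacing X
  with -X.\<close>

lemma quaternion_frame:
  assumes sp: "X \<in> spV" "Y \<in> spV"
    and q: "\<And>v. X *v (X *v v) = - v" "\<And>v. Y *v (Y *v v) = - v" "\<And>v. Y *v (X *v v) = - (X *v (Y *v v))"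
  shows "\<exists>P1 P2 Q1 Q2. symplectic_basis P1 P2 Q1 Q2 \<and> coords P1 P2 Q1 Q2 X \<in> u2
    \<and> coords P1 P2 Q1 Q2 Y \<in> u2
    \<and> coords P1 P2 Q1 Q2 (X ** Y) \<in> u2"
proof -
  note o = spV_Omega[OF sp(1)] spV_Omega[OF sp(2)]
  note l = matrix_vector_mult_scaleR matrix_minus_vector_right matrix_vector_right_distrib
  have nz: "c *\<^sub>R u + s *\<^sub>R (Z *v u) \<noteq> 0"
    if "\<And>v. Z *v (Z *v v) = - v" "c \<noteq> 0 \<or> s \<noteq> 0" "u \<noteq> 0" for Z :: glV and c s u
  proof
    assume z: "c *\<^sub>R u + s *\<^sub>R (Z *v u) = 0"
    then have "c *\<^sub>R (c *\<^sub>R u + s *\<^sub>R (Z *v u)) - s *\<^sub>R (Z *v (c *\<^sub>R u + s *\<^sub>R (Z *v u))) = 0" by simp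
    then have "(c*c + s * s) *\<^sub>R u = 0" unfolding l that(1) by (simp add: algebra_simps)
    then show False using that(2,3) by (simp add: sum_squares_eq_zero_iff)
  qed
  define u0 :: V where "u0 = p1"
  have u0: "u0 \<noteq> 0" using axis_nonzero by (simp add: u0_def)
  obtain c s where cs: "c \<noteq> 0 \<or> s \<noteq> 0"
    "(c*c - s * s) * Omega u0 (Y *v u0) - 2*c * s * Omega u0 (X *v (Y *v u0)) = 0"
    using isotropic_angle by blast
  define u1 where "u1 = c *\<^sub>R u0 + s *\<^sub>R (X *v u0)"
  have u1: "u1 \<noteq> 0" unfolding u1_def using nz q(1) cs(1) u0 by blast
  have Y1: "Omega u1 (Y *v u1) = 0"
    using cs(2) by (simp add: u1_def l o q Omega_linear algebra_simps)
  obtain c' s' where cs': "c' \<noteq> 0 \<or> s' \<noteq> 0"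
    "(c'*c' - s' * s') * Omega u1 (X *v (Y *v u1)) - 2*c' * s' * Omega u1 (X *v u1) = 0"
    using isotropic_angle by blast
  define u where "u = c' *\<^sub>R u1 + s' *\<^sub>R (Y *v u1)"
  have u: "u \<noteq> 0" unfolding u_def using nz q(2) cs'(1) u1 by blast
  have Yu: "Omega u (Y *v u) = 0"
    using Y1 by (simp add: u_def l o q Omega_linear algebra_simps)
  have Ku: "Omega u (X *v (Y *v u)) = 0"
    using cs'(2) Y1 by (simp add: u_def l o q Omega_linear algebra_simps)
  have "Omega u (X *v u) \<noteq> 0"
  proof
    assume z: "Omega u (X *v u) = 0"
    \<comment> \<open>If that form vanished too, u would be Omega-orthogonal to u, Xu, Yu and XYu.
      These span V: applying the conjugate quaternion to a relation multiplies u by the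
      norm.\<close>
    define S where "S = frame u (X *v u) (Y *v u) (X *v (Y *v u))"
    have Sx: "S *v x = x$1 *\<^sub>R u + x$2 *\<^sub>R (X *v u) + x$3 *\<^sub>R (Y *v u) + x$4 *\<^sub>R (X *v (Y *v u))" for x
      by (simp add: S_def frame_mult)
    have "x = 0" if "S *v x = 0" for x
    proof -
      define y where "y = S *v x"
      have "x$1 *\<^sub>R y - x$2 *\<^sub>R (X *v y) - x$3 *\<^sub>R (Y *v y) - x$4 *\<^sub>R (X *v (Y *v y))
          = (x$1*x$1 + x$2*x$2 + x$3*x$3 + x$4*x$4) *\<^sub>R u"
        by (simp add: y_def Sx l q algebra_simps)
      then have "x$1*x$1 + x$2*x$2 + x$3*x$3 + x$4*x$4 = 0" using that u by (simp add: y_def)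
      moreover have "x$1*x$1 \<ge> 0" "x$2*x$2 \<ge> 0" "x$3*x$3 \<ge> 0" "x$4*x$4 \<ge> 0" by simp_all
      ultimately have "x$1*x$1 = 0" "x$2*x$2 = 0" "x$3*x$3 = 0" "x$4*x$4 = 0" by linarith+
      then show "x = 0" by (simp add: vec_eq_iff forall_4)
    qed
    then have "invertible S" by (simp add: invertible_left_inverse matrix_left_invertible_ker)
    then have "S *v (matrix_inv S *v w) = w" for w
      using matrix_inv_mult(2)[of S] by (simp add: matrix_vector_mul_assoc)
    moreover have "Omega u (S *v x) = 0" for x by (simp add: Sx Omega_linear z Yu Ku)
    ultimately have "Omega u w = 0" for w by metis
    then show False using Omega_nondegenerate u by blast
  qed
  then consider "Omega u (X *v u) > 0" | "Omega u (X *v u) < 0" by linarith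
  then show ?thesis
  proof cases
    case 1
    then show ?thesis using quaternion_frame_pos[OF sp q _ Yu Ku] by blast
  next
    case 2
    have m: "(- X) *v v = - (X *v v)" for v by (rule minus_vector_mult)
    have "- X \<in> spV" using sp(1) by (simp add: spV_alt m Omega_linear)
    then have "\<exists>P1 P2 Q1 Q2. symplectic_basis P1 P2 Q1 Q2 \<and> coords P1 P2 Q1 Q2 (- X) \<in> u2
      \<and> coords P1 P2 Q1 Q2 Y \<in> u2
      \<and> coords P1 P2 Q1 Q2 ((- X) ** Y) \<in> u2"
      by (rule quaternion_frame_pos[of _ _ u]) (use sp(2) q Yu Ku 2 in \<open>simp_all add: m l Omega_linear\<close>)
    then obtain P1 P2 Q1 Q2 where P: "symplectic_basis P1 P2 Q1 Q2" "coords P1 P2 Q1 Q2 (- X) \<in> u2"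
      "coords P1 P2 Q1 Q2 Y \<in> u2" "coords P1 P2 Q1 Q2 ((- X) ** Y) \<in> u2" by blast
    then show ?thesis
      using u2_closed(3)[OF P(2)] u2_closed(3)[OF P(4)] by (auto simp: coords_linear matrix_minus_left)
  qed
qed

lemma scalar_square_rotations:
  assumes X: "X \<in> spV" and XX: "X ** X = m *\<^sub>R mat 1" and m: "m < 0"
  shows "\<exists>a b. sp_similar X (M 0 0 0 0 (- a) 0 (- b) a 0 b)"
proof -
  have tr: "trace (X ** X) = m * 4" unfolding XX trace_scaleR trace_mat_1 by simp
  have "X \<noteq> 0"
  proof
    assume "X = 0"
    then have "trace (X ** X) = 0" by (simp add: matrix_zero_left trace_def)
    then show False using tr m by simp
  qed
  then obtain v where v: "Omega v (X *v v) \<noteq> 0" using Omega_sym_form[OF X] by blast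
  have "X *v (X *v v) = m *\<^sub>R v" using XX by (simp add: matrix_vector_mul_assoc scaleR_vector_mult)
  then obtain c d g j where c: "c \<noteq> 0" "sp_similar X (M 0 0 0 d c 0 g (m/c) 0 j)"
    using block_form[OF X refl v] v by blast
  obtain g' j' where s: "sp_similar (M 0 0 0 d c 0 g (m/c) 0 j) (M 0 0 0 0 c 0 g' (m/c) 0 j')" "g' * j' = d*d + g*j"
    using block_companion by blast
  have "2 * (m + g' * j') = 4 * m"
    using tr sp_similar_trace_square[OF sp_similar_trans[OF c(2) s(1)]] c(1) by simp
  then have "g' * j' < 0" "c * (m/c) < 0" using m c(1) by auto
  then show ?thesis using sp_similar_two_rotations[of c "m/c" g' j'] sp_similar_trans[OF
    sp_similar_trans[OF c(2) s(1)]] by blast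
qed

text \<open>Anticommutators are scalar, so they act as an inner product. L is zero, a line, or the
  span of anticommuting X, Y and their product: two independent elements already produce the
  third.\<close>

lemma listed_quaternion:
  assumes L: "elliptic_subalgebra L" "trace_negative L"
    and sq: "\<And>Y. Y \<in> L \<Longrightarrow> \<exists>c. Y ** Y = c *\<^sub>R mat 1"
  shows "listed L"
proof (cases "\<exists>X\<in>L. X \<noteq> 0")
  case False
  have "M 0 0 0 0 0 0 0 0 0 0 = 0" by (simp add: M_eq_0_iff)
  moreover have "M 0 0 0 0 0 0 0 0 0 0 \<in> u2" by (simp add: u2_memI)
  ultimately have "0 \<in> u2" by metis
  then have "L \<subseteq> u2" using False by auto
  then show ?thesis by (rule listed_u2)
next
  case True
  note cl = elliptic_subalgebra_closed[OF L(1)]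
  have spV: "Y \<in> spV" if "Y \<in> L" for Y using that L by (auto simp: elliptic_subalgebra_def)
  have normalize: "\<exists>t. t \<noteq> 0 \<and> (t *\<^sub>R Y) ** (t *\<^sub>R Y) = - mat 1" if Y: "Y \<in> L"
    "Y \<noteq> 0" for Y
  proof -
    obtain c where c: "Y ** Y = c *\<^sub>R mat 1" using sq[OF Y(1)] by blast
    have "trace (Y ** Y) < 0" using L(2) Y by (simp add: trace_negative_def)
    then have "c < 0" unfolding c trace_scaleR trace_mat_1 by simp
    define t where "t = 1 / sqrt (- c)"
    have "t \<noteq> 0" "t * (t * c) = -1" using \<open>c < 0\<close> by (simp_all add: t_def)
    then show ?thesis by (intro exI[of _ t]) (simp add: matrix_distribs c)
  qed
  have anti: "\<exists>k. Y ** Z + Z ** Y = k *\<^sub>R mat 1" if YZ: "Y \<in> L" "Z \<in> L" for Y Z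
  proof -
    obtain a b c where "Y ** Y = a *\<^sub>R mat 1" "Z ** Z = b *\<^sub>R mat 1" "(Y + Z) ** (Y + Z)
      = c *\<^sub>R mat 1"
      using sq[OF YZ(1)] sq[OF YZ(2)] sq[OF cl(2)[OF YZ]] by blast
    then have "Y ** Z + Z ** Y = (c - a - b) *\<^sub>R mat 1"
      by (simp add: matrix_distribs algebra_simps)
    then show ?thesis by blast
  qed
  obtain X0 where X0: "X0 \<in> L" "X0 \<noteq> 0" using True by blast
  obtain t where t: "t \<noteq> 0" "(t *\<^sub>R X0) ** (t *\<^sub>R X0) = - mat 1" using normalize[OF X0] by blast
  define X where "X = t *\<^sub>R X0"
  have X: "X \<in> L" "X ** X = - mat 1" using cl(4)[OF X0(1)] t by (simp_all add: X_def)
  show ?thesis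
  proof (cases "\<forall>Z\<in>L. \<exists>r. Z = r *\<^sub>R X")
    case True
    obtain a b where "sp_similar X (M 0 0 0 0 (- a) 0 (- b) a 0 b)"
      using scalar_square_rotations[OF spV[OF X(1)], of "-1"] X(2) by auto
    then obtain S where S: "S \<in> SpV" "X ** S = S ** M 0 0 0 0 (- a) 0 (- b) a 0 b" by (auto simp: sp_similar_def)
    have "pullback S L \<subseteq> u2"
    proof
      fix Y assume "Y \<in> pullback S L"
      then obtain Z where Z: "Z \<in> L" "Z ** S = S ** Y" using pullback_memD[OF S(1)] by blast
      then obtain r where "Z = r *\<^sub>R X" using True by blast
      then have "S ** Y = S ** (r *\<^sub>R M 0 0 0 0 (- a) 0 (- b) a 0 b)"
        unfolding Z(2)[symmetric] matrix_scaleR_right S(2)[symmetric] by (simp add: matrix_scaleR_left)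
      then have "Y = r *\<^sub>R M 0 0 0 0 (- a) 0 (- b) a 0 b" using SpV_cancel(1)[OF S(1)] by metis
      then show "Y \<in> u2" by (simp add: u2_memI)
    qed
    then show ?thesis by (rule listed_pullback[OF S(1) listed_u2])
  next
    case False
    then obtain Z where Z: "Z \<in> L" "\<And>r. Z \<noteq> r *\<^sub>R X" by blast
    have ort: "\<exists>r. X ** (W + r *\<^sub>R X) = - ((W + r *\<^sub>R X) ** X)" if X: "X \<in> L" "X ** X
      = - mat 1" "W \<in> L" for W X
    proof -
      obtain k where k: "X ** W + W ** X = k *\<^sub>R mat 1" using anti[OF X(1,3)] by blast
      have "X ** (W + (k/2) *\<^sub>R X) + (W + (k/2) *\<^sub>R X) ** X
        = (X ** W + W ** X) - (k/2 + k/2) *\<^sub>R mat 1"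
        unfolding scaleR_left_distrib by (simp add: matrix_distribs X(2))
      then show ?thesis using k by (metis add_eq_0_iff field_sum_of_halves diff_self minus_equation_iff)
    qed
    obtain r where r: "X ** (Z + r *\<^sub>R X) = - ((Z + r *\<^sub>R X) ** X)" using ort[OF X Z(1)] by blast
    define Y0 where "Y0 = Z + r *\<^sub>R X"
    have Y0: "Y0 \<in> L" "Y0 \<noteq> 0" unfolding Y0_def using Z(2)[of "- r"]
      by (intro cl X Z, simp add: eq_neg_iff_add_eq_0)
    obtain t where t: "t \<noteq> 0" "(t *\<^sub>R Y0) ** (t *\<^sub>R Y0) = - mat 1" using normalize[OF Y0] by blast
    define Y where "Y = t *\<^sub>R Y0"
    have Y: "Y \<in> L" "Y ** Y = - mat 1" "Y ** X = - (X ** Y)"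
      using cl(4)[OF Y0(1)] t r by (simp_all add: Y_def Y0_def[symmetric] matrix_scaleR_left matrix_scaleR_right)
    define K where "K = X ** Y"
    have "(1/2) *\<^sub>R lie_bracket X Y \<in> L" by (intro cl X Y)
    moreover have "(1/2) *\<^sub>R lie_bracket X Y = K"
    proof -
      have "lie_bracket X Y = 2 *\<^sub>R K" unfolding lie_bracket_def Y(3) K_def scaleR_2 by simp
      then show ?thesis by simp
    qed
    ultimately have KL: "K \<in> L" by simp
    have KX: "X ** K = - (K ** X)" "Y ** K = - (K ** Y)" "K ** K = - mat 1"
    proof -
      have "K ** X = X ** (Y ** X)" by (simp add: K_def matrix_mul_assoc)
      then show "X ** K = - (K ** X)" unfolding Y(3) by (simp add: K_def matrix_minus_right)
      have "Y ** K = (Y ** X) ** Y" by (simp add: K_def matrix_mul_assoc)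
      then show YK: "Y ** K = - (K ** Y)" unfolding Y(3) by (simp add: K_def matrix_minus_left)
      have "K ** K = X ** (Y ** K)" by (simp add: K_def matrix_mul_assoc)
      also have "\<dots> = - (X ** (K ** Y))" unfolding YK by (simp add: matrix_minus_right)
      also have "K ** Y = - X" using Y(2) by (simp add: K_def matrix_mul_assoc[symmetric] matrix_minus_right)
      finally show "K ** K = - mat 1" using X(2) by (simp add: matrix_minus_right)
    qed
    have span: "\<exists>a b c. W = a *\<^sub>R X + b *\<^sub>R Y + c *\<^sub>R K" if W: "W \<in> L" for W
    proof -
      obtain a where a: "X ** (W + a *\<^sub>R X) = - ((W + a *\<^sub>R X) ** X)" using ort[OF X W] by blast
      obtain b where b: "Y ** (W + b *\<^sub>R Y) = - ((W + b *\<^sub>R Y) ** Y)" using ort[OF Y(1,2) W] by blast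
      obtain c where c: "K ** (W + c *\<^sub>R K) = - ((W + c *\<^sub>R K) ** K)" using ort[OF KL KX(3) W] by blast
      \<comment> \<open>The part of W orthogonal to X, Y and K anticommutes with X and Y, so
        commutes with K = XY; it also anticommutes with K, hence it is zero.\<close>
      define V where "V = W + a *\<^sub>R X + b *\<^sub>R Y + c *\<^sub>R K"
      have XY: "X ** Y = - (Y ** X)" "K ** X = - (X ** K)" "K ** Y = - (Y ** K)" using Y(3) KX by simp_all
      have V1: "X ** V = - (V ** X)"
      proof -
        have "X ** V = X ** (W + a *\<^sub>R X) + b *\<^sub>R (X ** Y) + c *\<^sub>R (X ** K)"
          by (simp add: V_def matrix_distribs)
        also have "\<dots> = - (V ** X)" unfolding a XY(1) KX(1) by (simp add: V_def matrix_distribs)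
        finally show ?thesis .
      qed
      have V2: "Y ** V = - (V ** Y)"
      proof -
        have "Y ** V = Y ** (W + b *\<^sub>R Y) + a *\<^sub>R (Y ** X) + c *\<^sub>R (Y ** K)"
          by (simp add: V_def matrix_distribs)
        also have "\<dots> = - (V ** Y)" unfolding b Y(3) KX(2) by (simp add: V_def matrix_distribs)
        finally show ?thesis .
      qed
      have V3: "K ** V = - (V ** K)"
      proof -
        have "K ** V = K ** (W + c *\<^sub>R K) + a *\<^sub>R (K ** X) + b *\<^sub>R (K ** Y)"
          by (simp add: V_def matrix_distribs)
        also have "\<dots> = - (V ** K)" unfolding c XY by (simp add: V_def matrix_distribs)
        finally show ?thesis .
      qed
      have "K ** V = X ** (Y ** V)" by (simp add: K_def matrix_mul_assoc)
      also have "\<dots> = - (X ** V ** Y)" unfolding V2 by (simp add: matrix_minus_right matrix_mul_assoc)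
      also have "\<dots> = V ** K" unfolding V1 by (simp add: matrix_minus_left matrix_mul_assoc K_def)
      finally have "V ** K = - (V ** K)" using V3 by simp
      then have "V ** K = 0" by (simp add: eq_neg_iff_add_eq_0 flip: scaleR_2)
      then have "V ** (K ** K) = 0" by (simp add: matrix_mul_assoc matrix_zero_left)
      then have "V = 0" using KX(3) by (simp add: matrix_minus_right)
      then have "W = (- a) *\<^sub>R X + (- b) *\<^sub>R Y + (- c) *\<^sub>R K"
        unfolding V_def by (simp add: algebra_simps eq_neg_iff_add_eq_0)
      then show ?thesis by blast
    qed
    have mv: "X *v (X *v v) = - v" "Y *v (Y *v v) = - v" "Y *v (X *v v) = - (X *v (Y *v v))" for v
      using X(2) Y(2,3) by (simp_all add: matrix_vector_mul_assoc minus_vector_mult)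
    obtain P1 P2 Q1 Q2 where P: "symplectic_basis P1 P2 Q1 Q2" "coords P1 P2 Q1 Q2 X \<in> u2"
      "coords P1 P2 Q1 Q2 Y \<in> u2"
      "coords P1 P2 Q1 Q2 K \<in> u2"
      using quaternion_frame[OF spV[OF X(1)] spV[OF Y(1)] mv] unfolding K_def by blast
    show ?thesis
    proof (rule listed_coordsI[OF P(1) L(1) listed_u2])
      fix W assume "W \<in> L"
      then obtain a b c where "W = a *\<^sub>R X + b *\<^sub>R Y + c *\<^sub>R K" using span by blast
      then show "coords P1 P2 Q1 Q2 W \<in> u2" using u2_closed P by (simp add: coords_linear)
    qed
  qed
qed

section \<open>The classification\<close>

text \<open>If X^2 has distinct real eigenvalues m and n, then u = (X^2 - n)v satisfies X^2 u = mu,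
  and Omega(u, Xu) is (m - n) times the quadratic form of G = X^3 - nX. The trace excludes G = 0, so
  \<open>block_form\<close> applies.\<close>

lemma block_exists:
  assumes Xs: "X \<in> spV" and CH: "X ** X ** (X ** X) = (m + n) *\<^sub>R (X ** X) - (m * n) *\<^sub>R mat 1"
    and tr: "trace (X ** X) = 2 * (m + n)" and mn: "m \<noteq> n" "m \<noteq> 0"
  shows "\<exists>e g h j. sp_similar X (M 0 0 0 0 e 0 g h 0 j) \<and> e * h = m \<and> g * j = n \<and> (g = 0
    \<longrightarrow> j = 0)"
proof -
  note o = spV_Omega[OF Xs]
  note lX = matrix_vector_right_distrib matrix_vector_mult_scaleR matrix_vector_mult_diff_distrib
  have X4: "X *v (X *v (X *v (X *v v))) = (m + n) *\<^sub>R (X *v (X *v v)) - (m * n) *\<^sub>R v" for v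
  proof -
    have "(X ** X ** (X ** X)) *v v = ((m + n) *\<^sub>R (X ** X) - (m * n) *\<^sub>R mat 1) *v v" using CH by simp
    then show ?thesis
      by (simp add: matrix_vector_mult_diff_rdistrib scaleR_vector_mult matrix_vector_mul_assoc[symmetric] matrix_mul_assoc)
  qed
  define G where "G = X ** X ** X - n *\<^sub>R X"
  have Gv: "G *v v = X *v (X *v (X *v v)) - n *\<^sub>R (X *v v)" for v
    by (simp add: G_def matrix_vector_mult_diff_rdistrib scaleR_vector_mult matrix_vector_mul_assoc matrix_mul_assoc)
  have Gs: "G \<in> spV" by (simp add: spV_alt Gv Omega_linear o)
  have "G \<noteq> 0"
  proof
    assume "G = 0"
    then have X3: "X *v (X *v (X *v v)) = n *\<^sub>R (X *v v)" for v using Gv[of v] by simp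
    have "m *\<^sub>R (X *v (X *v v)) = m *\<^sub>R (n *\<^sub>R v)" for v
    proof -
      have "X *v (X *v (X *v (X *v v))) = n *\<^sub>R (X *v (X *v v))" using X3 by (simp add: lX)
      then have "n *\<^sub>R (X *v (X *v v)) = (m + n) *\<^sub>R (X *v (X *v v)) - (m * n) *\<^sub>R v" using X4
        by simp
      then show ?thesis by (simp add: scaleR_left_distrib)
    qed
    then have "X *v (X *v v) = n *\<^sub>R v" for v using mn(2) scaleR_left_imp_eq by blast
    then have "(X ** X) *v v = (n *\<^sub>R mat 1) *v v" for v
      by (simp add: scaleR_vector_mult matrix_vector_mul_assoc[symmetric])
    then have "X ** X = n *\<^sub>R mat 1" by (simp add: matrix_eq)
    then have "trace (X ** X) = n * 4" by (simp only: trace_scaleR trace_mat_1)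
    then show False using tr mn by simp
  qed
  then obtain v where v: "Omega v (G *v v) \<noteq> 0" using Omega_sym_form[OF Gs] by blast
  define u where "u = X *v (X *v v) - n *\<^sub>R v"
  have XXu: "X *v (X *v u) = m *\<^sub>R u"
    by (simp add: u_def lX X4 algebra_simps)
  have "Omega u (X *v u) = (m - n) * Omega v (G *v v)"
    by (simp add: u_def Gv lX o Omega_linear X4 algebra_simps)
  then have c: "Omega u (X *v u) \<noteq> 0" using v mn by simp
  obtain d g j where b: "sp_similar X (M 0 0 0 d (Omega u (X *v u)) 0 g (m/Omega u (X *v u)) 0 j)"
    using block_form[OF Xs refl c XXu] by blast
  define k where "k = Omega u (X *v u)"
  obtain g' j' where s: "sp_similar (M 0 0 0 d k 0 g (m/k) 0 j) (M 0 0 0 0 k 0 g' (m/k) 0 j')" "g' = 0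
    \<longrightarrow> j' = 0"
    using block_companion by blast
  have sX: "sp_similar X (M 0 0 0 0 k 0 g' (m/k) 0 j')" using sp_similar_trans[OF b s(1)[unfolded k_def]]
    unfolding k_def .
  have k: "k \<noteq> 0" using c by (simp add: k_def)
  have "2 * (m + n) = 2 * (m + g' * j')" using sp_similar_trace_square[OF sX] tr k by simp
  then have "g' * j' = n" by simp
  moreover have "k * (m/k) = m" using k by simp
  ultimately show ?thesis using sX s(2) by blast
qed

lemma listed_elliptic_subalgebra:
  assumes L: "elliptic_subalgebra L"
  shows "listed L"
proof (rule ccontr)
  assume ng: "\<not> listed L"
  then have N: "nilpotent_free L" using listed_or_nilpotent_free[OF L] by blast
  have spV: "X \<in> spV" if "X \<in> L" for X using that L by (auto simp: elliptic_subalgebra_def)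
  \<comment> \<open>The second half is conditional so that one case analysis does both jobs: its
    first half establishes \<open>trace_negative L\<close>, which then releases the second.\<close>
  have main: "trace (X ** X) < 0 \<and> (trace_negative L \<longrightarrow> (\<exists>c. X ** X
    = c *\<^sub>R mat 1))" if X: "X \<in> L" "X \<noteq> 0" for X
  proof -
    define s where "s = trace (X ** X) / 2"
    have ts: "trace (X ** X) = 2 * s" by (simp add: s_def)
    obtain r where CH: "X ** X ** (X ** X) = s *\<^sub>R (X ** X) - r *\<^sub>R mat 1"
      using spV_Cayley_Hamilton[OF spV[OF X(1)]] unfolding s_def by blast
    \<comment> \<open>The squares of the eigenvalues are distinct and real, nonreal or a positive
      double root, or a nonpositive double root.\<close>
    consider "s * s > 4 * r" | "s * s \<le> 4 * r" "s > 0 \<or> s * s < 4 * r" | "s * s = 4 * r" "s \<le> 0"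
      by linarith
    then show ?thesis
    proof cases
      case 1
      define q where "q = sqrt (s * s - 4 * r)"
      have q: "q > 0" "q * q = s * s - 4 * r" using 1 by (simp_all add: q_def)
      define m n where "m = (s + q)/2" and "n = (s - q)/2"
      have mn: "m + n = s" "m * n = r" "n < m" using q by (simp_all add: m_def n_def field_simps)
      have CH1: "X ** X ** (X ** X) = (m + n) *\<^sub>R (X ** X) - (m * n) *\<^sub>R mat 1"
        and CH2: "X ** X ** (X ** X) = (n + m) *\<^sub>R (X ** X) - (n * m) *\<^sub>R mat 1"
        using CH mn by (simp_all add: add.commute mult.commute)
      have t1: "trace (X ** X) = 2 * (m + n)" "trace (X ** X) = 2 * (n + m)" using ts mn by simp_all
      have m: "m \<le> 0"
      proof (rule ccontr)
        assume "\<not> m \<le> 0"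
        then obtain e g h j where b: "sp_similar X (M 0 0 0 0 e 0 g h 0 j)" "e * h = m" "g * j = n" "g = 0
          \<longrightarrow> j = 0"
          using block_exists[OF spV[OF X(1)] CH1 t1(1)] mn by auto
        have "listed L"
          by (rule listed_sp_similar[OF L X(1) b(1)], rule listed_hyperbolic_block) (use N b mn \<open>\<not> m \<le> 0\<close> in auto)
        then show False using ng by blast
      qed
      have n: "n < 0" using m mn by simp
      then obtain e g h j where b: "sp_similar X (M 0 0 0 0 e 0 g h 0 j)" "e * h = n" "g * j = m" "g = 0
        \<longrightarrow> j = 0"
        using block_exists[OF spV[OF X(1)] CH2 t1(2)] mn by auto
      have False if trace_negative: "trace_negative L"
      proof -
        \<comment> \<open>For m = 0 the second block is zero or nilpotent, and
          \<open>block_exists\<close> has placed a nilpotent one in the entry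
          \<open>g\<close>.\<close>
        consider "m < 0" | "g = 0" "j = 0" | "g \<noteq> 0" "j = 0" using b m by (cases "m = 0") auto
        then have "listed L"
        proof cases
          case 1
          then obtain x y where xy: "x*x = - (e*h)" "y*y = - (g*j)"
            "sp_similar (M 0 0 0 0 e 0 g h 0 j) (M 0 0 0 0 (- x) 0 (- y) x 0 y)"
            using sp_similar_two_rotations b n by metis
          show ?thesis
            by (rule listed_sp_similar[OF L X(1)
              sp_similar_trans[OF b(1) xy(3)]], rule listed_rotations) (use trace_negative xy b mn n 1 in auto)
        next
          case 2
          have "sp_similar X (M 0 0 0 0 0 0 e 0 0 h)" using sp_similar_trans[OF b(1) sp_similar_swap] 2 by simp
          moreover obtain y where "y \<noteq> 0" "sp_similar (M 0 0 0 0 0 0 e 0 0 h) (M 0 0 0 0 0 0 (- y) 0 0 y)"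
            using sp_similar_rotate[of e h] b n by metis
          ultimately show ?thesis
            using listed_sp_similar[OF L X(1) sp_similar_trans] listed_single_rotation trace_negative by metis
        next
          case 3
          have "sp_similar X (M 0 0 0 0 g 0 e 0 0 h)" using sp_similar_trans[OF b(1) sp_similar_swap] 3 by simp
          moreover obtain y where "y \<noteq> 0" "sp_similar (M 0 0 0 0 g 0 e 0 0 h) (M 0 0 0 0 g 0 (- y) 0 0 y)"
            using sp_similar_rotate[of e h] b n by metis
          ultimately show ?thesis
            using listed_sp_similar[OF L X(1) sp_similar_trans] listed_line_form 3 by metis
        qed
        then show False using ng by blast
      qed
      moreover have "trace (X ** X) < 0" using t1 m n by simp
      ultimately show ?thesis by blast
    next
      case 2
      then show ?thesis using listed_complex_eigenvalues[OF L N X(1) CH] ng by blast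
    next
      case 3
      have "s \<noteq> 0"
      proof
        assume "s = 0"
        then have "X ** X ** (X ** X) = 0" using CH 3 by simp
        then show False using N X by (simp add: nilpotent_free_def)
      qed
      then have s: "s < 0" using 3 by simp
      define w where "w = sqrt (- s / 2)"
      have w: "w \<noteq> 0" "w * w = - s / 2" using s by (simp_all add: w_def)
      have r: "r = w*w*(w*w)" using 3 w by simp
      have "\<exists>c. X ** X = c *\<^sub>R mat 1"
      proof (rule ccontr)
        assume nc: "\<not> ?thesis"
        have "\<exists>v. X *v (X *v v) \<noteq> (- (w*w)) *\<^sub>R v"
        proof (rule ccontr)
          assume "\<not> ?thesis"
          then have "(X ** X) *v v = ((- (w*w)) *\<^sub>R mat 1) *v v" for v
            by (simp add: scaleR_vector_mult matrix_vector_mul_assoc[symmetric] minus_vector_mult)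
          then have "X ** X = (- (w*w)) *\<^sub>R mat 1" unfolding matrix_eq by blast
          then show False using nc by blast
        qed
        then obtain v0 where v0: "X *v (X *v v0) \<noteq> (- (w*w)) *\<^sub>R v0" by blast
        have "X *v (X *v (X *v (X *v v))) = (- 2*(w*w)) *\<^sub>R (X *v (X *v v)) - (w*w*(w*w)) *\<^sub>R v" for v
        proof -
          have "(X ** X ** (X ** X)) *v v = (s *\<^sub>R (X ** X) - r *\<^sub>R mat 1) *v v" using CH by simp
          then show ?thesis using r w(2)
            by (simp add: matrix_vector_mult_diff_rdistrib scaleR_vector_mult matrix_vector_mul_assoc[symmetric] matrix_mul_assoc)
        qed
        then have "listed L" using listed_imaginary_double[OF L N X(1) w(1) _ v0] by blast
        then show False using ng by blast
      qed
      then show ?thesis using ts s by simp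
    qed
  qed
  have trace_negative: "trace_negative L" unfolding trace_negative_def using main by blast
  have "\<exists>c. Y ** Y = c *\<^sub>R mat 1" if "Y \<in> L" for Y
  proof (cases "Y = 0")
    case True
    then show ?thesis by (intro exI[of _ 0]) (simp add: matrix_distribs)
  next
    case False
    then show ?thesis using main that trace_negative by blast
  qed
  then show False using listed_quaternion[OF L trace_negative] ng by blast
qed

section \<open>Complex rank one elements force infinite type\<close>

text \<open>The polarised k-th power of a complex linear form; outside length k the value 0 is the
  convention of \<open>sym_multilinear\<close>.\<close>

lemma power_form_sym_multilinear:
  fixes z :: "'v::real_vector \<Rightarrow> complex" and G :: "complex \<Rightarrow> 'w::real_vector"
  assumes z: "linear z" and G: "linear G"
  shows "(\<lambda>vs. if length vs = k then G (c * prod_list (map z vs)) else 0) \<in> sym_multilinear k"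
proof -
  have "linear (\<lambda>v. if length (xs @ v # ys) = k then G (c * prod_list (map z (xs @ v # ys))) else 0)"
    if "Suc (length xs + length ys) = k" for xs ys
  proof -
    have "linear (\<lambda>v. G ((c * prod_list (map z xs) * prod_list (map z ys)) * z v))"
      by (rule linearI)
        (simp_all add: linear_add[OF z] linear_scale[OF z] distrib_left linear_add[OF G] linear_scale[OF G])
    then show ?thesis using that by (simp add: mult_ac)
  qed
  moreover have "(if length vs = k then G (c * prod_list (map z vs)) else 0) =
      (if length ws = k then G (c * prod_list (map z ws)) else 0)" if "mset vs = mset ws" for vs ws
  proof -
    have "prod_list (map z vs) = prod_list (map z ws)"
      using that by (simp flip: prod_mset_prod_list add: mset_map)
    then show ?thesis using mset_eq_length[OF that] by simp
  qed
  ultimately show ?thesis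
    unfolding sym_multilinear_def mem_Collect_eq by (intro conjI allI impI) (blast, blast, simp)
qed

text \<open>The square of a nonzero complex vector is nonzero, expressed through real and imaginary
  parts.\<close>

lemma quad_eq_0:
  assumes A: "quad u u - quad v v = 0" and B: "quad u v = 0"
  shows "u = 0 \<and> v = 0"
proof -
  have sq: "a = 0" if "quad a a = 0" for a
  proof (rule ccontr)
    assume a: "a \<noteq> 0"
    then obtain w where w: "Omega a w \<noteq> 0" using Omega_nondegenerate by blast
    have "quad a a *v w = 0" using that by simp
    then show False using a w by (simp add: quad_mult flip: scaleR_2)
  qed
  have aux: "v = 0" if uv: "u \<noteq> 0" "quad u v = 0" for u v
  proof -
    obtain w where w: "Omega u w \<noteq> 0" using Omega_nondegenerate[of u] uv(1) by blast
    define r where "r = - Omega v w / Omega u w"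
    have "Omega u w *\<^sub>R v + Omega v w *\<^sub>R u = 0" using uv(2) quad_mult[of u v w] by simp
    then have "(1 / Omega u w) *\<^sub>R (Omega u w *\<^sub>R v + Omega v w *\<^sub>R u) = 0" by simp
    then have v: "v = r *\<^sub>R u" using w by (simp add: r_def scaleR_right_distrib add_eq_0_iff)
    have "quad u v = r *\<^sub>R quad u u" by (subst v) (rule quad_linear(6))
    then have "r = 0" using uv sq[of u] by auto
    then show "v = 0" using v by simp
  qed
  show ?thesis
  proof (cases "u = 0")
    case True
    then show ?thesis using A sq[of v] by (simp add: quad_linear)
  next
    case False
    then show ?thesis using aux[OF False B] A sq[of u] by (simp add: quad_linear)
  qed
qed

lemma finite_type_elliptic:
  assumes h: "subspace L" and ft: "finite_type L"
  shows "elliptic L"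
  unfolding elliptic_def
proof (intro allI impI, rule ccontr)
  fix u v assume uv: "quad u u - quad v v \<in> L \<and> quad u v \<in> L" and nz: "\<not> (u = 0 \<and> v = 0)"
  obtain k where k: "prolongation L k = {\<lambda>_. 0}" using ft by (auto simp: finite_type_def)
  define A B where "A = quad u u - quad v v" and "B = 2 *\<^sub>R quad u v"
  have AB: "A \<in> L" "B \<in> L" using uv subspace_scale[OF h] by (auto simp: A_def B_def)
  have ABnz: "A \<noteq> 0 \<or> B \<noteq> 0" using quad_eq_0[of u v] nz by (auto simp: A_def B_def)
  \<comment> \<open>With \<omega> = u + iv: z(w) is Omega(\<omega>, w), G(q) is the real part of q
    \<omega>^2 and \<open>G2 q\<close> that of 2q \<omega>. Applying G(c z^k) to one more vector
    gives \<open>G2\<close> of c z^(k+1), visibly symmetric in all arguments.\<close>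
  define z where "z w = Complex (Omega u w) (Omega v w)" for w
  have z: "linear z" by (rule linearI) (simp_all add: z_def Omega_linear complex_eq_iff)
  define G :: "complex \<Rightarrow> glV" where "G q = Re q *\<^sub>R A - Im q *\<^sub>R B" for q
  define G2 :: "complex \<Rightarrow> V" where "G2 q = (2 * Re q) *\<^sub>R u - (2 * Im q) *\<^sub>R v" for q
  have lG: "linear G" by (rule linearI) (simp_all add: G_def algebra_simps)
  have lG2: "linear G2" by (rule linearI) (simp_all add: G2_def algebra_simps)
  have Aw: "A *v w = (2 * Omega u w) *\<^sub>R u - (2 * Omega v w) *\<^sub>R v" for w
    by (simp only: A_def matrix_vector_mult_diff_rdistrib quad_mult mult_2 scaleR_left_distrib)
  have Bw: "B *v w = (2 * Omega u w) *\<^sub>R v + (2 * Omega v w) *\<^sub>R u" for w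
    by (simp add: B_def scaleR_vector_mult quad_mult scaleR_right_distrib)
  have GG: "G q *v w = G2 (q * z w)" for q w
    by (simp add: G_def G2_def matrix_vector_mult_diff_rdistrib scaleR_vector_mult Aw Bw z_def algebra_simps)
  have zero: "G (c * z w ^ k) = 0" for c w
  proof -
    define T where "T vs = (if length vs = k then G (c * prod_list (map z vs)) else 0)" for vs
    have "T \<in> sym_multilinear k"
      unfolding T_def by (rule power_form_sym_multilinear[OF z lG])
    moreover have "T vs \<in> L" for vs
      unfolding T_def G_def using AB h by (auto intro!: subspace_diff subspace_scale subspace_0)
    moreover have "(\<lambda>vs. case vs of [] \<Rightarrow> 0 | v # us \<Rightarrow> T us *v v) \<in> sym_multilinear (Suc k)"
    proof -
      have "(\<lambda>vs. case vs of [] \<Rightarrow> 0 | v # us \<Rightarrow> T us *v v)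
          = (\<lambda>vs. if length vs = Suc k then G2 (c * prod_list (map z vs)) else 0)"
        by (auto simp: fun_eq_iff T_def GG mult_ac split: list.split)
      then show ?thesis using power_form_sym_multilinear[OF z lG2] by simp
    qed
    ultimately have "T \<in> prolongation L k" by (simp add: prolongation_def)
    then have "T = (\<lambda>_. 0)" using k by blast
    then have "T (replicate k w) = 0" by simp
    then show ?thesis by (simp add: T_def prod_list_replicate)
  qed
  obtain w where w: "z w \<noteq> 0"
    using nz Omega_nondegenerate[of u] Omega_nondegenerate[of v] by (auto simp: z_def complex_eq_iff)
  \<comment> \<open>The coefficient c is free, so every complex number is reached once z(w) is
    nonzero.\<close>
  have "G q = 0" for q
    using zero[of "q / z w ^ k" w] w by simp
  from this[of 1] this[of \<i>] show False using ABnz by (simp add: G_def)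
qed


section \<open>Finite type via the first prolongation\<close>

definition trivial_prolongation :: "glV set \<Rightarrow> bool" where
  "trivial_prolongation L \<longleftrightarrow> (\<forall>t. linear t \<longrightarrow> (\<forall>v. t v \<in> L)
    \<longrightarrow> (\<forall>u v. t u *v v = t v *v u) \<longrightarrow> (\<forall>v. t v = 0))"

lemma trivial_prolongation_finite_type:
  assumes L: "trivial_prolongation L" "0 \<in> L"
  shows "finite_type L"
proof -
  have "T = (\<lambda>_. 0)" if T: "T \<in> prolongation L 1" for T
  proof -
    have T1: "T \<in> sym_multilinear 1" "\<And>vs. T vs \<in> L"
      and T2: "(\<lambda>vs. case vs of [] \<Rightarrow> 0 | v # us \<Rightarrow> T us *v v) \<in> sym_multilinear 2"
      using T by (auto simp: prolongation_def numeral_2_eq_2)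
    note D1 = T1(1)[unfolded sym_multilinear_def mem_Collect_eq]
      and D2 = T2[unfolded sym_multilinear_def mem_Collect_eq]
    have lin: "linear (\<lambda>v. T [v])" using conjunct1[OF D1, rule_format, of "[]" "[]"] by simp
    have off: "T vs = 0" if "length vs \<noteq> 1" for vs
      using conjunct2[OF conjunct2[OF D1]] that by blast
    have sym: "T [u] *v v = T [v] *v u" for u v
      using conjunct1[OF conjunct2[OF D2], rule_format, of "[v, u]" "[u, v]"] by (simp add: add_mset_commute)
    have "T [v] = 0" for v
      using L(1)[unfolded trivial_prolongation_def, rule_format, of "\<lambda>v. T [v]"] lin T1(2) sym by simp
    then have "T vs = 0" for vs
      using off[of vs] by (cases "length vs = 1") (auto simp: length_Suc_conv)
    then show ?thesis by blast
  qed
  moreover have "(\<lambda>_. 0) \<in> prolongation L 1"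
  proof -
    have "(\<lambda>vs. case vs of [] \<Rightarrow> 0 | v # us \<Rightarrow> (0::glV) *v v) = (\<lambda>_. 0)"
      by (auto split: list.split)
    then show ?thesis using L(2) by (simp add: prolongation_def sym_multilinear_def linear_zero)
  qed
  ultimately have "prolongation L 1 = {\<lambda>_. 0}" by blast
  then show ?thesis unfolding finite_type_def by blast
qed

lemma trivial_prolongation_conjugate:
  assumes S: "S \<in> SpV" and L: "trivial_prolongation L"
  shows "trivial_prolongation (conjugate S L)"
  unfolding trivial_prolongation_def
proof (intro allI impI)
  fix t v assume t: "linear t" "\<forall>v. t v \<in> conjugate S L" "\<forall>u v. t u *v v = t v *v u"
  note iv = SpV_inv_vector[OF S]
  define t' where "t' v = matrix_inv S ** t (S *v v) ** S" for v
  have "linear t'"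
    by (rule linearI) (simp_all add: t'_def matrix_vector_right_distrib matrix_vector_mult_scaleR
      linear_add[OF t(1)] linear_scale[OF t(1)] matrix_distribs)
  moreover have "t' v \<in> L" for v
  proof -
    obtain A where A: "A \<in> L" "t (S *v v) = S ** A ** matrix_inv S" using t(2) by (auto simp: conjugate_def)
    have "t' v = A"
      using conj_conj_inv[OF SpV_matrix_inv[OF S], of A] by (simp add: t'_def A matrix_inv_matrix_inv[OF S])
    then show ?thesis using A by simp
  qed
  moreover have "t' u *v v = t' v *v u" for u v
    using t(3) by (simp add: t'_def matrix_vector_mul_assoc[symmetric])
  ultimately have "t' (matrix_inv S *v v) = 0" using L unfolding trivial_prolongation_def by blast
  then have "matrix_inv S ** t v ** S = 0" by (simp add: t'_def iv)
  then show "t v = 0"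
    using conj_conj_inv[OF S, of "t v"] by (simp add: matrix_distribs)
qed

text \<open>A linear map is given by its values A, B, C, D on the basis, and symmetry amounts to the
  six vector equations for pairs of basis vectors.\<close>

lemma trivial_prolongationI:
  assumes "\<And>A B C D. A \<in> L \<Longrightarrow> B \<in> L \<Longrightarrow> C \<in> L
    \<Longrightarrow> D \<in> L \<Longrightarrow>
    A *v axis 2 1 = B *v axis 1 1 \<Longrightarrow> A *v axis 3 1 = C *v axis 1 1 \<Longrightarrow> A *v axis 4 1
      = D *v axis 1 1 \<Longrightarrow>
    B *v axis 3 1 = C *v axis 2 1 \<Longrightarrow> B *v axis 4 1 = D *v axis 2 1 \<Longrightarrow> C *v axis 4 1
      = D *v axis 3 1 \<Longrightarrow>
    A = 0 \<and> B = 0 \<and> C = 0 \<and> D = 0"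
  shows "trivial_prolongation L"
  unfolding trivial_prolongation_def
proof (intro allI impI)
  fix t :: "V \<Rightarrow> glV" and v :: V
  assume t: "linear t" "\<forall>v. t v \<in> L" "\<forall>u v. t u *v v = t v *v u"
  have z: "t (axis 1 1) = 0 \<and> t (axis 2 1) = 0 \<and> t (axis 3 1) = 0 \<and> t (axis 4 1) = 0"
    by (rule assms) (use t in auto)
  have e: "v = v$1 *\<^sub>R axis 1 1 + v$2 *\<^sub>R axis 2 1 + v$3 *\<^sub>R axis 3 1 + v$4 *\<^sub>R axis 4 1"
    by (simp add: vec_eq_iff forall_4 axis_def)
  have "t (v$1 *\<^sub>R axis 1 1 + v$2 *\<^sub>R axis 2 1 + v$3 *\<^sub>R axis 3 1 + v$4 *\<^sub>R axis 4 1) = 0"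
    using z by (simp add: linear_add[OF t(1)] linear_scale[OF t(1)])
  then show "t v = 0" unfolding e[symmetric] .
qed

lemma M_axis:
  "M a b c d e f g h i j *v axis 1 1 = vector [a, c, h, i]"
  "M a b c d e f g h i j *v axis 2 1 = vector [b, d, i, j]"
  "M a b c d e f g h i j *v axis 3 1 = vector [e, f, - a, - b]"
  "M a b c d e f g h i j *v axis 4 1 = vector [f, g, - c, - d]"
  by (simp_all add: axis_def vec_eq_iff forall_4)

lemma vector_4_eq_iff: "(vector [a, b, c, d] :: V) = vector [a', b', c', d'] \<longleftrightarrow> a = a' \<and> b
  = b' \<and> c = c' \<and> d = d'"
  by (auto simp: vec_eq_iff forall_4)

lemma trivial_prolongation_u2: "trivial_prolongation u2"
  by (rule trivial_prolongationI) (auto simp: u2_eq M_axis vector_4_eq_iff M_eq_0_iff simp del: M_vector_mult)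

lemma trivial_prolongation_gl_std: "trivial_prolongation gl_std"
  by (rule trivial_prolongationI) (auto simp: gl_std_def M_axis vector_4_eq_iff M_eq_0_iff simp del: M_vector_mult)

lemma trivial_prolongation_u11_std: "trivial_prolongation u11_std"
  by (rule trivial_prolongationI) (auto simp: u11_std_def M_axis vector_4_eq_iff M_eq_0_iff simp del: M_vector_mult)

lemma trivial_prolongation_sl24_std: "trivial_prolongation sl24_std"
  by (rule trivial_prolongationI) (auto simp: sl24_std_def M_axis vector_4_eq_iff M_eq_0_iff simp del: M_vector_mult)

text \<open>The two planes are exchanged against \<open>cartan_sum\<close>, as in
  \<open>listed_mixed\<close>.\<close>

definition cartan_std :: "glV set" where
  "cartan_std = {M t 0 0 0 0 0 (- r) 0 0 r | r t. True}"

definition D_std :: "real \<Rightarrow> glV set" where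
  "D_std k = {M a 0 0 0 0 f (k*a) 0 0 0 | a f. True}"

lemma trivial_prolongation_cartan_std: "trivial_prolongation cartan_std"
  by (rule trivial_prolongationI) (auto simp: cartan_std_def M_axis vector_4_eq_iff M_eq_0_iff simp del: M_vector_mult)

lemma trivial_prolongation_D_std: "k \<noteq> 0 \<Longrightarrow> trivial_prolongation (D_std k)"
  by (rule trivial_prolongationI) (auto simp: D_std_def M_axis vector_4_eq_iff M_eq_0_iff simp del: M_vector_mult)

lemma trivial_prolongation_line: "e \<noteq> 0 \<Longrightarrow> trivial_prolongation (line_algebra e)"
  by (rule trivial_prolongationI) (auto simp: line_algebra_eq M_axis vector_4_eq_iff M_eq_0_iff simp del: M_vector_mult)


section \<open>Maximality\<close>

text \<open>Elliptic subalgebras include those of finite type, so maximality is tested in a class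
  defined without prolongations.\<close>

definition maximal_elliptic :: "glV set \<Rightarrow> bool" where
  "maximal_elliptic \<gg> \<longleftrightarrow> lie_subalgebra \<gg> \<and> \<gg> \<subseteq> spV
    \<and> trivial_prolongation \<gg> \<and> (\<forall>L. elliptic_subalgebra L \<and> \<gg> \<subseteq> L
    \<longrightarrow> L \<subseteq> \<gg>)"

lemma finite_type_elliptic_subalgebra: "lie_subalgebra L \<Longrightarrow> L \<subseteq> spV
  \<Longrightarrow> finite_type L \<Longrightarrow> elliptic_subalgebra L"
  using finite_type_elliptic by (auto simp: elliptic_subalgebra_def lie_subalgebra_def)

lemma maximal_elliptic_maximal: "maximal_elliptic \<gg> \<Longrightarrow> maximal_finite_type \<gg>"
  unfolding maximal_elliptic_def maximal_finite_type_def
  using finite_type_elliptic_subalgebra trivial_prolongation_finite_type lie_closed(1) by (meson subset_antisym)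

lemma pullback_pullback_inv:
  assumes "S \<in> SpV"
  shows "pullback (matrix_inv S) (pullback S L) = L"
proof -
  have "S ** (matrix_inv S ** X ** S) ** matrix_inv S = X" for X by (rule conj_conj_inv[OF assms])
  then show ?thesis by (simp add: pullback_def matrix_inv_matrix_inv[OF assms])
qed

lemma maximal_elliptic_conjugate:
  assumes S: "S \<in> SpV" and g: "maximal_elliptic \<gg>"
  shows "maximal_elliptic (conjugate S \<gg>)"
proof -
  note Si = SpV_matrix_inv[OF S]
  note cp = conjugate_eq_pullback[OF S]
  have "L \<subseteq> conjugate S \<gg>" if L: "elliptic_subalgebra L" "conjugate S \<gg> \<subseteq> L" for L
  proof -
    have "\<gg> = pullback S (pullback (matrix_inv S) \<gg>)"
      using pullback_pullback_inv[OF Si] by (simp add: matrix_inv_matrix_inv[OF S])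
    also have "\<dots> \<subseteq> pullback S L" using L(2) unfolding cp by (auto simp: pullback_def)
    finally have "pullback S L \<subseteq> \<gg>" using g elliptic_subalgebra_pullback[OF S L(1)]
      by (auto simp: maximal_elliptic_def)
    then have "pullback (matrix_inv S) (pullback S L) \<subseteq> pullback (matrix_inv S) \<gg>"
      by (auto simp: pullback_def)
    then show ?thesis unfolding cp pullback_pullback_inv[OF S] .
  qed
  moreover have "lie_subalgebra (conjugate S \<gg>)" "conjugate S \<gg> \<subseteq> spV"
    unfolding cp using g lie_subalgebra_pullback[OF Si] pullback_subset_spV[OF Si]
      by (auto simp: maximal_elliptic_def)
  ultimately show ?thesis using trivial_prolongation_conjugate[OF S] g by (auto simp: maximal_elliptic_def)
qed

lemma coords_image:
  assumes s: "symplectic_basis P1 P2 Q1 Q2" and L: "L \<subseteq> spV"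
  shows "coords P1 P2 Q1 Q2 ` L = conjugate (matrix_inv (frame P1 P2 Q1 Q2)) L"
proof -
  let ?S = "frame P1 P2 Q1 Q2"
  have "coords P1 P2 Q1 Q2 X = matrix_inv ?S ** X ** ?S" if "X \<in> L" for X
  proof -
    have "X ** ?S = ?S ** coords P1 P2 Q1 Q2 X" using frame_coords[OF s] that L by blast
    then have "matrix_inv ?S ** (X ** ?S) = coords P1 P2 Q1 Q2 X" by (simp add: SpV_cancel[OF frame_in_SpV[OF s]])
    then show ?thesis by (simp add: matrix_mul_assoc)
  qed
  then show ?thesis
    unfolding conjugate_def matrix_inv_matrix_inv[OF frame_in_SpV[OF s]] by (intro image_cong refl)
qed

lemma param_dim:
  fixes f :: "real^4 \<Rightarrow> glV"
  assumes "linear f" "L = range f"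
  shows "dim L \<le> 4" "inj f \<Longrightarrow> dim L = 4"
  using dim_image_le[OF assms(1), of UNIV] dim_image_eq[OF assms(1), of UNIV] assms(2) by auto

lemma M_mem_std:
  "M a b c d e f g h i j \<in> u2 \<longleftrightarrow> a = 0 \<and> d = 0 \<and> c = - b \<and> h = - e \<and> i
    = - f \<and> j = - g"
  "M a b c d e f g h i j \<in> gl_std \<longleftrightarrow> e = 0 \<and> f = 0 \<and> g = 0 \<and> h = 0 \<and> i
    = 0 \<and> j = 0"
  "M a b c d e f g h i j \<in> u11_std \<longleftrightarrow> d = a \<and> c = - b \<and> f = 0 \<and> g = e
    \<and> i = 0 \<and> j = h"
  "M a b c d e f g h i j \<in> sl24_std \<longleftrightarrow> a = - 3 * d \<and> b = 0 \<and> c = 0 \<and> e = 0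
    \<and> h = 0 \<and> 2 * i = 9 * g \<and> j = 6 * f"
  "M a b c d e f g h i j \<in> cartan_std \<longleftrightarrow> b = 0 \<and> c = 0 \<and> d = 0 \<and> e = 0
    \<and> f = 0 \<and> h = 0 \<and> i = 0 \<and> g = - j"
  "M a b c d e f g h i j \<in> D_std k \<longleftrightarrow> b = 0 \<and> c = 0 \<and> d = 0 \<and> e = 0 \<and> g
    = k * a \<and> h = 0 \<and> i = 0 \<and> j = 0"
  "M a b c d e f g h i j \<in> line_algebra \<epsilon> \<longleftrightarrow> a = 0 \<and> b = 0 \<and> c = 0
    \<and> d = 0 \<and> e = - \<epsilon> * j \<and> f = 0 \<and> g = - j \<and> h = 0 \<and> i = 0"
proof -
  show "M a b c d e f g h i j \<in> sl24_std \<longleftrightarrow> a = - 3 * d \<and> b = 0 \<and> c = 0 \<and> e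
    = 0 \<and> h = 0 \<and> 2 * i = 9 * g \<and> j = 6 * f"
    (is "_ \<longleftrightarrow> ?R")
  proof
    assume ?R
    then have "M a b c d e f g h i j = M (3*(- d)) 0 0 (- (- d)) 0 f (2*(g/2)) 0 (9*(g/2)) (6*f)"
      by (simp add: M_eq_iff)
    then show "M a b c d e f g h i j \<in> sl24_std" unfolding sl24_std_def by blast
  qed (auto simp: sl24_std_def M_eq_iff)
  show "M a b c d e f g h i j \<in> line_algebra \<epsilon> \<longleftrightarrow> a = 0 \<and> b = 0 \<and> c = 0
    \<and> d = 0 \<and> e = - \<epsilon> * j \<and> f = 0 \<and> g = - j \<and> h = 0 \<and> i = 0"
    (is "_ \<longleftrightarrow> ?R")
  proof
    assume ?R
    then have "M a b c d e f g h i j = M 0 0 0 0 (- 2 * \<epsilon> * (j/2)) 0 (- 2 * (j/2)) 0 0 (2 * (j/2))"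
      by (simp add: M_eq_iff)
    then show "M a b c d e f g h i j \<in> line_algebra \<epsilon>" unfolding line_algebra_eq by blast
  qed (auto simp: line_algebra_eq M_eq_iff)
qed (auto simp: u2_eq gl_std_def u11_std_def cartan_std_def D_std_def M_eq_iff)

lemma std_subset_spV:
  "u2 \<subseteq> spV" "gl_std \<subseteq> spV" "u11_std \<subseteq> spV" "sl24_std \<subseteq> spV"
    "cartan_std \<subseteq> spV" "D_std k \<subseteq> spV"
  "line_algebra \<epsilon> \<subseteq> spV"
  by (auto simp: u2_eq gl_std_def u11_std_def sl24_std_def cartan_std_def D_std_def line_algebra_eq)

lemma lie_subalgebra_MI:
  assumes g: "\<gg> \<subseteq> spV" and z: "M 0 0 0 0 0 0 0 0 0 0 \<in> \<gg>"
    and add: "\<And>a b c d e f g h i j a' b' c' d' e' f' g' h' i' j'. M a b c d e f g h i j \<in> \<gg>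
      \<Longrightarrow> M a' b' c' d' e' f' g' h' i' j' \<in> \<gg> \<Longrightarrow>
      M a b c d e f g h i j + M a' b' c' d' e' f' g' h' i' j' \<in> \<gg>"
    and scale: "\<And>r a b c d e f g h i j. M a b c d e f g h i j \<in> \<gg>
      \<Longrightarrow> r *\<^sub>R M a b c d e f g h i j \<in> \<gg>"
    and br: "\<And>a b c d e f g h i j a' b' c' d' e' f' g' h' i' j'. M a b c d e f g h i j \<in> \<gg>
      \<Longrightarrow> M a' b' c' d' e' f' g' h' i' j' \<in> \<gg> \<Longrightarrow>
      lie_bracket (M a b c d e f g h i j) (M a' b' c' d' e' f' g' h' i' j') \<in> \<gg>"
  shows "lie_subalgebra \<gg>"
proof -
  have "0 \<in> \<gg>" using z M_eq_0_iff[of 0 0 0 0 0 0 0 0 0 0] by simp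
  moreover have "A + B \<in> \<gg> \<and> lie_bracket A B \<in> \<gg>" if "A \<in> \<gg>" "B \<in> \<gg>" for A B
  proof -
    obtain a b c d e f g h i j where A: "A = M a b c d e f g h i j" using g \<open>A \<in> \<gg>\<close> spV_cases
      by blast
    obtain a' b' c' d' e' f' g' h' i' j' where B: "B = M a' b' c' d' e' f' g' h' i' j'"
      using g \<open>B \<in> \<gg>\<close> spV_cases by blast
    show ?thesis using that unfolding A B by (intro conjI add br)
  qed
  moreover have "r *\<^sub>R A \<in> \<gg>" if "A \<in> \<gg>" for A r
  proof -
    obtain a b c d e f g h i j where A: "A = M a b c d e f g h i j" using g \<open>A \<in> \<gg>\<close> spV_cases
      by blast
    show ?thesis using that unfolding A by (rule scale)
  qed
  ultimately show ?thesis by (simp add: lie_subalgebra_def subspace_def)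
qed

lemma lie_subalgebra_std:
  "lie_subalgebra u2" "lie_subalgebra gl_std" "lie_subalgebra u11_std" "lie_subalgebra sl24_std"
  "lie_subalgebra cartan_std" "lie_subalgebra (D_std k)" "lie_subalgebra (line_algebra \<epsilon>)"
proof -
  show "lie_subalgebra u2"
    by (rule lie_subalgebra_MI) (simp_all add: M_mem_std std_subset_spV algebra_simps)
  show "lie_subalgebra gl_std"
    by (rule lie_subalgebra_MI) (simp_all add: M_mem_std std_subset_spV algebra_simps)
  show "lie_subalgebra u11_std"
    by (rule lie_subalgebra_MI) (simp_all add: M_mem_std std_subset_spV algebra_simps)
  show "lie_subalgebra sl24_std"
  proof (rule lie_subalgebra_MI)
    fix a b c d e f g h i j a' b' c' d' e' f' g' h' i' j'
    assume "M a b c d e f g h i j \<in> sl24_std" "M a' b' c' d' e' f' g' h' i' j' \<in> sl24_std"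
    moreover have "\<exists>x. g = 2 * x" "\<exists>x. g' = 2 * x" by (intro exI[of _ "g/2"] exI[of _ "g'/2"], simp)+
    ultimately obtain x x' where "g = 2 * x" "i = 9 * x" "a = - 3 * d" "b = 0" "c = 0" "e = 0" "h = 0" "j = 6 * f"
       "g' = 2 * x'" "i' = 9 * x'" "a' = - 3 * d'" "b' = 0" "c' = 0" "e' = 0" "h' = 0" "j' = 6 * f'"
      by (auto simp: M_mem_std)
    then show "lie_bracket (M a b c d e f g h i j) (M a' b' c' d' e' f' g' h' i' j') \<in> sl24_std"
      by (simp add: M_mem_std algebra_simps)
  qed (auto simp: M_mem_std std_subset_spV algebra_simps)
  show "lie_subalgebra cartan_std"
    by (rule lie_subalgebra_MI) (simp_all add: M_mem_std std_subset_spV algebra_simps)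
  show "lie_subalgebra (D_std k)"
    by (rule lie_subalgebra_MI) (simp_all add: M_mem_std std_subset_spV algebra_simps)
  show "lie_subalgebra (line_algebra \<epsilon>)"
    by (rule lie_subalgebra_MI) (simp_all add: M_mem_std std_subset_spV algebra_simps)
qed

section \<open>Dimensions of the models\<close>

lemma dim_u2: "dim u2 = 4"
proof (rule param_dim(2))
  let ?f = "\<lambda>x::real^4. M 0 (x$1) (- x$1) 0 (x$2) (x$3) (x$4) (- x$2) (- x$3) (- x$4)"
  show "linear ?f" by (rule linearI) (simp_all add: M_eq_iff)
  show "u2 = range ?f"
  proof
    show "u2 \<subseteq> range ?f"
    proof
      fix X assume "X \<in> u2"
      then obtain b e f g where "X = M 0 b (- b) 0 e f g (- e) (- f) (- g)" by (auto simp: u2_eq)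
      then show "X \<in> range ?f" by (intro image_eqI[of _ _ "vector [b, e, f, g]"]) simp_all
    qed
  qed (auto simp: M_mem_std)
  show "inj ?f" by (rule injI) (simp add: M_eq_iff vec_eq_iff forall_4)
qed

lemma dim_gl_std: "dim gl_std = 4"
proof (rule param_dim(2))
  let ?f = "\<lambda>x::real^4. M (x$1) (x$2) (x$3) (x$4) 0 0 0 0 0 0"
  show "linear ?f" by (rule linearI) (simp_all add: M_eq_iff)
  show "gl_std = range ?f"
  proof
    show "gl_std \<subseteq> range ?f"
    proof
      fix X assume "X \<in> gl_std"
      then obtain a b c d where "X = M a b c d 0 0 0 0 0 0" by (auto simp: gl_std_def)
      then show "X \<in> range ?f" by (intro image_eqI[of _ _ "vector [a, b, c, d]"]) simp_all
    qed
  qed (auto simp: M_mem_std)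
  show "inj ?f" by (rule injI) (simp add: M_eq_iff vec_eq_iff forall_4)
qed

lemma dim_u11_std: "dim u11_std = 4"
proof (rule param_dim(2))
  let ?f = "\<lambda>x::real^4. M (x$1) (- x$2) (x$2) (x$1) (x$3) 0 (x$3) (x$4) 0 (x$4)"
  show "linear ?f" by (rule linearI) (simp_all add: M_eq_iff)
  show "u11_std = range ?f"
  proof
    show "u11_std \<subseteq> range ?f"
    proof
      fix X assume "X \<in> u11_std"
      then obtain x y z r where "X = M x (- r) r x z 0 z y 0 y" by (auto simp: u11_std_def)
      then show "X \<in> range ?f" by (intro image_eqI[of _ _ "vector [x, r, z, y]"]) simp_all
    qed
  qed (auto simp: M_mem_std)
  show "inj ?f" by (rule injI) (simp add: M_eq_iff vec_eq_iff forall_4)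
qed

lemma dim_le_4I:
  fixes f :: "real^4 \<Rightarrow> glV"
  assumes "linear f" "L \<subseteq> range f"
  shows "dim L \<le> 4"
  using param_dim(1)[OF assms(1) refl] dim_subset[OF assms(2)] by linarith

lemma dim_std_le_4:
  "dim sl24_std \<le> 4" "dim cartan_std \<le> 4" "dim (D_std k) \<le> 4" "dim (line_algebra \<epsilon>) \<le> 4"
proof -
  let ?f = "\<lambda>x::real^4. M (3 * x$1) 0 0 (- x$1) 0 (x$2) (2 * x$3) 0 (9 * x$3) (6 * x$2)"
  show "dim sl24_std \<le> 4"
  proof (rule dim_le_4I)
    show "linear ?f" by (rule linearI) (simp_all add: M_eq_iff)
    show "sl24_std \<subseteq> range ?f"
    proof
      fix X assume "X \<in> sl24_std"
      then obtain x y z where "X = M (3*x) 0 0 (- x) 0 y (2*z) 0 (9*z) (6*y)" by (auto simp: sl24_std_def)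
      then show "X \<in> range ?f" by (intro image_eqI[of _ _ "vector [x, y, z, 0]"]) simp_all
    qed
  qed
  let ?g = "\<lambda>x::real^4. M (x$1) 0 0 0 (x$2) (x$4) (x$3) 0 0 (- x$3)"
  have lin: "linear ?g" by (rule linearI) (simp_all add: M_eq_iff)
  show "dim cartan_std \<le> 4"
  proof (rule dim_le_4I[OF lin], rule subsetI)
    fix X assume "X \<in> cartan_std"
    then obtain t r where "X = M t 0 0 0 0 0 (- r) 0 0 r" by (auto simp: cartan_std_def)
    then show "X \<in> range ?g" by (intro image_eqI[of _ _ "vector [t, 0, - r, 0]"]) simp_all
  qed
  show "dim (line_algebra \<epsilon>) \<le> 4"
  proof (rule dim_le_4I[OF lin], rule subsetI)
    fix X assume "X \<in> line_algebra \<epsilon>"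
    then obtain t where "X = M 0 0 0 0 (- 2 * \<epsilon> * t) 0 (- 2 * t) 0 0 (2 * t)" by (auto simp: line_algebra_eq)
    then show "X \<in> range ?g" by (intro image_eqI[of _ _ "vector [0, - 2 * \<epsilon> * t, - 2 * t, 0]"]) simp_all
  qed
  have lin2: "linear (\<lambda>x::real^4. M (x$1) 0 0 0 0 (x$2) (k * x$1) 0 0 0)"
    by (rule linearI) (simp_all add: M_eq_iff algebra_simps)
  show "dim (D_std k) \<le> 4"
  proof (rule dim_le_4I[OF lin2], rule subsetI)
    fix X assume "X \<in> D_std k"
    then obtain a f where "X = M a 0 0 0 0 f (k*a) 0 0 0" by (auto simp: D_std_def)
    then show "X \<in> range (\<lambda>x::real^4. M (x$1) 0 0 0 0 (x$2) (k * x$1) 0 0 0)"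
      by (intro image_eqI[of _ _ "vector [a, f, 0, 0]"]) simp_all
  qed
qed

lemma linear_conj: "linear (\<lambda>A. S ** A ** (T::glV))"
  by (rule linearI) (simp_all add: matrix_distribs)

lemma dim_conjugate_le: "dim (conjugate S \<gg>) \<le> dim \<gg>"
  unfolding conjugate_def by (rule dim_image_le[OF linear_conj])


section \<open>The listed families are single conjugacy classes\<close>

text \<open>Sp(V) acts transitively on Lagrangian splittings, since each has an adapted symplectic
  basis.\<close>

lemma gl_algebras_conj:
  assumes "\<gg> \<in> gl_algebras"
  shows "\<exists>S\<in>SpV. \<gg> = conjugate S gl_std"
proof -
  obtain Q P where g: "\<gg> = vee Q P" and Q: "lagrangian Q" and P: "lagrangian P"
    and sum: "{q + p | q p. q \<in> Q \<and> p \<in> P} = UNIV"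
    using assms by (auto simp: gl_algebras_def)
  have sQ: "subspace Q" "\<And>u v. u \<in> Q \<Longrightarrow> v \<in> Q \<Longrightarrow> Omega u v = 0"
    and sP: "subspace P" "\<And>u v. u \<in> P \<Longrightarrow> v \<in> P \<Longrightarrow> Omega u v = 0"
    using Q P by (auto simp: lagrangian_def)
  have "\<exists>p\<in>P. \<exists>q\<in>Q. v = p + q" for v
  proof -
    have "v \<in> {q + p | q p. q \<in> Q \<and> p \<in> P}" using sum by simp
    then show ?thesis using add.commute by blast
  qed
  then obtain P1 P2 Q1 Q2 where m: "P1 \<in> P" "P2 \<in> P" "Q1 \<in> Q" "Q2 \<in> Q"
    and s: "symplectic_basis P1 P2 Q1 Q2"
    using lagrangian_frame[OF sP sQ] by blast
  let ?S = "frame P1 P2 Q1 Q2"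
  let ?Q0 = "{v::V. v$1 = 0 \<and> v$2 = 0}" and ?P0 = "{v::V. v$3 = 0 \<and> v$4 = 0}"
  have SQ: "(*v) ?S ` ?Q0 = Q"
  proof
    show "(*v) ?S ` ?Q0 \<subseteq> Q"
      using m sQ(1) by (auto simp: frame_mult intro!: subspace_add subspace_scale)
    show "Q \<subseteq> (*v) ?S ` ?Q0"
    proof
      fix q assume q: "q \<in> Q"
      have "q = ?S *v vector [0, 0, - Omega P1 q, - Omega P2 q]"
        using symplectic_basis_expand[OF s, of q] sQ(2)[OF m(3) q] sQ(2)[OF m(4) q] by (simp add: frame_mult)
      then show "q \<in> (*v) ?S ` ?Q0" by (rule image_eqI) simp
    qed
  qed
  have SP: "(*v) ?S ` ?P0 = P"
  proof
    show "(*v) ?S ` ?P0 \<subseteq> P"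
      using m sP(1) by (auto simp: frame_mult intro!: subspace_add subspace_scale)
    show "P \<subseteq> (*v) ?S ` ?P0"
    proof
      fix p assume p: "p \<in> P"
      have "p = ?S *v vector [Omega Q1 p, Omega Q2 p, 0, 0]"
        using symplectic_basis_expand[OF s, of p] sP(2)[OF m(1) p] sP(2)[OF m(2) p] by (simp add: frame_mult)
      then show "p \<in> (*v) ?S ` ?P0" by (rule image_eqI) simp
    qed
  qed
  have "conjugate ?S gl_std = (\<lambda>A. ?S ** A ** matrix_inv ?S) ` span {quad q p | q p. q \<in> ?Q0
    \<and> p \<in> ?P0}"
    unfolding conjugate_def vee_std[OF refl refl, symmetric] vee_def by simp
  also have "\<dots> = span ((\<lambda>A. ?S ** A ** matrix_inv ?S) ` {quad q p | q p. q \<in> ?Q0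
    \<and> p \<in> ?P0})"
    by (rule linear_span_image[OF linear_conj, symmetric])
  also have "(\<lambda>A. ?S ** A ** matrix_inv ?S) ` {quad q p | q p. q \<in> ?Q0 \<and> p \<in> ?P0}
      = {quad (?S *v q) (?S *v p) | q p. q \<in> ?Q0 \<and> p \<in> ?P0}"
  proof -
    have "(\<lambda>A. ?S ** A ** matrix_inv ?S) ` {quad q p | q p. q \<in> ?Q0 \<and> p \<in> ?P0}
      = {?S ** quad q p ** matrix_inv ?S | q p. q \<in> ?Q0 \<and> p \<in> ?P0}" by blast
    then show ?thesis by (simp only: quad_conj[OF frame_in_SpV[OF s]])
  qed
  also have "\<dots> = {quad q p | q p. q \<in> Q \<and> p \<in> P}" unfolding SQ[symmetric] SP[symmetric] by blast
  finally show ?thesis using frame_in_SpV[OF s] unfolding g vee_def by metis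
qed

text \<open>Two symplectic identifications of the model with V differ by an element of Sp(V);
  \<open>\<psi>\<close> is the inverse of the reference identification.\<close>

lemma transport_conj:
  fixes W :: "'w::real_vector set"
  assumes iso: "symplectic_iso W \<omega> \<phi>" "symplectic_iso W \<omega> \<phi>0"
    and \<psi>: "linear \<psi>" "\<And>v. \<psi> v \<in> W" "\<And>v. \<phi>0 (\<psi> v) = v" "\<And>s. s \<in> W
      \<Longrightarrow> \<psi> (\<phi>0 s) = s"
    and X: "\<And>X s. X \<in> \<gg> \<Longrightarrow> s \<in> W \<Longrightarrow> X s \<in> W"
  shows "\<exists>S\<in>SpV. transport W \<phi> \<gg> = conjugate S (transport W \<phi>0 \<gg>)"
proof -
  have O: "Omega (\<phi> s) (\<phi> t) = \<omega> s t" "Omega (\<phi>0 s) (\<phi>0 t) = \<omega> s t" if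
    "s \<in> W" "t \<in> W" for s t
    using iso that by (auto simp: symplectic_iso_def)
  have lin: "linear \<phi>" using iso by (simp add: symplectic_iso_def)
  define S where "S = matrix (\<lambda>v. \<phi> (\<psi> v))"
  have S: "S *v v = \<phi> (\<psi> v)" for v
    using linear_compose[OF \<psi>(1) lin] by (simp add: S_def matrix_works o_def)
  have S0: "S *v (\<phi>0 s) = \<phi> s" if "s \<in> W" for s using that \<psi>(4) by (simp add: S)
  have Sp: "S \<in> SpV" unfolding SpV_def using O \<psi>(2,3) by (auto simp: S) metis
  note iv = SpV_inv_vector[OF Sp]
  have Si: "matrix_inv S *v (\<phi> s) = \<phi>0 s" if "s \<in> W" for s using S0[OF that] iv(2) by metis
  have "transport W \<phi> \<gg> = conjugate S (transport W \<phi>0 \<gg>)"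
  proof
    show "transport W \<phi> \<gg> \<subseteq> conjugate S (transport W \<phi>0 \<gg>)"
    proof
      fix A assume "A \<in> transport W \<phi> \<gg>"
      then obtain Y where Y: "Y \<in> \<gg>" "\<forall>s\<in>W. A *v \<phi> s = \<phi> (Y s)"
        by (auto simp: transport_def)
      define B where "B = matrix_inv S ** A ** S"
      have "B *v \<phi>0 s = \<phi>0 (Y s)" if "s \<in> W" for s
        using Y that X by (simp add: B_def matrix_vector_mul_assoc[symmetric] S0 Si)
      then have "B \<in> transport W \<phi>0 \<gg>" using Y(1) by (auto simp: transport_def)
      moreover have "A = S ** B ** matrix_inv S" unfolding B_def by (rule conj_conj_inv[OF Sp, symmetric])
      ultimately show "A \<in> conjugate S (transport W \<phi>0 \<gg>)" by (auto simp: conjugate_def)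
    qed
    show "conjugate S (transport W \<phi>0 \<gg>) \<subseteq> transport W \<phi> \<gg>"
    proof
      fix A assume "A \<in> conjugate S (transport W \<phi>0 \<gg>)"
      then obtain B Y where B: "A = S ** B ** matrix_inv S" "Y \<in> \<gg>" "\<forall>s\<in>W. B *v \<phi>0 s
        = \<phi>0 (Y s)"
        by (auto simp: conjugate_def transport_def)
      have "A *v \<phi> s = \<phi> (Y s)" if "s \<in> W" for s
        using B that X by (simp add: matrix_vector_mul_assoc[symmetric] S0 Si)
      then show "A \<in> transport W \<phi> \<gg>" using B(2) by (auto simp: transport_def)
    qed
  qed
  then show ?thesis using Sp by blast
qed

lemma u11_algebras_conj:
  assumes "\<gg> \<in> u11_algebras"
  shows "\<exists>S\<in>SpV. \<gg> = conjugate S u11_std"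
proof -
  obtain \<phi> where g: "\<gg> = transport UNIV \<phi> sl_plus_so" and iso: "symplectic_iso UNIV tensor_form \<phi>"
    using assms by (auto simp: u11_algebras_def)
  define \<psi> :: "V \<Rightarrow> real^2^2" where "\<psi> v = vector [vector [v$3, v$4], vector [v$1, v$2]]" for v
  have "linear \<psi>" by (rule linearI) (simp_all add: \<psi>_def vec_eq_iff forall_2)
  then show ?thesis
    unfolding g transport_u11[symmetric]
    by (intro transport_conj[OF iso u11_map_iso, of \<psi>])
      (simp_all add: \<psi>_def u11_map_def vec_eq_iff forall_2 forall_4)
qed

lemma subspace_S3: "subspace S3"
  by (auto simp: subspace_def S3_def)

text \<open>Invariance under H pairs only opposite weights, and the raising operator E ties the two
  remaining values together by -3.\<close>

lemma invariant_form_unique: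
  assumes sy: "symplectic_form_on S3 \<omega>" and inv: "sl2_invariant_on_S3 \<omega>"
  shows "\<exists>c. c \<noteq> 0 \<and> (\<forall>s\<in>S3. \<forall>t\<in>S3. \<omega> s t = c * S3_form s t)"
proof -
  have bil: "bilinear \<omega>" using sy by (simp add: symplectic_form_on_def)
  note bl = bilinear_ladd[OF bil] bilinear_radd[OF bil] bilinear_lmul[OF bil] bilinear_rmul[OF bil]
    bilinear_lneg[OF bil] bilinear_rneg[OF bil]
  define H E where "H = (vector [vector [1, 0], vector [0, -1]] :: real^2^2)"
    and "E = (vector [vector [0, 1], vector [0, 0]] :: real^2^2)"
  have HE: "H \<in> sl2" "E \<in> sl2" by (simp_all add: H_def E_def sl2_def trace_def sum_2)
  have mem: "S3_vec x y z w \<in> S3" for x y z w using S3_eq_vec by blast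
  have alt: "\<omega> s s = 0" if "s \<in> S3" for s using sy that by (simp add: symplectic_form_on_def)
  have S3_add: "S3_vec x y z w + S3_vec x' y' z' w' = S3_vec (x+x') (y+y') (z+z') (w+w')"
    and S3_scale: "r *\<^sub>R S3_vec x y z w = S3_vec (r*x) (r*y) (r*z) (r*w)" for x y z w x' y' z' w' r
    by (simp_all add: vec_eq_iff forall_2)
  define e :: "int \<Rightarrow> real^2^2^2" where "e
    = (\<lambda>n. S3_vec (of_bool (n=0)) (of_bool (n=1)) (of_bool (n=2)) (of_bool (n=3)))"
  have em: "e n \<in> S3" for n unfolding e_def by (rule mem)
  have expand: "S3_vec x y z w = x *\<^sub>R e 0 + y *\<^sub>R e 1 + z *\<^sub>R e 2 + w *\<^sub>R e 3" for x y z w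
    by (simp add: e_def S3_add S3_scale)
  have He: "S3_action H (e 0) = 3 *\<^sub>R e 0" "S3_action H (e 1) = e 1" "S3_action H (e 2)
    = (-1) *\<^sub>R e 2" "S3_action H (e 3) = (-3) *\<^sub>R e 3"
    by (simp_all add: e_def S3_action_vec[OF HE(1)] S3_scale) (simp_all add: H_def)
  have Ee: "S3_action E (e 1) = 3 *\<^sub>R e 0" "S3_action E (e 3) = e 2"
    by (simp_all add: e_def S3_action_vec[OF HE(2)] S3_scale) (simp_all add: E_def)
  have I: "\<omega> (S3_action A (e m)) (e n) + \<omega> (e m) (S3_action A (e n)) = 0" if "A \<in> sl2" for A m n
    using inv that em by (simp add: sl2_invariant_on_S3_def)
  have z: "\<omega> (e 0) (e 1) = 0" "\<omega> (e 0) (e 2) = 0" "\<omega> (e 1) (e 3) = 0" "\<omega> (e 2) (e 3) = 0"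
    using I[OF HE(1), of 0 1] I[OF HE(1), of 0 2] I[OF HE(1), of 1 3] I[OF HE(1), of 2 3] by (simp_all add: He bl)
  have skew: "\<omega> (e m) (e n) = - \<omega> (e n) (e m)" for m n
    using alt[of "e m + e n"] alt[of "e m"] alt[of "e n"] em[of m] em[of n] subspace_S3
    by (simp add: bl subspace_add)
  define c where "c = - \<omega> (e 0) (e 3)"
  have c: "\<omega> (e 0) (e 3) = - c" "\<omega> (e 1) (e 2) = 3 * c"
    using I[OF HE(2), of 1 3] by (simp_all add: c_def Ee bl)
  have v: "\<omega> (e 1) (e 0) = 0" "\<omega> (e 2) (e 0) = 0" "\<omega> (e 3) (e 1) = 0" "\<omega> (e 3) (e 2) = 0"
    "\<omega> (e 3) (e 0) = c" "\<omega> (e 2) (e 1) = - 3 * c"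
    using skew[of 1 0] skew[of 2 0] skew[of 3 1] skew[of 3 2] skew[of 3 0] skew[of 2 1] z c by simp_all
  have form: "\<omega> s t = c * S3_form s t" if st: "s \<in> S3" "t \<in> S3" for s t
  proof -
    obtain x y z' w where s: "s = S3_vec x y z' w" using st(1) S3_eq_vec by blast
    obtain x' y' z'' w' where t: "t = S3_vec x' y' z'' w'" using st(2) S3_eq_vec by blast
    have "\<omega> s t = \<omega> (x *\<^sub>R e 0 + y *\<^sub>R e 1 + z' *\<^sub>R e 2 + w *\<^sub>R e 3) (x' *\<^sub>R e 0 + y' *\<^sub>R e 1 + z'' *\<^sub>R e 2 + w' *\<^sub>R e 3)"
      unfolding s t expand ..
    also have "\<dots> = c * (w*x' - x*w' + 3*(y*z'' - z'*y'))"
      unfolding bl z c v alt[OF em] by (simp add: algebra_simps)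
    finally show ?thesis unfolding s t S3_form_vec .
  qed
  have "c \<noteq> 0"
  proof
    assume "c = 0"
    then have "\<forall>t\<in>S3. \<omega> (e 0) t = 0" using form em by simp
    then have "e 0 = 0" using sy em by (auto simp: symplectic_form_on_def)
    then have "e 0 $ 1 $ 1 $ 1 = 0" by simp
    then show False by (simp add: e_def)
  qed
  then show ?thesis using form by blast
qed

lemma S3_action_S3: "A \<in> sl2 \<Longrightarrow> s \<in> S3 \<Longrightarrow> S3_action A s \<in> S3"
  using S3_eq_vec S3_action_vec by metis

text \<open>
  A negative multiple of the invariant form is turned into a positive one by \<open>diag(1,-1)\<close>, which
  normalises the image of \<open>sl2\<close>.
\<close>
definition S3_twist :: "real^2^2^2 \<Rightarrow> real^2^2^2" where
  "S3_twist T = S3_vec (T$1$1$1) (- T$1$1$2) (T$1$2$2) (- T$2$2$2)"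

lemma S3_twist_vec: "S3_twist (S3_vec x y z w) = S3_vec x (- y) z (- w)"
  by (simp add: S3_twist_def)

lemma linear_S3_twist: "linear S3_twist"
  by (rule linearI) (simp_all add: S3_twist_def vec_eq_iff forall_2)

lemma S3_twist_S3: "s \<in> S3 \<Longrightarrow> S3_twist s \<in> S3" "s \<in> S3
  \<Longrightarrow> S3_twist (S3_twist s) = s"
  using S3_eq_vec S3_twist_vec by (metis, metis minus_minus)

lemma S3_twist_action:
  assumes "A \<in> sl2"
  shows "\<exists>B\<in>sl2. \<forall>s\<in>S3. S3_twist (S3_action A s) = S3_action B (S3_twist s)"
proof -
  let ?B = "vector [vector [A$1$1, - A$1$2], vector [- A$2$1, - A$1$1]] :: real^2^2"
  have B: "?B \<in> sl2" by (simp add: sl2_def trace_def sum_2)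
  have "S3_twist (S3_action A (S3_vec x y z w)) = S3_action ?B (S3_twist (S3_vec x y z w))" for x y z w
    by (simp add: S3_action_vec[OF assms] S3_twist_vec S3_action_vec[OF B] algebra_simps)
  then show ?thesis using B S3_eq_vec by metis
qed

lemma sl24_algebras_conj:
  assumes "\<gg> \<in> sl24_algebras"
  shows "\<exists>S\<in>SpV. \<gg> = conjugate S sl24_std"
proof -
  obtain \<phi> \<omega> where g: "\<gg> = transport S3 \<phi> (S3_action ` sl2)"
    and iso: "symplectic_iso S3 \<omega> \<phi>"
    and \<omega>: "symplectic_form_on S3 \<omega>" "sl2_invariant_on_S3 \<omega>"
    using assms by (auto simp: sl24_algebras_def)
  obtain c where c: "c \<noteq> 0" "\<And>s t. s \<in> S3 \<Longrightarrow> t \<in> S3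
    \<Longrightarrow> \<omega> s t = c * S3_form s t"
    using invariant_form_unique[OF \<omega>] by blast
  have lin: "linear \<phi>" and bij: "bij_betw \<phi> S3 UNIV"
    and O: "\<And>s t. s \<in> S3 \<Longrightarrow> t \<in> S3 \<Longrightarrow> Omega (\<phi> s) (\<phi> t)
    = \<omega> s t"
    using iso by (auto simp: symplectic_iso_def)
  define \<psi> where "\<psi> v = S3_vec (v$1) (v$4 / 3) (v$2) (v$3)" for v :: V
  have \<psi>: "linear \<psi>" by (rule linearI) (simp_all add: \<psi>_def vec_eq_iff forall_2 add_divide_distrib)
  have std: "\<exists>S\<in>SpV. transport S3 \<phi>' (S3_action ` sl2) = conjugate S sl24_std" if i:
    "symplectic_iso S3 S3_form \<phi>'" for \<phi>'
    unfolding transport_sl24[symmetric]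
  proof (rule transport_conj[OF i S3_map_iso \<psi>])
    show "\<psi> v \<in> S3" for v using S3_eq_vec by (auto simp: \<psi>_def)
    show "S3_map (\<psi> v) = v" for v by (simp add: \<psi>_def S3_map_vec vec_eq_iff forall_4)
    show "\<psi> (S3_map s) = s" if "s \<in> S3" for s using that S3_eq_vec by (auto simp: \<psi>_def S3_map_vec)
    show "X s \<in> S3" if "X \<in> S3_action ` sl2" "s \<in> S3" for X s using that S3_action_S3 by auto
  qed
  \<comment> \<open>Rescaling the identification makes the form standard up to sign; the transported
    endomorphisms do not change, as they commute with scalars.\<close>
  define r where "r = 1 / sqrt \<bar>c\<bar>"
  have r: "r \<noteq> 0" "r * r * \<bar>c\<bar> = 1" using c(1) by (simp_all add: r_def)
  have scaled: "bij_betw (\<lambda>s. r *\<^sub>R \<theta> s) S3 UNIV" if b: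
    "bij_betw \<theta> S3 UNIV" for \<theta> :: "real^2^2^2 \<Rightarrow> V"
  proof -
    have "bij (\<lambda>v::V. r *\<^sub>R v)"
      by (rule o_bij[of "\<lambda>v. (1/r) *\<^sub>R v"]) (use r in \<open>simp_all add: fun_eq_iff\<close>)
    then show ?thesis using bij_betw_trans[OF b] by (simp add: o_def)
  qed
  show ?thesis
  proof (cases "c > 0")
    case True
    define \<phi>' where "\<phi>' = (\<lambda>s. r *\<^sub>R \<phi> s)"
    have "linear \<phi>'" unfolding \<phi>'_def by (rule linear_compose_scale_right[OF lin])
    moreover have "Omega (\<phi>' s) (\<phi>' t) = S3_form s t" if "s \<in> S3" "t \<in> S3" for s t
    proof -
      have "Omega (\<phi>' s) (\<phi>' t) = (r * r * \<bar>c\<bar>) * S3_form s t"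
        using that True by (simp add: \<phi>'_def Omega_linear O c(2))
      then show ?thesis using r by simp
    qed
    ultimately have i: "symplectic_iso S3 S3_form \<phi>'"
      using scaled[OF bij] by (simp add: symplectic_iso_def \<phi>'_def)
    have "transport S3 \<phi>' (S3_action ` sl2) = \<gg>"
      using r(1) by (simp add: g transport_def \<phi>'_def matrix_vector_mult_scaleR)
    then show ?thesis using std[OF i] by simp
  next
    case False
    define \<phi>' where "\<phi>' = (\<lambda>s. r *\<^sub>R \<phi> (S3_twist s))"
    have "linear (\<lambda>s. \<phi> (S3_twist s))" using linear_compose[OF linear_S3_twist lin] by (simp add: o_def)
    then have "linear \<phi>'" unfolding \<phi>'_def by (rule linear_compose_scale_right)
    moreover have "Omega (\<phi>' s) (\<phi>' t) = S3_form s t" if "s \<in> S3" "t \<in> S3" for s t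
    proof -
      have "S3_form (S3_twist s) (S3_twist t) = - S3_form s t"
        using that by (auto simp: S3_eq_vec S3_twist_vec S3_form_vec)
      then have "Omega (\<phi>' s) (\<phi>' t) = (r * r * \<bar>c\<bar>) * S3_form s t"
        using that False by (simp add: \<phi>'_def Omega_linear O c(2) S3_twist_S3)
      then show ?thesis using r by simp
    qed
    moreover have "bij_betw S3_twist S3 S3"
      by (rule bij_betw_byWitness[of _ S3_twist]) (auto simp: S3_twist_S3)
    then have "bij_betw (\<lambda>s. \<phi> (S3_twist s)) S3 UNIV" using bij_betw_trans[OF _ bij] by (simp add: o_def)
    ultimately have i: "symplectic_iso S3 S3_form \<phi>'"
      using scaled by (simp add: symplectic_iso_def \<phi>'_def)
    have tr: "A \<in> transport S3 \<phi>' (S3_action ` sl2) \<longleftrightarrow> (\<exists>B\<in>sl2. \<forall>s\<in>S3. A *v \<phi> (S3_twist s) = \<phi> (S3_twist (S3_action B s)))" for A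
      using r(1) by (simp add: transport_def \<phi>'_def matrix_vector_mult_scaleR)
    have "transport S3 \<phi>' (S3_action ` sl2) = \<gg>"
    proof (intro set_eqI iffI)
      fix A assume "A \<in> transport S3 \<phi>' (S3_action ` sl2)"
      then obtain B where B: "B \<in> sl2" "\<forall>s\<in>S3. A *v \<phi> (S3_twist s)
        = \<phi> (S3_twist (S3_action B s))" using tr by blast
      obtain C where C: "C \<in> sl2" "\<forall>s\<in>S3. S3_twist (S3_action B s) = S3_action C (S3_twist s)"
        using S3_twist_action[OF B(1)] by blast
      have "A *v \<phi> s = \<phi> (S3_action C s)" if "s \<in> S3" for s
        using B(2) C(2) S3_twist_S3[OF that] by metis
      then show "A \<in> \<gg>" using C(1) by (auto simp: g transport_def)
    next
      fix A assume "A \<in> \<gg>"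
      then obtain B where B: "B \<in> sl2" "\<forall>s\<in>S3. A *v \<phi> s = \<phi> (S3_action B s)"
        by (auto simp: g transport_def)
      obtain C where C: "C \<in> sl2" "\<forall>s\<in>S3. S3_twist (S3_action B s) = S3_action C (S3_twist s)"
        using S3_twist_action[OF B(1)] by blast
      have "A *v \<phi> (S3_twist s) = \<phi> (S3_twist (S3_action C s))" if "s \<in> S3" for s
        using B C(2) S3_twist_S3[OF that] S3_twist_S3(2) S3_action_S3 by metis
      then show "A \<in> transport S3 \<phi>' (S3_action ` sl2)" using C(1) tr by blast
    qed
    then show ?thesis using std[OF i] by simp
  qed
qed

lemma finite_type_list_conj:
  assumes "\<gg> \<in> finite_type_list"
  shows "\<exists>S\<in>SpV. \<exists>\<kk>\<in>{u2, gl_std, u11_std, sl24_std, cartan_std, D_std 2, D_std (-2), line_algebra 1, line_algebra (-1)}.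
    \<gg> = conjugate S \<kk>"
proof -
  have id: "\<exists>S\<in>SpV. \<kk> = conjugate S \<kk>" for \<kk>
    using mat_1_in_SpV by (intro bexI[of _ "mat 1"]) simp_all
  have co: "\<exists>S\<in>SpV. coords P1 P2 Q1 Q2 ` \<kk> = conjugate S \<kk>" if "symplectic_basis P1 P2 Q1 Q2"
    "\<kk> \<subseteq> spV" for P1 P2 Q1 Q2 \<kk>
    using coords_image[OF that] SpV_matrix_inv[OF frame_in_SpV[OF that(1)]] by blast
  have cartan: "\<exists>S\<in>SpV. cartan_sum = conjugate S cartan_std"
  proof -
    have s: "symplectic_basis (vector [0,1,0,0]) (vector [1,0,0,0]) (vector [0,0,0,1]) (vector [0,0,1,0])"
      by (simp add: symplectic_basis_def Omega_def)
    have "coords (vector [0,1,0,0]) (vector [1,0,0,0]) (vector [0,0,0,1]) (vector [0,0,1,0]) (M t 0 0 0 0 0 (- r) 0 0 r)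
      = M 0 0 0 t (- r) 0 0 r 0 0" for t r by (simp add: coords_def Omega_def)
    then have "coords (vector [0,1,0,0]) (vector [1,0,0,0]) (vector [0,0,0,1]) (vector [0,0,1,0]) ` cartan_std
      = cartan_sum"
      unfolding cartan_std_def cartan_sum_eq by (auto simp: image_iff) metis+
    then show ?thesis using co[OF s std_subset_spV(5)] by simp
  qed
  have D: "\<exists>S\<in>SpV. D412 \<epsilon> = conjugate S (D_std (2 * \<epsilon>))" for \<epsilon>
  proof -
    have s: "symplectic_basis (vector [0,0,1,0]) (vector [0,1,0,0]) (vector [-1,0,0,0]) (vector [0,0,0,1])"
      by (simp add: symplectic_basis_def Omega_def)
    have c: "coords (vector [0,0,1,0]) (vector [0,1,0,0]) (vector [-1,0,0,0]) (vector [0,0,0,1]) (M a 0 0 0 0 f g 0 0 0)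
      = M (- a) 0 f 0 0 0 g 0 0 0" for a f g by (simp add: coords_def Omega_def)
    have "coords (vector [0,0,1,0]) (vector [0,1,0,0]) (vector [-1,0,0,0]) (vector [0,0,0,1]) ` D_std (2 * \<epsilon>) = D412 \<epsilon>"
    proof
      show "coords (vector [0,0,1,0]) (vector [0,1,0,0]) (vector [-1,0,0,0]) (vector [0,0,0,1]) ` D_std (2 * \<epsilon>) \<subseteq> D412 \<epsilon>"
        unfolding D_std_def D412_eq by (auto simp: c M_eq_iff)
      show "D412 \<epsilon> \<subseteq> coords (vector [0,0,1,0]) (vector [0,1,0,0]) (vector [-1,0,0,0]) (vector [0,0,0,1]) ` D_std (2 * \<epsilon>)"
      proof
        fix X assume "X \<in> D412 \<epsilon>"
        then obtain a f where X: "X = M a 0 f 0 0 0 (- 2 * \<epsilon> * a) 0 0 0" by (auto simp: D412_eq)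
        have "M (- a) 0 0 0 0 f (2 * \<epsilon> * (- a)) 0 0 0 \<in> D_std (2 * \<epsilon>)" unfolding D_std_def
          by blast
        moreover have "X = coords (vector [0,0,1,0]) (vector [0,1,0,0]) (vector [-1,0,0,0]) (vector [0,0,0,1]) (M (- a) 0 0 0 0 f (2 * \<epsilon> * (- a)) 0 0 0)"
          unfolding c X by (simp add: M_eq_iff)
        ultimately show "X \<in> coords (vector [0,0,1,0]) (vector [0,1,0,0]) (vector [-1,0,0,0]) (vector [0,0,0,1]) ` D_std (2 * \<epsilon>)"
          by (rule image_eqI[rotated])
      qed
    qed
    then show ?thesis using co[OF s std_subset_spV(6)] by metis
  qed
  consider "\<gg> = u2" | "\<gg> \<in> u11_algebras" | "\<gg> \<in> gl_algebras" | "\<gg> \<in> sl24_algebras" |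
    "\<gg> = cartan_sum"
    | "\<gg> = D412 1" | "\<gg> = D412 (-1)" | "\<gg> = line_algebra 1" | "\<gg> = line_algebra (-1)"
    using assms unfolding finite_type_list_def by blast
  then show ?thesis
  proof cases
    case 1 then show ?thesis using id[of u2] by blast
  next
    case 2 then show ?thesis using u11_algebras_conj by blast
  next
    case 3 then show ?thesis using gl_algebras_conj by blast
  next
    case 4 then show ?thesis using sl24_algebras_conj by blast
  next
    case 5 then show ?thesis using cartan by blast
  next
    case 6 then show ?thesis using D[of 1] by auto
  next
    case 7 then show ?thesis using D[of "-1"] by auto
  next
    case 8 then show ?thesis using id[of "line_algebra 1"] by blast
  next
    case 9 then show ?thesis using id[of "line_algebra (-1)"] by blast
  qed
qed

lemma finite_type_list_dim: "\<gg> \<in> finite_type_list \<Longrightarrow> dim \<gg> \<le> 4"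
proof -
  assume "\<gg> \<in> finite_type_list"
  then obtain S \<kk> where k:
    "\<kk> \<in> {u2, gl_std, u11_std, sl24_std, cartan_std, D_std 2, D_std (-2), line_algebra 1, line_algebra (-1)}"
    and g: "\<gg> = conjugate S \<kk>" using finite_type_list_conj by blast
  have "dim \<kk> \<le> 4" using k dim_u2 dim_gl_std dim_u11_std dim_std_le_4 by auto
  then show ?thesis using dim_conjugate_le[of S \<kk>] unfolding g by linarith
qed

section \<open>Maximality of each model\<close>

lemma elliptic_subalgebra_dim:
  assumes "elliptic_subalgebra L"
  shows "dim L \<le> 4"
proof -
  obtain \<gg> S where g: "\<gg> \<in> finite_type_list" "L \<subseteq> conjugate S \<gg>"
    using listed_elliptic_subalgebra[OF assms] by (auto simp: listed_def)
  show ?thesis using dim_subset[OF g(2)] dim_conjugate_le[of S \<gg>] finite_type_list_dim[OF g(1)] by linarith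
qed

text \<open>The classification bounds every elliptic subalgebra by dimension 4, so nothing lies
  strictly above.\<close>

lemma maximal_elliptic_dim_4:
  assumes g: "lie_subalgebra \<gg>" "\<gg> \<subseteq> spV" "trivial_prolongation \<gg>" and d: "dim \<gg> = 4"
  shows "maximal_elliptic \<gg>"
proof -
  have "L \<subseteq> \<gg>" if L: "elliptic_subalgebra L" "\<gg> \<subseteq> L" for L
  proof -
    have "subspace L" "subspace \<gg>" using L g by (auto simp: elliptic_subalgebra_def lie_subalgebra_def)
    then have "\<gg> = L" using subspace_dim_equal[of \<gg> L] L elliptic_subalgebra_dim d by auto
    then show ?thesis by simp
  qed
  then show ?thesis using g by (auto simp: maximal_elliptic_def)
qed

text \<open>Dimension 3 leaves room below the bound 4, but any larger algebra contains the principal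
  nilpotent and its grading element.\<close>

lemma maximal_elliptic_sl24_std: "maximal_elliptic sl24_std"
proof -
  have "L \<subseteq> sl24_std" if L: "elliptic_subalgebra L" "sl24_std \<subseteq> L" for L
    by (rule principal_graded[OF L(1)]) (use L(2) in \<open>auto simp: M_mem_std subset_iff\<close>)
  then show ?thesis using lie_subalgebra_std(4) std_subset_spV(4) trivial_prolongation_sl24_std
    by (auto simp: maximal_elliptic_def)
qed

lemma maximal_elliptic_D_std:
  assumes k: "k \<noteq> 0"
  shows "maximal_elliptic (D_std k)"
proof -
  have "L \<subseteq> D_std k" if L: "elliptic_subalgebra L" "D_std k \<subseteq> L" for L
  proof
    have "M 0 0 0 0 0 1 0 0 0 0 \<in> D_std k" "M 1 0 0 0 0 0 k 0 0 0 \<in> D_std k" by (simp_all add: M_mem_std)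
    then have N: "M 0 0 0 0 0 1 0 0 0 0 \<in> L" and A: "M 1 0 0 0 0 0 k 0 0 0 \<in> L" using L(2) by auto
    fix Y assume Y: "Y \<in> L"
    then obtain a b c d e f g h i j where M: "Y = M a b c d e f g h i j" by (rule elliptic_subalgebra_cases[OF L(1)])
    note cl = elliptic_subalgebra_closed[OF L(1)]
    note pencil = indefinite_pencil[OF L(1) N]
    have hj: "h = 0" "j = 0" using indefinite_lower[OF L(1) N] Y M by auto
    \<comment> \<open>The inner bracket brings \<open>i\<close> to the diagonal, the outer one moves
      it into the upper block, where the pencil of N decides.\<close>
    have "lie_bracket (M 1 0 0 0 0 0 k 0 0 0) (lie_bracket (M 0 0 0 0 0 1 0 0 0 0) Y) \<in> L" by (intro cl A N Y)
    then have "M 0 (- 0) 0 0 (- 4*b) (- (a+d)) (- 2*k*i) 0 0 0 \<in> L" by (simp add: M hj algebra_simps)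
    then have i: "i = 0" using pencil[of "- 4*b" "- (a+d)" "- 2*k*i"] k by simp
    have bc: "b = 0" "c = 0" using indefinite_stab[OF L(1) N] Y M hj i by auto
    have "lie_bracket (M 1 0 0 0 0 0 k 0 0 0) Y \<in> L" by (intro cl A Y)
    then have "M 0 0 0 0 (2*e) f (- 2*k*d) 0 0 0 \<in> L" by (simp add: M hj i bc algebra_simps)
    then have ed: "e = 0" "d = 0" using pencil[of "2*e" f "- 2*k*d"] k by auto
    have "Y - a *\<^sub>R M 1 0 0 0 0 0 k 0 0 0 \<in> L" by (intro cl A Y)
    then have "M 0 0 0 0 0 f (g - a*k) 0 0 0 \<in> L" by (simp add: M hj i bc ed)
    then have "g = k * a" using pencil[of 0 f "g - a*k"] by (simp add: mult.commute)
    then show "Y \<in> D_std k" by (simp add: M_mem_std M hj i bc ed)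
  qed
  then show ?thesis using lie_subalgebra_std(6) std_subset_spV(6) trivial_prolongation_D_std[OF k]
    by (auto simp: maximal_elliptic_def)
qed

lemma maximal_elliptic_line:
  assumes e: "\<epsilon> \<noteq> 0"
  shows "maximal_elliptic (line_algebra \<epsilon>)"
proof -
  have "L \<subseteq> line_algebra \<epsilon>" if L: "elliptic_subalgebra L"
    "line_algebra \<epsilon> \<subseteq> L" for L
  proof
    have "M 0 0 0 0 (- \<epsilon>) 0 (- 1) 0 0 1 \<in> line_algebra \<epsilon>" by (simp add: M_mem_std)
    then have X: "M 0 0 0 0 (- \<epsilon>) 0 (- 1) 0 0 1 \<in> L" using L(2) by auto
    fix Y assume "Y \<in> L"
    then obtain t where "Y = M 0 0 0 0 ((- \<epsilon>/1)*t) 0 (- t) 0 0 t" using line_subset[OF L(1) X] e by auto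
    then show "Y \<in> line_algebra \<epsilon>" by (simp add: M_mem_std)
  qed
  then show ?thesis using lie_subalgebra_std(7) std_subset_spV(7) trivial_prolongation_line[OF e]
    by (auto simp: maximal_elliptic_def)
qed

lemma maximal_elliptic_cartan_std: "maximal_elliptic cartan_std"
proof -
  have "L \<subseteq> cartan_std" if L: "elliptic_subalgebra L" "cartan_std \<subseteq> L" for L
  proof
    let ?H = "M 1 0 0 0 0 0 0 0 0 0" and ?R = "M 0 0 0 0 0 0 (- 1) 0 0 1"
    have "?H \<in> cartan_std" "?R \<in> cartan_std" by (simp_all add: M_mem_std)
    then have H: "?H \<in> L" and R: "?R \<in> L" using L(2) by auto
    note cl = elliptic_subalgebra_closed[OF L(1)]
    have lowest: "h = 0" if "M 0 0 0 0 0 0 0 h 0 0 \<in> L" for h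
      using elliptic_subalgebra_square[OF L(1), of "h/2" q1] that axis_nonzero by (simp add: quad_basis)
    \<comment> \<open>L is only known to be elliptic here, so nilpotent elements are not excluded
      outright. Bracketing with the rotated copy gives a sum of squares times p1^2.\<close>
    have up: "x = 0 \<and> y = 0" if xy: "M 0 x 0 0 0 y 0 0 0 0 \<in> L" for x y
    proof -
      have "lie_bracket (M 0 x 0 0 0 y 0 0 0 0) (lie_bracket ?R (M 0 x 0 0 0 y 0 0 0 0)) \<in> L" by (intro cl R xy)
      then have "M 0 0 0 0 (2*(x*x) + 2*(y*y)) 0 0 0 0 0 \<in> L" by (simp add: algebra_simps)
      then have "2*(x*x) + 2*(y*y) = 0" by (rule elliptic_subalgebra_long_root[OF L(1)])
      then have "x*x = 0 \<and> y*y = 0" using zero_le_square[of x] zero_le_square[of y] by linarith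
      then show ?thesis by simp
    qed
    have down: "x = 0 \<and> y = 0" if xy: "M 0 0 x 0 0 0 0 0 y 0 \<in> L" for x y
    proof -
      have "lie_bracket (M 0 0 x 0 0 0 0 0 y 0) (lie_bracket ?R (M 0 0 x 0 0 0 0 0 y 0)) \<in> L" by (intro cl R xy)
      then have "M 0 0 0 0 0 0 0 (- (2*(y*y)) - 2*(x*x)) 0 0 \<in> L" by (simp add: algebra_simps)
      then have "- (2*(y*y)) - 2*(x*x) = 0" by (rule lowest)
      then have "x*x = 0 \<and> y*y = 0" using zero_le_square[of x] zero_le_square[of y] by linarith
      then show ?thesis by simp
    qed
    fix Y assume Y: "Y \<in> L"
    then obtain a b c d e f g h i j where M: "Y = M a b c d e f g h i j" by (rule elliptic_subalgebra_cases[OF L(1)])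
    define U where "U = lie_bracket ?H Y"
    have UL: "U \<in> L" unfolding U_def by (intro cl H Y)
    have U: "U = M 0 b (- c) 0 (2*e) f 0 (- 2*h) (- i) 0" unfolding U_def M by (simp add: M_eq_iff)
    \<comment> \<open>D^3 - D leaves the weights 2 and -2 of the grading by H, which are of real
      rank one.\<close>
    define W where "W = lie_bracket ?H (lie_bracket ?H U) - U"
    have WL: "W \<in> L" unfolding W_def by (intro cl H UL)
    have W: "W = M 0 0 0 0 (6*e) 0 0 (- 6*h) 0 0" unfolding W_def U by (simp add: M_eq_iff)
    have "lie_bracket ?H W + 2 *\<^sub>R W \<in> L" "lie_bracket ?H W - 2 *\<^sub>R W \<in> L" by (intro cl H WL)+
    then have "M 0 0 0 0 (24*e) 0 0 0 0 0 \<in> L" "M 0 0 0 0 0 0 0 (24*h) 0 0 \<in> L" unfolding W by simp_all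
    then have eh: "e = 0" "h = 0" using elliptic_subalgebra_long_root[OF L(1), of "24*e"] lowest[of "24*h"]
      by simp_all
    have "lie_bracket ?H U + U \<in> L" "lie_bracket ?H U - U \<in> L" by (intro cl H UL)+
    then have "M 0 (2*b) 0 0 0 (2*f) 0 0 0 0 \<in> L" "M 0 0 (2*c) 0 0 0 0 0 (2*i) 0 \<in> L" unfolding U eh
      by simp_all
    then have bcfi: "b = 0" "f = 0" "c = 0" "i = 0" using up[of "2*b" "2*f"] down[of "2*c" "2*i"] by simp_all
    have "lie_bracket ?R Y = M 0 0 0 (- (g+j)) 0 0 (2*d) 0 0 (2*d)"
      "(1/2) *\<^sub>R lie_bracket ?R (lie_bracket ?R Y) = M 0 0 0 (- (2*d)) 0 0 (- (g+j)) 0 0 (- (g+j))"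
      unfolding M eh bcfi by (simp_all add: M_eq_iff)
    moreover have "lie_bracket ?R Y \<in> L" "(1/2) *\<^sub>R lie_bracket ?R (lie_bracket ?R Y) \<in> L"
      by (intro cl R Y)+
    ultimately have "M 0 0 0 (- (g+j)) 0 0 (2*d) 0 0 (2*d) \<in> L"
      "M 0 0 0 (- (2*d)) 0 0 (- (g+j)) 0 0 (- (g+j)) \<in> L"
      by metis+
    then have "- (g+j) = 0 \<and> 2*d = 0" by (rule elliptic_plane[OF L(1)])
    then show "Y \<in> cartan_std" by (simp add: M M_mem_std eh bcfi)
  qed
  then show ?thesis using lie_subalgebra_std(5) std_subset_spV(5) trivial_prolongation_cartan_std
    by (auto simp: maximal_elliptic_def)
qed

theorem theorem1:
  shows "(\<forall>\<hh>. lie_subalgebra \<hh> \<and> \<hh> \<subseteq> spV \<longrightarrow>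
            infinite_type \<hh> \<or> (\<exists>\<gg>\<in>finite_type_list. \<exists>S\<in>SpV. \<hh> \<subseteq> conjugate S \<gg>)) \<and>
         (\<forall>\<gg>\<in>finite_type_list. maximal_finite_type \<gg>) \<and>
         (\<forall>\<hh>. lie_subalgebra \<hh> \<and> \<hh> \<subseteq> spV \<and> finite_type \<hh>
           \<longrightarrow> dim \<hh> \<le> 4)"
proof (intro conjI allI impI ballI)
  fix \<hh> assume "lie_subalgebra \<hh> \<and> \<hh> \<subseteq> spV"
  then show "infinite_type \<hh> \<or> (\<exists>\<gg>\<in>finite_type_list. \<exists>S\<in>SpV. \<hh> \<subseteq> conjugate S \<gg>)"
    using listed_elliptic_subalgebra[OF finite_type_elliptic_subalgebra] unfolding infinite_type_def listed_def
      by blast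
next
  fix \<gg> assume "\<gg> \<in> finite_type_list"
  then obtain S \<kk> where S: "S \<in> SpV" and g: "\<gg> = conjugate S \<kk>"
    and k: "\<kk> \<in> {u2, gl_std, u11_std, sl24_std, cartan_std, D_std 2, D_std (-2), line_algebra 1, line_algebra (-1)}"
    using finite_type_list_conj by blast
  have "maximal_elliptic u2" "maximal_elliptic gl_std" "maximal_elliptic u11_std"
    by (rule maximal_elliptic_dim_4, simp_all add: lie_subalgebra_std std_subset_spV trivial_prolongation_u2 trivial_prolongation_gl_std trivial_prolongation_u11_std dim_u2 dim_gl_std dim_u11_std)+
  then have "maximal_elliptic \<kk>"
    using k maximal_elliptic_sl24_std maximal_elliptic_cartan_std maximal_elliptic_D_std[of 2] maximal_elliptic_D_std[of "-2"] maximal_elliptic_line[of 1] maximal_elliptic_line[of "-1"]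
    by auto
  then show "maximal_finite_type \<gg>" unfolding g
    by (intro maximal_elliptic_maximal maximal_elliptic_conjugate[OF S])
next
  fix \<hh> assume "lie_subalgebra \<hh> \<and> \<hh> \<subseteq> spV \<and> finite_type \<hh>"
  then show "dim \<hh> \<le> 4" using elliptic_subalgebra_dim[OF finite_type_elliptic_subalgebra] by blast
qed

end
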